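(* Let $R$ be a parabolic open Riemann surface, let $N$ be an oriented Riemannian surface and let $\phi:R\to N$ be a harmonic local diffeomorphism. Suppose either that $N$ has Gaussian curvature $K_N>0$, or that $K_N\geq 0$ and $N$ has no flat (non-empty) open subset. Then $\phi$ is either holomorphic or antiholomorphic.
   Context: An open Riemann surface is a (connected) non-compact Riemann surface without boundary; it is called hyperbolic if it carries non-constant negative subharmonic functions, and parabolic otherwise. The oriented Riemannian surface $N$ is regarded as a Riemann surface with the complex structure determined by its metric and orientation. An open subset of $N$ is flat if $K_N\equiv 0$ on it. A smooth map $f:(S,g)\to(N,h)$ between Riemannian manifolds is harmonic if it is a critical point of the energy $E_\Omega(f)=\frac12\int_\Omega|df|^2\,dV_g$ with respect to smooth variations supported in $\Omega$, for every relatively compact domain $\Omega\subset S$. When $S$ is $2$-dimensional this depends only on the conformal class of $g$, so harmonicity of a map from a Riemann surface into a Riemannian manifold is well defined. *)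

theory Defs
  imports "HOL-Complex_Analysis.Complex_Analysis"
begin

section \<open>Smooth functions on open sets\<close>

primrec Ck_on :: "nat \<Rightarrow> 'a set \<Rightarrow> ('a::real_normed_vector \<Rightarrow> 'b::real_normed_vector) \<Rightarrow> bool" where
  "Ck_on 0 S f \<longleftrightarrow> continuous_on S f"
| "Ck_on (Suc k) S f \<longleftrightarrow>
     (\<forall>x\<in>S. f differentiable (at x)) \<and> (\<forall>v. Ck_on k S (\<lambda>x. frechet_derivative f (at x) v))"

definition smooth_on :: "'a set \<Rightarrow> ('a::real_normed_vector \<Rightarrow> 'b::real_normed_vector) \<Rightarrow> bool" where
  "smooth_on S f \<longleftrightarrow> (\<forall>k. Ck_on k S f)"

definition pderiv_at :: "'n \<Rightarrow> (real ^ 'n::finite \<Rightarrow> real) \<Rightarrow> real ^ 'n \<Rightarrow> real" where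
  "pderiv_at i f x = frechet_derivative f (at x) (axis i 1)"


section \<open>Atlases\<close>

text \<open>A chart with values in the model space \<open>'e\<close> is a pair \<open>(U, y)\<close> of an open set and a
  coordinate function; only the values of \<open>y\<close> on \<open>U\<close> matter.\<close>

type_synonym ('a, 'e) chart = "'a set \<times> ('a \<Rightarrow> 'e)"

record ('a, 'e) manifold =
  mtop :: "'a topology"
  charts :: "('a, 'e) chart set"

definition chart_image :: "('a, 'e) chart \<Rightarrow> 'e set" where
  "chart_image c = snd c ` fst c"

definition chart_inv :: "('a, 'e) chart \<Rightarrow> 'e \<Rightarrow> 'a" where
  "chart_inv c = inv_into (fst c) (snd c)"

definition is_chart :: "'a topology \<Rightarrow> ('a, 'e::topological_space) chart \<Rightarrow> bool" where
  "is_chart X c \<longleftrightarrow> openin X (fst c) \<and> open (chart_image c) \<and>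
     homeomorphic_map (subtopology X (fst c)) (top_of_set (chart_image c)) (snd c)"

text \<open>The expression of \<open>f\<close> in the charts \<open>c\<close> (source) and \<open>d\<close> (target), and its domain.\<close>

definition local_rep :: "('a, 'e) chart \<Rightarrow> ('b, 'f) chart \<Rightarrow> ('a \<Rightarrow> 'b) \<Rightarrow> 'e \<Rightarrow> 'f" where
  "local_rep c d f = snd d \<circ> f \<circ> chart_inv c"

definition local_dom :: "('a, 'e) chart \<Rightarrow> ('b, 'f) chart \<Rightarrow> ('a \<Rightarrow> 'b) \<Rightarrow> 'e set" where
  "local_dom c d f = snd c ` (fst c \<inter> f -` fst d)"

definition maximal_atlas ::
    "(('a, 'e::topological_space) chart \<Rightarrow> ('a, 'e) chart \<Rightarrow> bool) \<Rightarrow> ('a, 'e, 'z) manifold_scheme \<Rightarrow> bool" where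
  "maximal_atlas rel M \<longleftrightarrow>
     (\<forall>c\<in>charts M. is_chart (mtop M) c) \<and>
     (\<Union>c\<in>charts M. fst c) = topspace (mtop M) \<and>
     (\<forall>c\<in>charts M. \<forall>d\<in>charts M. rel c d) \<and>
     (\<forall>c. is_chart (mtop M) c \<and> (\<forall>d\<in>charts M. rel c d \<and> rel d c) \<longrightarrow> c \<in> charts M)"

definition chart_at :: "('a, 'e, 'z) manifold_scheme \<Rightarrow> 'a \<Rightarrow> ('a, 'e) chart" where
  "chart_at M p = (SOME c. c \<in> charts M \<and> p \<in> fst c)"

definition open_part :: "('a, 'e, 'z) manifold_scheme \<Rightarrow> 'a set \<Rightarrow> ('a, 'e) manifold" where
  "open_part M W =
     \<lparr>mtop = subtopology (mtop M) W, charts = {(fst c \<inter> W, snd c) |c. c \<in> charts M}\<rparr>"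


section \<open>Smooth maps and local diffeomorphisms\<close>

definition smooth_map ::
    "('a, 'e::real_normed_vector, 'y) manifold_scheme \<Rightarrow>
     ('b, 'f::real_normed_vector, 'z) manifold_scheme \<Rightarrow> ('a \<Rightarrow> 'b) \<Rightarrow> bool" where
  "smooth_map M N f \<longleftrightarrow> continuous_map (mtop M) (mtop N) f \<and>
     (\<forall>c\<in>charts M. \<forall>d\<in>charts N. smooth_on (local_dom c d f) (local_rep c d f))"

definition diffeomorphism ::
    "('a, 'e::real_normed_vector, 'y) manifold_scheme \<Rightarrow>
     ('b, 'f::real_normed_vector, 'z) manifold_scheme \<Rightarrow> ('a \<Rightarrow> 'b) \<Rightarrow> bool" where
  "diffeomorphism M N f \<longleftrightarrow> smooth_map M N f \<and>
     (\<exists>g. smooth_map N M g \<and> (\<forall>p\<in>topspace (mtop M). g (f p) = p) \<and>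
          (\<forall>q\<in>topspace (mtop N). f (g q) = q))"

definition local_diffeomorphism ::
    "('a, 'e::real_normed_vector, 'y) manifold_scheme \<Rightarrow>
     ('b, 'f::real_normed_vector, 'z) manifold_scheme \<Rightarrow> ('a \<Rightarrow> 'b) \<Rightarrow> bool" where
  "local_diffeomorphism M N f \<longleftrightarrow>
     (\<forall>p\<in>topspace (mtop M). \<exists>W V. openin (mtop M) W \<and> openin (mtop N) V \<and> p \<in> W \<and>
        diffeomorphism (open_part M W) (open_part N V) f)"


section \<open>Riemann surfaces\<close>

type_synonym 'a complex_curve = "('a, complex) manifold"

definition holo_compat :: "('a, complex) chart \<Rightarrow> ('a, complex) chart \<Rightarrow> bool" where
  "holo_compat c d \<longleftrightarrow> local_rep c d id holomorphic_on local_dom c d id"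

definition riemann_surface :: "'a complex_curve \<Rightarrow> bool" where
  "riemann_surface R \<longleftrightarrow> Hausdorff_space (mtop R) \<and> connected_space (mtop R) \<and>
     topspace (mtop R) \<noteq> {} \<and> maximal_atlas holo_compat R"

definition open_riemann_surface :: "'a complex_curve \<Rightarrow> bool" where
  "open_riemann_surface R \<longleftrightarrow> riemann_surface R \<and> \<not> compact_space (mtop R)"

definition holomorphic_map :: "'a complex_curve \<Rightarrow> 'b complex_curve \<Rightarrow> ('a \<Rightarrow> 'b) \<Rightarrow> bool" where
  "holomorphic_map R S f \<longleftrightarrow> continuous_map (mtop R) (mtop S) f \<and>
     (\<forall>p\<in>topspace (mtop R). \<exists>c\<in>charts R. \<exists>d\<in>charts S. p \<in> fst c \<and> f p \<in> fst d \<and>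
        local_rep c d f holomorphic_on local_dom c d f)"

definition antiholomorphic_map :: "'a complex_curve \<Rightarrow> 'b complex_curve \<Rightarrow> ('a \<Rightarrow> 'b) \<Rightarrow> bool" where
  "antiholomorphic_map R S f \<longleftrightarrow> continuous_map (mtop R) (mtop S) f \<and>
     (\<forall>p\<in>topspace (mtop R). \<exists>c\<in>charts R. \<exists>d\<in>charts S. p \<in> fst c \<and> f p \<in> fst d \<and>
        (cnj \<circ> local_rep c d f) holomorphic_on local_dom c d f)"

definition laplacian :: "(complex \<Rightarrow> real) \<Rightarrow> complex \<Rightarrow> real" where
  "laplacian h z =
     (\<Sum>b\<in>Basis. frechet_derivative (\<lambda>w. frechet_derivative h (at w) b) (at z) b)"

definition harmonic_function_on :: "complex set \<Rightarrow> (complex \<Rightarrow> real) \<Rightarrow> bool" where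
  "harmonic_function_on S h \<longleftrightarrow> Ck_on 2 S h \<and> (\<forall>z\<in>S. laplacian h z = 0)"

text \<open>Upper semicontinuous functions with values in \<open>[-\<infinity>, \<infinity>)\<close> that, on every closed coordinate
  disc, lie below every harmonic function which dominates them on the boundary circle.\<close>

definition subharmonic :: "'a complex_curve \<Rightarrow> ('a \<Rightarrow> ereal) \<Rightarrow> bool" where
  "subharmonic R u \<longleftrightarrow>
     (\<forall>p\<in>topspace (mtop R). u p < \<infinity>) \<and>
     (\<forall>a. openin (mtop R) {p \<in> topspace (mtop R). u p < a}) \<and>
     (\<forall>c\<in>charts R. \<forall>z r h.
        0 < r \<and> cball z r \<subseteq> chart_image c \<and>
        continuous_on (cball z r) h \<and> harmonic_function_on (ball z r) h \<and>
        (\<forall>w\<in>sphere z r. u (chart_inv c w) \<le> ereal (h w)) \<longrightarrow>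
        (\<forall>w\<in>ball z r. u (chart_inv c w) \<le> ereal (h w)))"

definition hyperbolic_surface :: "'a complex_curve \<Rightarrow> bool" where
  "hyperbolic_surface R \<longleftrightarrow> open_riemann_surface R \<and>
     (\<exists>u. subharmonic R u \<and> (\<forall>p\<in>topspace (mtop R). u p < 0) \<and>
          \<not> (\<exists>k. \<forall>p\<in>topspace (mtop R). u p = k))"

definition parabolic_surface :: "'a complex_curve \<Rightarrow> bool" where
  "parabolic_surface R \<longleftrightarrow> open_riemann_surface R \<and> \<not> hyperbolic_surface R"


section \<open>Oriented Riemannian manifolds\<close>

text \<open>The metric is given by its coefficient matrix \<open>metric M c x\<close> at the point with coordinates
  \<open>x\<close> in the chart \<open>c\<close>.  The orientation is contained in the choice of the maximal atlas,
  whose coordinate changes have positive Jacobian determinant.\<close>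

record ('a, 'n) riemannian = "('a, real ^ 'n) manifold" +
  metric :: "('a, real ^ 'n) chart \<Rightarrow> real ^ 'n \<Rightarrow> real ^ 'n ^ 'n"

definition oriented_compat ::
    "('a, real ^ 'n::finite) chart \<Rightarrow> ('a, real ^ 'n) chart \<Rightarrow> bool" where
  "oriented_compat c d \<longleftrightarrow> smooth_on (local_dom c d id) (local_rep c d id) \<and>
     (\<forall>x\<in>local_dom c d id. 0 < det (jacobian (local_rep c d id) (at x)))"

definition oriented_riemannian_manifold :: "('a, 'n::finite) riemannian \<Rightarrow> bool" where
  "oriented_riemannian_manifold M \<longleftrightarrow>
     Hausdorff_space (mtop M) \<and> second_countable (mtop M) \<and> maximal_atlas oriented_compat M \<and>
     (\<forall>c\<in>charts M. smooth_on (chart_image c) (metric M c) \<and>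
        (\<forall>x\<in>chart_image c. transpose (metric M c x) = metric M c x \<and>
           (\<forall>v. v \<noteq> 0 \<longrightarrow> 0 < v \<bullet> (metric M c x *v v)))) \<and>
     (\<forall>c\<in>charts M. \<forall>d\<in>charts M. \<forall>x\<in>local_dom c d id.
        metric M c x =
          transpose (jacobian (local_rep c d id) (at x)) ** metric M d (local_rep c d id x) **
          jacobian (local_rep c d id) (at x))"

abbreviation oriented_riemannian_surface :: "('a, 2) riemannian \<Rightarrow> bool" where
  "oriented_riemannian_surface \<equiv> oriented_riemannian_manifold"


subsection \<open>Gaussian curvature\<close>

text \<open>\<open>christoffel G k i j\<close> is \<open>\<Gamma>\<^sup>k\<^sub>i\<^sub>j\<close>, and \<open>curvature_tensor G l i j k\<close> is the \<open>l\<close>-th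
  component of \<open>R(\<partial>\<^sub>i, \<partial>\<^sub>j)\<partial>\<^sub>k\<close>, where
  \<open>R(X, Y)Z = \<nabla>\<^sub>X\<nabla>\<^sub>Y Z - \<nabla>\<^sub>Y\<nabla>\<^sub>X Z - \<nabla>\<^bsub>[X, Y]\<^esub> Z\<close>.\<close>

definition christoffel ::
    "(real ^ 'n::finite \<Rightarrow> real ^ 'n ^ 'n) \<Rightarrow> 'n \<Rightarrow> 'n \<Rightarrow> 'n \<Rightarrow> real ^ 'n \<Rightarrow> real" where
  "christoffel G k i j x = (1 / 2) * (\<Sum>l\<in>UNIV. matrix_inv (G x) $ k $ l *
     (pderiv_at i (\<lambda>y. G y $ j $ l) x + pderiv_at j (\<lambda>y. G y $ i $ l) x
      - pderiv_at l (\<lambda>y. G y $ i $ j) x))"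

definition curvature_tensor ::
    "(real ^ 'n::finite \<Rightarrow> real ^ 'n ^ 'n) \<Rightarrow> 'n \<Rightarrow> 'n \<Rightarrow> 'n \<Rightarrow> 'n \<Rightarrow> real ^ 'n \<Rightarrow> real" where
  "curvature_tensor G l i j k x =
     pderiv_at i (christoffel G l j k) x - pderiv_at j (christoffel G l i k) x
     + (\<Sum>m\<in>UNIV. christoffel G m j k x * christoffel G l i m x
                 - christoffel G m i k x * christoffel G l j m x)"

text \<open>\<open>\<langle>R(\<partial>\<^sub>1, \<partial>\<^sub>2)\<partial>\<^sub>2, \<partial>\<^sub>1\<rangle> / det G\<close>, evaluated in some chart around the point; the value does
  not depend on the chart.\<close>

definition gauss_curvature :: "('a, 2) riemannian \<Rightarrow> 'a \<Rightarrow> real" where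
  "gauss_curvature M p =
     (let c = chart_at M p; G = metric M c; x = snd c p
      in (\<Sum>l\<in>UNIV. G x $ l $ 1 * curvature_tensor G l 1 2 2 x) / det (G x))"

definition flat_on :: "('a, 2) riemannian \<Rightarrow> 'a set \<Rightarrow> bool" where
  "flat_on M V \<longleftrightarrow> (\<forall>p\<in>V. gauss_curvature M p = 0)"


subsection \<open>The Riemann surface determined by metric and orientation\<close>

definition vec_to_complex :: "real ^ 2 \<Rightarrow> complex" where
  "vec_to_complex v = Complex (v $ 1) (v $ 2)"

text \<open>The holomorphic charts are the positively oriented isothermal charts, in which the metric
  has the form \<open>\<lambda> (dx\<^sup>2 + dy\<^sup>2)\<close>.  As \<open>charts M\<close> is maximal, it already contains all of these.\<close>

definition underlying_curve :: "('a, 2) riemannian \<Rightarrow> 'a complex_curve" where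
  "underlying_curve M =
     \<lparr>mtop = mtop M,
      charts = {(fst c, vec_to_complex \<circ> snd c) |c. c \<in> charts M \<and>
                  (\<forall>x\<in>chart_image c. \<exists>l. metric M c x = l *\<^sub>R mat 1)}\<rparr>"


section \<open>Harmonic maps\<close>

text \<open>The requirement determines \<open>\<mu>\<close>, since the charts cover and the topology is second countable.\<close>

definition is_volume_measure :: "('a, 'n::finite) riemannian \<Rightarrow> 'a measure \<Rightarrow> bool" where
  "is_volume_measure M \<mu> \<longleftrightarrow>
     space \<mu> = topspace (mtop M) \<and>
     sets \<mu> = sigma_sets (topspace (mtop M)) {U. openin (mtop M) U} \<and>
     (\<forall>c\<in>charts M. \<forall>A\<in>sets \<mu>. A \<subseteq> fst c \<longrightarrow>
        emeasure \<mu> A = (\<integral>\<^sup>+x\<in>snd c ` A. ennreal (sqrt (det (metric M c x))) \<partial>lborel))"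

text \<open>\<open>|df|\<^sup>2 = g\<^sup>i\<^sup>j h\<^sub>a\<^sub>b \<partial>\<^sub>i f\<^sup>a \<partial>\<^sub>j f\<^sup>b\<close>, evaluated in some charts around the point and its image;
  the value does not depend on the charts.\<close>

definition diff_norm_sq ::
    "('a, 'm::finite) riemannian \<Rightarrow> ('b, 'n::finite) riemannian \<Rightarrow> ('a \<Rightarrow> 'b) \<Rightarrow> 'a \<Rightarrow> real" where
  "diff_norm_sq M N f p =
     (let c = chart_at M p; d = chart_at N (f p); x = snd c p; J = jacobian (local_rep c d f) (at x)
      in trace (matrix_inv (metric M c x) ** (transpose J ** metric N d (snd d (f p)) ** J)))"

definition energy ::
    "('a, 'm::finite) riemannian \<Rightarrow> ('b, 'n::finite) riemannian \<Rightarrow> 'a measure \<Rightarrow> 'a set \<Rightarrow>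
     ('a \<Rightarrow> 'b) \<Rightarrow> real" where
  "energy M N \<mu> \<Omega> f = (1 / 2) * (LINT p:\<Omega>|\<mu>. diff_norm_sq M N f p)"

definition relatively_compact_domain :: "'a topology \<Rightarrow> 'a set \<Rightarrow> bool" where
  "relatively_compact_domain X \<Omega> \<longleftrightarrow>
     openin X \<Omega> \<and> connectedin X \<Omega> \<and> compactin X (X closure_of \<Omega>)"

text \<open>The product manifold \<open>(-\<epsilon>, \<epsilon>) \<times> M\<close>.\<close>

definition cylinder ::
    "real \<Rightarrow> ('a, 'e::real_normed_vector, 'z) manifold_scheme \<Rightarrow> (real \<times> 'a, real \<times> 'e) manifold" where
  "cylinder \<epsilon> M =
     \<lparr>mtop = prod_topology (top_of_set {-\<epsilon><..<\<epsilon>}) (mtop M),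
      charts = {({-\<epsilon><..<\<epsilon>} \<times> fst c, map_prod id (snd c)) |c. c \<in> charts M}\<rparr>"

definition smooth_variation ::
    "('a, 'e::real_normed_vector, 'y) manifold_scheme \<Rightarrow>
     ('b, 'f::real_normed_vector, 'z) manifold_scheme \<Rightarrow>
     ('a \<Rightarrow> 'b) \<Rightarrow> 'a set \<Rightarrow> real \<Rightarrow> (real \<Rightarrow> 'a \<Rightarrow> 'b) \<Rightarrow> bool" where
  "smooth_variation M N f \<Omega> \<epsilon> F \<longleftrightarrow> 0 < \<epsilon> \<and>
     smooth_map (cylinder \<epsilon> M) N (\<lambda>(t, p). F t p) \<and>
     (\<forall>p\<in>topspace (mtop M). F 0 p = f p) \<and>
     (\<exists>K. compactin (mtop M) K \<and> K \<subseteq> \<Omega> \<and>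
        (\<forall>t\<in>{-\<epsilon><..<\<epsilon>}. \<forall>p\<in>topspace (mtop M) - K. F t p = f p))"

definition harmonic_map ::
    "('a, 'm::finite) riemannian \<Rightarrow> ('b, 'n::finite) riemannian \<Rightarrow> ('a \<Rightarrow> 'b) \<Rightarrow> bool" where
  "harmonic_map M N f \<longleftrightarrow> smooth_map M N f \<and>
     (\<exists>\<mu>. is_volume_measure M \<mu> \<and>
        (\<forall>\<Omega> \<epsilon> F. relatively_compact_domain (mtop M) \<Omega> \<and> smooth_variation M N f \<Omega> \<epsilon> F \<longrightarrow>
           ((\<lambda>t. energy M N \<mu> \<Omega> (F t)) has_real_derivative 0) (at 0)))"

text \<open>Harmonicity of a map from a Riemann surface refers to a metric in the given conformal class;
  by conformal invariance of the energy the choice is immaterial.\<close>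

definition harmonic_map_from_curve ::
    "'a complex_curve \<Rightarrow> ('b, 'n::finite) riemannian \<Rightarrow> ('a \<Rightarrow> 'b) \<Rightarrow> bool" where
  "harmonic_map_from_curve R N f \<longleftrightarrow>
     (\<exists>M :: ('a, 2) riemannian. oriented_riemannian_surface M \<and> underlying_curve M = R \<and>
        harmonic_map M N f)"

end

theory Submission
  imports Defs
begin

text \<open>In local coordinates let \<open>a\<close> and \<open>b\<close> be the components of \<open>\<partial>\<phi>\<close> and of the antiholomorphic
  derivative of \<open>\<phi>\<close>.  Varying \<open>\<phi>\<close> by \<open>\<phi> \<circ> \<psi>\<^sub>t\<close> with \<open>\<psi>\<^sub>t\<close> a compactly supported deformation of
  the domain shows that the stress-energy tensor is divergence free; since \<open>\<phi>\<close> is a local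
  diffeomorphism this forces the tension field to vanish.  The Bochner formula then reads
  \<open>\<Delta> ln (|b|\<^sup>2 / |a|\<^sup>2) = 4 K J\<close> where \<open>J\<close> is the Jacobian, so the logarithm of the smaller of
  \<open>|b|\<^sup>2 / |a|\<^sup>2\<close> and its inverse is a negative subharmonic function (with value \<open>-\<infinity>\<close> at the zeros)
  because \<open>K \<ge> 0\<close>.  On a parabolic surface it is constant.  A finite constant would make \<open>K\<close> vanish
  on the open image of \<open>\<phi>\<close>; hence \<open>\<phi>\<close> is conformal everywhere, and by connectedness it has one
  orientation.  Isothermal charts of \<open>N\<close> are never assumed to exist: where they are needed, \<open>\<phi>\<close>
  transports them from \<open>R\<close>.\<close>

text \<open>Deformations of the domain test the tension field only against the vectors d\<phi>(e_k);
  these span the tangent space because \<phi> is a local diffeomorphism. In return the energy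
  density involves nothing but the pullback metric. The target is treated in an arbitrary chart
  through the frame vector \<open>\<partial>\<^sub>1\<close>, over the complex numbers. Its
  connection form \<theta> is complex: Re \<theta> is half of d ln E with E the square length of
  \<open>\<partial>\<^sub>1\<close>, and d\<theta> is -i K times the area form. Harmonicity becomes
  first order: \<open>a\<close> solves a Cauchy-Riemann equation perturbed by the pullback of
  \<theta>, and the conjugate of \<open>b\<close> solves the one perturbed by the conjugate of
  \<theta>. Hence ln |a|^2 and ln |b|^2 have Laplacians -D - C and -D + C. The term D depends on the
  frame but cancels in the quotient, while C = 2 K J doubles; this is the origin of the factor 4.
  The difference |a|^2 - |b|^2 has the sign of J, so it never vanishes. This makes the smaller
  quotient less than 1 and its logarithm negative, and it decides at the end between holomorphic and
  antiholomorphic.\<close>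

no_notation fps_nth (infixl "$" 75)

section \<open>Calculus of smooth functions\<close>

lemma Ck_on_subset: "Ck_on k S f \<Longrightarrow> T \<subseteq> S \<Longrightarrow> Ck_on k T f"
  by (induction k arbitrary: f) (auto intro: continuous_on_subset)

text \<open>The derivatives in \<open>Ck_on\<close> are full derivatives at the points of
  \<open>S\<close>; openness of \<open>S\<close> makes them depend on the values on \<open>S\<close>
  alone.\<close>

lemma Ck_on_cong:
  assumes "open S" "\<And>x. x \<in> S \<Longrightarrow> f x = g x" "Ck_on k S f"
  shows "Ck_on k S g"
  using assms(2,3)
proof (induction k arbitrary: f g)
  case 0
  then show ?case by (simp cong: continuous_on_cong)
next
  case (Suc k)
  have d: "(f has_derivative frechet_derivative f (at x)) (at x)" if "x \<in> S" for x
    using Suc.prems that by (simp add: frechet_derivative_works)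
  have d': "(g has_derivative frechet_derivative f (at x)) (at x)" if "x \<in> S" for x
    by (rule has_derivative_transform_within_open[OF d[OF that] \<open>open S\<close> that]) (use Suc.prems in auto)
  have e: "frechet_derivative f (at x) = frechet_derivative g (at x)" if "x \<in> S" for x
    using frechet_derivative_at[OF d'[OF that]] .
  have "Ck_on k S (\<lambda>x. frechet_derivative g (at x) v)" for v
    by (rule Suc.IH[of "\<lambda>x. frechet_derivative f (at x) v"]) (use e Suc.prems in auto)
  then show ?case using d' by (auto simp: differentiable_def)
qed

text \<open>Introduction rule with a freely chosen formula for the derivative, which uniqueness
  identifies with \<open>frechet_derivative\<close>.\<close>

lemma Ck_on_SucI:
  assumes "open S" "\<And>x. x \<in> S \<Longrightarrow> (f has_derivative f' x) (at x)"
    "\<And>v. Ck_on k S (\<lambda>x. f' x v)"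
  shows "Ck_on (Suc k) S f"
proof -
  have e: "f' x = frechet_derivative f (at x)" if "x \<in> S" for x
    using frechet_derivative_at[OF assms(2)[OF that]] .
  have "Ck_on k S (\<lambda>x. frechet_derivative f (at x) v)" for v
    by (rule Ck_on_cong[OF assms(1) _ assms(3)[of v]]) (simp add: e)
  then show ?thesis using assms(2) by (auto simp: differentiable_def)
qed

lemma Ck_on_has_derivative:
  "Ck_on (Suc k) S f \<Longrightarrow> x \<in> S \<Longrightarrow> (f has_derivative frechet_derivative f (at x)) (at x)"
  by (simp add: frechet_derivative_works)

lemma Ck_on_Suc_imp: "Ck_on (Suc k) S f \<Longrightarrow> Ck_on k S f"
proof (induction k arbitrary: f)
  case 0
  then show ?case
    by (auto intro!: continuous_at_imp_continuous_on differentiable_imp_continuous_within)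
next
  case (Suc k)
  then show ?case by simp
qed

lemma Ck_on_imp_continuous: "Ck_on k S f \<Longrightarrow> continuous_on S f"
  by (induction k) (auto dest: Ck_on_Suc_imp simp del: Ck_on.simps(2))

lemma Ck_on_const: "Ck_on k S (\<lambda>x. c)"
  by (induction k arbitrary: c) auto

lemma Ck_on_bounded_linear:
  assumes "bounded_linear f" "open S" shows "Ck_on k S f"
proof (cases k)
  case 0
  then show ?thesis using assms by (simp add: linear_continuous_on)
next
  case (Suc m)
  show ?thesis unfolding Suc
    by (rule Ck_on_SucI[where f' = "\<lambda>_. f"])
      (use assms in \<open>auto intro: bounded_linear_imp_has_derivative Ck_on_const\<close>)
qed

text \<open>Serves for functions given by different formulas on overlapping open sets, such as
  cut-off products and transplanted variations.\<close>

lemma Ck_on_local: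
  assumes "\<And>x. x \<in> S \<Longrightarrow> \<exists>A. open A \<and> x \<in> A \<and> Ck_on k A f"
  shows "Ck_on k S f"
  using assms
proof (induction k arbitrary: f)
  case 0
  have "continuous (at x within S) f" if "x \<in> S" for x
    using 0[OF that] by (auto simp: continuous_on_eq_continuous_at continuous_at_imp_continuous_at_within)
  then show ?case by (simp add: continuous_on_eq_continuous_within)
next
  case (Suc k)
  have "f differentiable (at x)" if "x \<in> S" for x using Suc.prems[OF that] by auto
  moreover have "Ck_on k S (\<lambda>x. frechet_derivative f (at x) v)" for v
    by (rule Suc.IH) (use Suc.prems in fastforce)
  ultimately show ?case by simp
qed

lemma Ck_on_add:
  assumes "open S" "Ck_on k S f" "Ck_on k S g" shows "Ck_on k S (\<lambda>x. f x + g x)"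
  using assms(2,3)
proof (induction k arbitrary: f g)
  case 0 then show ?case by (auto intro: continuous_intros)
next
  case (Suc k)
  show ?case
    by (rule Ck_on_SucI[OF \<open>open S\<close> has_derivative_add[OF Ck_on_has_derivative[OF Suc.prems(1)] Ck_on_has_derivative[OF Suc.prems(2)]]])
      (use Suc in auto)
qed

lemma Ck_on_bilinear:
  assumes B: "bounded_bilinear B" and "open S" "Ck_on k S f" "Ck_on k S g"
  shows "Ck_on k S (\<lambda>x. B (f x) (g x))"
  using assms(3,4)
proof (induction k arbitrary: f g)
  case 0 then show ?case by (auto intro: bounded_bilinear.continuous_on[OF B])
next
  case (Suc k)
  have fg: "Ck_on k S f" "Ck_on k S g" using Suc.prems by (blast intro: Ck_on_Suc_imp)+
  show ?case
    by (rule Ck_on_SucI[OF \<open>open S\<close> bounded_bilinear.FDERIV[OF B Ck_on_has_derivative[OF Suc.prems(1)] Ck_on_has_derivative[OF Suc.prems(2)]]])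
      (use Suc fg in \<open>auto intro!: Ck_on_add \<open>open S\<close>\<close>)
qed

lemma Ck_on_sum:
  assumes "open S" "\<And>i. i \<in> I \<Longrightarrow> Ck_on k S (f i)"
  shows "Ck_on k S (\<lambda>x. \<Sum>i\<in>I. f i x)"
  using assms(2)
proof (induction I rule: infinite_finite_induct)
  case (insert i I)
  then show ?case by (simp add: Ck_on_add[OF assms(1)])
qed (simp_all add: Ck_on_const)

lemma Ck_on_linear_compose:
  assumes L: "bounded_linear L" and "open S" "Ck_on k S f"
  shows "Ck_on k S (\<lambda>x. L (f x))"
  using assms(3)
proof (induction k arbitrary: f)
  case 0 then show ?case by (auto intro: continuous_on_compose2[OF linear_continuous_on[OF L, of UNIV]])
next
  case (Suc k)
  show ?case
    by (rule Ck_on_SucI[OF \<open>open S\<close> bounded_linear.has_derivative[OF L Ck_on_has_derivative[OF Suc.prems(1)]]])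
      (use Suc in auto)
qed

text \<open>The induction hypothesis covers the derivative of \<open>g\<close> in a fixed direction,
  whereas in the chain rule the direction moves with \<open>x\<close>. Expanding in
  \<open>Basis\<close> separates the two: finitely many fixed directions, with coefficients that are
  again \<open>Ck_on k\<close>.\<close>

lemma Ck_on_compose:
  fixes f :: "'a::real_normed_vector \<Rightarrow> 'b::euclidean_space" and g :: "'b \<Rightarrow> 'c::real_normed_vector"
  assumes "open S" "open T" "f ` S \<subseteq> T" "Ck_on k S f" "Ck_on k T g"
  shows "Ck_on k S (\<lambda>x. g (f x))"
  using assms(4,5)
proof (induction k arbitrary: g)
  case 0 then show ?case using assms(3) by (auto intro: continuous_on_compose2)
next
  case (Suc k)
  let ?f = "\<lambda>x. frechet_derivative f (at x)" and ?g = "\<lambda>y. frechet_derivative g (at y)"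
  have fT: "f x \<in> T" if "x \<in> S" for x using that assms(3) by auto
  have dg: "(g has_derivative ?g (f x)) (at (f x))" if "x \<in> S" for x
    using Suc.prems(2) fT[OF that] Ck_on_has_derivative by blast
  have eq: "?g (f x) (?f x v) = (\<Sum>b\<in>Basis. (?f x v \<bullet> b) *\<^sub>R ?g (f x) b)" if "x \<in> S" for x v
  proof -
    have "?g (f x) (\<Sum>b\<in>Basis. (?f x v \<bullet> b) *\<^sub>R b) = (\<Sum>b\<in>Basis. (?f x v \<bullet> b) *\<^sub>R ?g (f x) b)"
      using has_derivative_linear[OF dg[OF that]] by (simp add: linear_sum linear_cmul)
    then show ?thesis by (simp add: euclidean_representation)
  qed
  have Ckf: "Ck_on k S f" using Suc.prems(1) by (rule Ck_on_Suc_imp)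
  show ?case
  proof (rule Ck_on_SucI[OF \<open>open S\<close>])
    fix x assume x: "x \<in> S"
    show "((\<lambda>x. g (f x)) has_derivative (\<lambda>v. ?g (f x) (?f x v))) (at x)"
      by (rule has_derivative_compose[OF Ck_on_has_derivative[OF Suc.prems(1) x] dg[OF x]])
  next
    fix v
    have "Ck_on k S (\<lambda>x. (?f x v \<bullet> b) *\<^sub>R ?g (f x) b)" for b
    proof (rule Ck_on_bilinear[OF bounded_bilinear_scaleR \<open>open S\<close>])
      show "Ck_on k S (\<lambda>x. ?f x v \<bullet> b)"
        by (rule Ck_on_bilinear[OF bounded_bilinear_inner \<open>open S\<close>]) (use Suc.prems in \<open>auto intro: Ck_on_const\<close>)
      show "Ck_on k S (\<lambda>x. ?g (f x) b)"
        by (rule Suc.IH[OF Ckf]) (use Suc.prems in auto)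
    qed
    then have "Ck_on k S (\<lambda>x. \<Sum>b\<in>Basis. (?f x v \<bullet> b) *\<^sub>R ?g (f x) b)"
      by (intro Ck_on_sum \<open>open S\<close>)
    then show "Ck_on k S (\<lambda>x. ?g (f x) (?f x v))"
      by (rule Ck_on_cong[OF \<open>open S\<close>, rotated]) (simp add: eq)
  qed
qed

lemma smooth_on_subset: "smooth_on S f \<Longrightarrow> T \<subseteq> S \<Longrightarrow> smooth_on T f"
  unfolding smooth_on_def using Ck_on_subset by blast

lemma smooth_on_cong:
  assumes "open S" "\<And>x. x \<in> S \<Longrightarrow> f x = g x" "smooth_on S f"
  shows "smooth_on S g"
  using Ck_on_cong[of S f g, OF assms(1,2)] assms(3) unfolding smooth_on_def by blast

lemma smooth_on_local:
  assumes "\<And>x. x \<in> S \<Longrightarrow> \<exists>A. open A \<and> x \<in> A \<and> smooth_on A f"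
  shows "smooth_on S f"
  using assms unfolding smooth_on_def by (meson Ck_on_local)

lemma smooth_on_imp_continuous_on: "smooth_on S f \<Longrightarrow> continuous_on S f"
  unfolding smooth_on_def using Ck_on_imp_continuous by blast

lemma smooth_on_has_derivative:
  "smooth_on S f \<Longrightarrow> x \<in> S \<Longrightarrow> (f has_derivative frechet_derivative f (at x)) (at x)"
  unfolding smooth_on_def using Ck_on_has_derivative by blast

lemma smooth_on_frechet_derivative:
  "smooth_on S f \<Longrightarrow> smooth_on S (\<lambda>x. frechet_derivative f (at x) v)"
  unfolding smooth_on_def using Ck_on.simps(2) by blast

lemma smooth_on_differentiable: "smooth_on S f \<Longrightarrow> x \<in> S \<Longrightarrow> f differentiable (at x)"
  unfolding smooth_on_def by (meson Ck_on.simps(2))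

lemma smooth_on_const: "smooth_on S (\<lambda>x. c)"
  by (simp add: smooth_on_def Ck_on_const)

lemma smooth_on_bounded_linear: "bounded_linear f \<Longrightarrow> open S \<Longrightarrow> smooth_on S f"
  by (simp add: smooth_on_def Ck_on_bounded_linear)

lemma smooth_on_ident: "open S \<Longrightarrow> smooth_on S (\<lambda>x. x)"
  using smooth_on_bounded_linear[OF bounded_linear_ident] .

lemma smooth_on_linear_compose:
  "bounded_linear L \<Longrightarrow> open S \<Longrightarrow> smooth_on S f \<Longrightarrow> smooth_on S (\<lambda>x. L (f x))"
  by (simp add: smooth_on_def Ck_on_linear_compose)

lemma smooth_on_bilinear:
  "bounded_bilinear B \<Longrightarrow> open S \<Longrightarrow> smooth_on S f \<Longrightarrow> smooth_on S g \<Longrightarrow> smooth_on S (\<lambda>x. B (f x) (g x))"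
  by (simp add: smooth_on_def Ck_on_bilinear)

lemma smooth_on_add: "open S \<Longrightarrow> smooth_on S f \<Longrightarrow> smooth_on S g \<Longrightarrow> smooth_on S (\<lambda>x. f x + g x)"
  by (simp add: smooth_on_def Ck_on_add)

lemma smooth_on_uminus: "open S \<Longrightarrow> smooth_on S f \<Longrightarrow> smooth_on S (\<lambda>x. - f x)"
  by (rule smooth_on_linear_compose[OF bounded_linear_minus[OF bounded_linear_ident]])

lemma smooth_on_diff: "open S \<Longrightarrow> smooth_on S f \<Longrightarrow> smooth_on S g \<Longrightarrow> smooth_on S (\<lambda>x. f x - g x)"
  using smooth_on_add[of S f "\<lambda>x. - g x"] smooth_on_uminus[of S g] by simp

lemma smooth_on_sum:
  "open S \<Longrightarrow> (\<And>i. i \<in> I \<Longrightarrow> smooth_on S (f i)) \<Longrightarrow> smooth_on S (\<lambda>x. \<Sum>i\<in>I. f i x)"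
  by (simp add: smooth_on_def Ck_on_sum)

lemma smooth_on_mult:
  fixes f g :: "'a::real_normed_vector \<Rightarrow> 'b::real_normed_algebra"
  shows "open S \<Longrightarrow> smooth_on S f \<Longrightarrow> smooth_on S g \<Longrightarrow> smooth_on S (\<lambda>x. f x * g x)"
  by (rule smooth_on_bilinear[OF bounded_bilinear_mult])

lemma smooth_on_scaleR:
  "open S \<Longrightarrow> smooth_on S f \<Longrightarrow> smooth_on S g \<Longrightarrow> smooth_on S (\<lambda>x. f x *\<^sub>R g x)"
  by (rule smooth_on_bilinear[OF bounded_bilinear_scaleR])

lemma smooth_on_of_real:
  "open S \<Longrightarrow> smooth_on S f \<Longrightarrow> smooth_on S (\<lambda>x. of_real (f x) :: 'b::real_normed_algebra_1)"
  by (rule smooth_on_linear_compose[OF bounded_linear_of_real])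

lemma smooth_on_compose:
  fixes f :: "'a::real_normed_vector \<Rightarrow> 'b::euclidean_space" and g :: "'b \<Rightarrow> 'c::real_normed_vector"
  shows "open S \<Longrightarrow> open T \<Longrightarrow> f ` S \<subseteq> T \<Longrightarrow> smooth_on S f \<Longrightarrow> smooth_on T g \<Longrightarrow> smooth_on S (\<lambda>x. g (f x))"
  unfolding smooth_on_def using Ck_on_compose[of S T f _ g] by blast

lemma smooth_on_vec_nth:
  "open S \<Longrightarrow> smooth_on S f \<Longrightarrow> smooth_on S (\<lambda>x. f x $ i)"
  by (rule smooth_on_linear_compose[OF bounded_linear_vec_nth])

section \<open>Families closed under differentiation, and bump functions\<close>

lemma smooth_on_real_family:
  fixes f :: "'i \<Rightarrow> real \<Rightarrow> real"
  assumes "open S" and "\<And>i. \<exists>I c. finite I \<and> (\<forall>x\<in>S. (f i has_real_derivative (\<Sum>j\<in>I. c j * f j x)) (at x))"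
  shows "smooth_on S (f i)"
proof -
  \<comment> \<open>All members are treated at once: the derivative of each is a linear combination
    of members, to which the hypothesis for \<open>k\<close> applies.\<close>
  have "Ck_on k S (f i)" for k i
  proof (induction k arbitrary: i)
    case 0
    obtain I c where "\<And>x. x \<in> S \<Longrightarrow> (f i has_real_derivative (\<Sum>j\<in>I. c j * f j x)) (at x)"
      using assms(2)[of i] by blast
    then show ?case by (auto intro!: continuous_at_imp_continuous_on DERIV_isCont)
  next
    case (Suc k)
    obtain I c where D: "\<And>x. x \<in> S \<Longrightarrow> (f i has_real_derivative (\<Sum>j\<in>I. c j * f j x)) (at x)"
      using assms(2)[of i] by blast
    show ?case
    proof (rule Ck_on_SucI[OF \<open>open S\<close>])
      show "(f i has_derivative (\<lambda>v. (\<Sum>j\<in>I. c j * f j x) * v)) (at x)" if "x \<in> S" for x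
        using D[OF that] by (simp add: has_field_derivative_def)
      show "Ck_on k S (\<lambda>x. (\<Sum>j\<in>I. c j * f j x) * v)" for v
        by (intro Ck_on_bilinear[OF bounded_bilinear_mult] Ck_on_sum Ck_on_const Suc \<open>open S\<close>)
    qed
  qed
  then show ?thesis by (simp add: smooth_on_def)
qed

lemma smooth_on_powr: "smooth_on {0<..} (\<lambda>x::real. x powr p)"
proof (rule smooth_on_real_family)
  fix p :: real
  show "\<exists>I c. finite I \<and> (\<forall>x\<in>{0<..}. ((\<lambda>x. x powr p) has_real_derivative (\<Sum>q\<in>I. c q * x powr q)) (at x))"
    by (rule exI[of _ "{p - 1}"], rule exI[of _ "\<lambda>_. p"]) (auto intro!: derivative_eq_intros)
qed auto

lemma smooth_on_sqrt:
  assumes "open S" "smooth_on S f" "\<And>x. x \<in> S \<Longrightarrow> 0 < f x" shows "smooth_on S (\<lambda>x. sqrt (f x))"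
proof (rule smooth_on_cong[OF assms(1)])
  show "smooth_on S (\<lambda>x. f x powr (1/2))"
    by (rule smooth_on_compose[OF assms(1) _ _ assms(2) smooth_on_powr]) (use assms in auto)
qed (use assms in \<open>auto simp: powr_half_sqrt less_imp_le\<close>)

lemma smooth_on_inverse:
  fixes f :: "'a::real_normed_vector \<Rightarrow> real"
  assumes "open S" "smooth_on S f" "\<And>x. x \<in> S \<Longrightarrow> 0 < f x" shows "smooth_on S (\<lambda>x. inverse (f x))"
proof (rule smooth_on_cong[OF assms(1)])
  show "smooth_on S (\<lambda>x. f x powr (-1))"
    by (rule smooth_on_compose[OF assms(1) _ _ assms(2) smooth_on_powr]) (use assms in auto)
qed (use assms in \<open>auto simp: powr_minus less_imp_le\<close>)

lemma smooth_on_divide: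
  fixes f :: "'a::real_normed_vector \<Rightarrow> real"
  assumes "open S" "smooth_on S f" "smooth_on S g" "\<And>x. x \<in> S \<Longrightarrow> 0 < g x"
  shows "smooth_on S (\<lambda>x. f x / g x)"
  unfolding divide_inverse by (intro smooth_on_mult smooth_on_inverse assms)

text \<open>Each derivative of exp (- 1 / x) is a polynomial in 1 / x times exp (- 1 / x). Dividing
  by x ^ n therefore gives a family closed under differentiation up to linear combinations, as
  \<open>smooth_on_real_family\<close> requires.\<close>

definition flat_bump :: "nat \<Rightarrow> real \<Rightarrow> real" where
  "flat_bump n x = (if 0 < x then exp (- 1 / x) / x ^ n else 0)"

text \<open>From the right, y = 1 / x turns the function into y ^ n / exp y as y grows; from the
  left it is zero.\<close>

lemma flat_bump_limit: "((\<lambda>x. flat_bump n x) \<longlongrightarrow> 0) (at 0)"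
proof -
  have "((\<lambda>x::real. exp (- 1 / x) / x ^ n) \<longlongrightarrow> 0) (at_right 0)"
  proof -
    have "((\<lambda>x::real. x ^ n / exp x) \<longlongrightarrow> 0) at_top"
      by (rule tendsto_power_div_exp_0)
    then have "((\<lambda>x::real. (inverse x) ^ n / exp (inverse x)) \<longlongrightarrow> 0) (at_right 0)"
      by (rule filterlim_compose) (rule filterlim_inverse_at_top_right)
    then show ?thesis
      by (rule filterlim_cong[THEN iffD1, rotated -1]) 
        (auto simp: exp_minus field_simps intro!: always_eventually)
  qed
  then have "((\<lambda>x. flat_bump n x) \<longlongrightarrow> 0) (at_right 0)"
    by (rule Lim_transform_eventually) (auto simp: flat_bump_def eventually_at_right_less eventually_at_filter)
  moreover have "((\<lambda>x. flat_bump n x) \<longlongrightarrow> 0) (at_left 0)"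
    by (rule Lim_transform_eventually[OF tendsto_const]) (auto simp: flat_bump_def eventually_at_filter)
  ultimately show ?thesis by (simp add: filterlim_split_at)
qed

lemma flat_bump_derivative:
  "(flat_bump n has_real_derivative flat_bump (n + 2) x - n * flat_bump (n + 1) x) (at x)"
proof -
  consider "x < 0" | "x = 0" | "0 < x" by linarith
  then show ?thesis
  proof cases
    case 1
    have "((\<lambda>x. 0) has_real_derivative 0) (at x)" by simp
    then have "(flat_bump n has_real_derivative 0) (at x)"
      by (rule has_field_derivative_transform_within_open[of _ _ _ "{..<0}"])
        (use 1 in \<open>auto simp: flat_bump_def\<close>)
    then show ?thesis using 1 by (simp add: flat_bump_def)
  next
    case 2
    \<comment> \<open>At 0 the difference quotient of \<open>flat_bump n\<close> is
      \<open>flat_bump (n + 1)\<close>, whose limit is known to be 0.\<close>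
    have "((\<lambda>h. flat_bump n h / h) \<longlongrightarrow> 0) (at 0)"
      by (rule Lim_transform_eventually[OF flat_bump_limit[of "Suc n"]])
        (auto simp: flat_bump_def eventually_at_filter intro!: always_eventually)
    then show ?thesis using 2 by (simp add: DERIV_def flat_bump_def)
  next
    case 3
    have "((\<lambda>x. exp (- 1 / x) / x ^ n) has_real_derivative
        (exp (-1/x) * (1 / x^2) * x ^ n - exp (-1/x) * (real n * x ^ (n - 1))) / (x ^ n * x ^ n)) (at x)"
      using 3 by (auto intro!: derivative_eq_intros simp: power2_eq_square)
    also have "(exp (-1/x) * (1 / x^2) * x ^ n - exp (-1/x) * (real n * x ^ (n - 1))) / (x ^ n * x ^ n)
       = flat_bump (n + 2) x - n * flat_bump (n + 1) x"
      using 3 by (cases n) (simp_all add: flat_bump_def power2_eq_square field_simps)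
    finally show ?thesis
      by (rule has_field_derivative_transform_within_open[of _ _ _ "{0<..}"])
        (use 3 in \<open>auto simp: flat_bump_def\<close>)
  qed
qed

lemma smooth_on_flat_bump: "smooth_on UNIV (flat_bump n)"
proof (rule smooth_on_real_family)
  fix n :: nat
  show "\<exists>I c. finite I \<and> (\<forall>x\<in>UNIV. (flat_bump n has_real_derivative (\<Sum>j\<in>I. c j * flat_bump j x)) (at x))"
    by (rule exI[of _ "{n + 1, n + 2}"], rule exI[of _ "\<lambda>j. if j = n + 2 then 1 else - real n"])
      (use flat_bump_derivative in \<open>auto simp: algebra_simps\<close>)
qed auto

text \<open>\<open>flat_bump 0\<close> is composed with \<delta>^2 - |x - x0|^2, which is positive
  exactly on the ball. The exact description of the non-zero set later yields both the support and
  the positivity at the centre.\<close>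

lemma bump_exists:
  fixes x0 :: "'a::euclidean_space"
  assumes "0 < \<delta>"
  obtains \<eta> :: "'a \<Rightarrow> real" where "smooth_on UNIV \<eta>" "\<And>x. 0 \<le> \<eta> x" "\<And>x. \<eta> x \<noteq> 0 \<longleftrightarrow> dist x0 x < \<delta>"
proof
  let ?q = "\<lambda>x::'a. \<delta>^2 - (x - x0) \<bullet> (x - x0)"
  let ?\<eta> = "\<lambda>x. flat_bump 0 (?q x)"
  have "smooth_on UNIV ?q"
    by (intro smooth_on_diff smooth_on_const smooth_on_bilinear[OF bounded_bilinear_inner] smooth_on_ident open_UNIV)
  then show "smooth_on UNIV ?\<eta>"
    by (rule smooth_on_compose[OF open_UNIV open_UNIV _ _ smooth_on_flat_bump, rotated]) auto
  show "0 \<le> ?\<eta> x" for x by (simp add: flat_bump_def)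
  show "?\<eta> x \<noteq> 0 \<longleftrightarrow> dist x0 x < \<delta>" for x
  proof -
    have "dist x0 x < \<delta> \<longleftrightarrow> (dist x0 x)\<^sup>2 < \<delta>\<^sup>2"
      using assms by (metis abs_of_nonneg abs_of_pos power2_less_eq_zero_iff zero_le_dist abs_square_less_1 real_sqrt_abs real_sqrt_less_iff)
    also have "(dist x0 x)\<^sup>2 = (x - x0) \<bullet> (x - x0)"
      by (simp add: dist_norm power2_norm_eq_inner inner_diff algebra_simps)
    finally show ?thesis by (simp add: flat_bump_def)
  qed
qed

section \<open>Symmetry of second derivatives\<close>

lemma second_difference:
  fixes f :: "'a::real_normed_vector \<Rightarrow> real"
  assumes "Ck_on 2 (ball x d) f" "0 < t" "t * (norm v + norm w) < d"
  shows "\<exists>y. dist x y \<le> t * (norm v + norm w) \<and>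
    f (x + t *\<^sub>R v + t *\<^sub>R w) - f (x + t *\<^sub>R v) - f (x + t *\<^sub>R w) + f x =
      t\<^sup>2 * frechet_derivative (\<lambda>y. frechet_derivative f (at y) v) (at y) w"
proof -
  let ?f = "\<lambda>y. frechet_derivative f (at y)"
  let ?g = "\<lambda>y. frechet_derivative (\<lambda>y. ?f y v) (at y)"
  have C: "Ck_on (Suc (Suc 0)) (ball x d) f" using assms(1) by (simp add: numeral_2_eq_2)
  have df: "(f has_derivative ?f y) (at y)" if "y \<in> ball x d" for y
    using Ck_on_has_derivative[OF C that] .
  have dg: "((\<lambda>y. ?f y v) has_derivative ?g y) (at y)" if "y \<in> ball x d" for y
    by (rule Ck_on_has_derivative[OF _ that, where k = 0]) (use C in auto)
  have near: "dist x (x + a *\<^sub>R v + b *\<^sub>R w) \<le> t * (norm v + norm w)" if "0 \<le> a" "a \<le> t" "0 \<le> b" "b \<le> t" for a b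
  proof -
    have "dist x (x + a *\<^sub>R v + b *\<^sub>R w) = norm (a *\<^sub>R v + b *\<^sub>R w)"
      by (simp only: dist_norm norm_minus_commute[of x] add.assoc add_diff_cancel_left')
    also have "\<dots> \<le> a * norm v + b * norm w"
      by (rule order_trans[OF norm_triangle_ineq]) (use that in auto)
    also have "\<dots> \<le> t * (norm v + norm w)"
      using that by (simp add: distrib_left add_mono mult_right_mono)
    finally show ?thesis .
  qed
  have ball: "x + a *\<^sub>R v + b *\<^sub>R w \<in> ball x d" if "0 \<le> a" "a \<le> t" "0 \<le> b" "b \<le> t" for a b
    using near[OF that] assms(3) by simp
  \<comment> \<open>The mean value theorem in direction \<open>v\<close>, for the difference over
    \<open>t w\<close>, and then in direction \<open>w\<close> turns the mixed second difference
    into t^2 times a second derivative at a nearby point.\<close>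
  let ?h = "\<lambda>s. f (x + s *\<^sub>R v + t *\<^sub>R w) - f (x + s *\<^sub>R v + 0 *\<^sub>R w)"
  have ch: "((\<lambda>s. f (x + s *\<^sub>R v + b *\<^sub>R w)) has_real_derivative ?f (x + s *\<^sub>R v + b *\<^sub>R w) v) (at s)"
    if "0 \<le> s" "s \<le> t" "0 \<le> b" "b \<le> t" for s b
  proof -
    have "((\<lambda>s. x + s *\<^sub>R v + b *\<^sub>R w) has_derivative (\<lambda>h. h *\<^sub>R v)) (at s)"
      by (auto intro!: derivative_eq_intros)
    from has_derivative_compose[OF this df[OF ball[OF that]]]
    show ?thesis
      using linear_cmul[OF has_derivative_linear[OF df[OF ball[OF that]]]]
      by (simp add: has_field_derivative_def mult_commute_abs)
  qed
  have "\<exists>\<xi>. 0 < \<xi> \<and> \<xi> < t \<and> ?h t - ?h 0 = (t - 0) * (?f (x + \<xi> *\<^sub>R v + t *\<^sub>R w) v - ?f (x + \<xi> *\<^sub>R v + 0 *\<^sub>R w) v)"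
    by (rule MVT2[OF \<open>0 < t\<close>], rule DERIV_diff; rule ch) (use assms in auto)
  then obtain \<xi> where xi: "0 < \<xi>" "\<xi> < t"
    "?h t - ?h 0 = t * (?f (x + \<xi> *\<^sub>R v + t *\<^sub>R w) v - ?f (x + \<xi> *\<^sub>R v + 0 *\<^sub>R w) v)" by auto
  have ch2: "((\<lambda>b. ?f (x + \<xi> *\<^sub>R v + b *\<^sub>R w) v) has_real_derivative ?g (x + \<xi> *\<^sub>R v + b *\<^sub>R w) w) (at b)"
    if "0 \<le> b" "b \<le> t" for b
  proof -
    have b: "x + \<xi> *\<^sub>R v + b *\<^sub>R w \<in> ball x d" using ball that xi by simp
    have "((\<lambda>b. x + \<xi> *\<^sub>R v + b *\<^sub>R w) has_derivative (\<lambda>h. h *\<^sub>R w)) (at b)"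
      by (auto intro!: derivative_eq_intros)
    from has_derivative_compose[OF this dg[OF b]]
    show ?thesis
      using linear_cmul[OF has_derivative_linear[OF dg[OF b]]]
      by (simp add: has_field_derivative_def mult_commute_abs)
  qed
  have "\<exists>\<tau>. 0 < \<tau> \<and> \<tau> < t \<and> ?f (x + \<xi> *\<^sub>R v + t *\<^sub>R w) v - ?f (x + \<xi> *\<^sub>R v + 0 *\<^sub>R w) v = (t - 0) * ?g (x + \<xi> *\<^sub>R v + \<tau> *\<^sub>R w) w"
    by (rule MVT2[OF \<open>0 < t\<close>]) (use ch2 in auto)
  then obtain \<tau> where tau: "0 < \<tau>" "\<tau> < t"
    "?f (x + \<xi> *\<^sub>R v + t *\<^sub>R w) v - ?f (x + \<xi> *\<^sub>R v + 0 *\<^sub>R w) v = t * ?g (x + \<xi> *\<^sub>R v + \<tau> *\<^sub>R w) w" by auto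
  show ?thesis
    using xi tau near[of \<xi> \<tau>] by (intro exI[of _ "x + \<xi> *\<^sub>R v + \<tau> *\<^sub>R w"]) (auto simp: power2_eq_square)
qed

text \<open>The mixed second difference is symmetric in \<open>v\<close> and \<open>w\<close>, so
  the two mixed derivatives agree when taken at two points close to \<open>x\<close>. Continuity
  brings both points to \<open>x\<close>.\<close>

lemma symmetric_second_derivative_real:
  fixes f :: "'a::real_normed_vector \<Rightarrow> real"
  assumes "open S" "Ck_on 2 S f" "x \<in> S"
  shows "frechet_derivative (\<lambda>y. frechet_derivative f (at y) v) (at x) w =
         frechet_derivative (\<lambda>y. frechet_derivative f (at y) w) (at x) v"
proof -
  let ?A = "\<lambda>v w x. frechet_derivative (\<lambda>y. frechet_derivative f (at y) v) (at x) w"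
  have cont: "continuous_on S (?A v w)" for v w
    using assms(2) by (simp add: numeral_2_eq_2)
  have "\<bar>?A v w x - ?A w v x\<bar> \<le> e + e" if "0 < e" for e
  proof -
    obtain d1 where d1: "d1 > 0" "\<And>y. dist y x < d1 \<Longrightarrow> y \<in> S \<Longrightarrow> dist (?A v w y) (?A v w x) < e"
      using cont[of v w] assms(3) \<open>0 < e\<close> unfolding continuous_on_iff by blast
    obtain d2 where d2: "d2 > 0" "\<And>y. dist y x < d2 \<Longrightarrow> y \<in> S \<Longrightarrow> dist (?A w v y) (?A w v x) < e"
      using cont[of w v] assms(3) \<open>0 < e\<close> unfolding continuous_on_iff by blast
    obtain d3 where d3: "d3 > 0" "ball x d3 \<subseteq> S" using assms open_contains_ball by blast
    define d where "d = min d1 (min d2 d3)"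
    \<comment> \<open>The summand 1 covers v = w = 0, and the 2 leaves strict room inside the
      ball.\<close>
    define t where "t = d / (2 * (norm v + norm w + 1))"
    have d: "d > 0" "ball x d \<subseteq> S" using d1 d2 d3 by (auto simp: d_def)
    have nn: "0 < norm v + norm w + 1" by (simp add: add_nonneg_pos)
    have t: "t > 0" using d nn by (simp add: t_def)
    have "t * (norm v + norm w) \<le> t * (norm v + norm w + 1)" using t by simp
    also have "\<dots> = d / 2" using nn by (simp add: t_def field_simps)
    also have "\<dots> < d" using d by simp
    finally have td: "t * (norm v + norm w) < d" .
    have C: "Ck_on 2 (ball x d) f" using assms(2) d(2) Ck_on_subset by blast
    obtain y where y: "dist x y \<le> t * (norm v + norm w)"
      "f (x + t *\<^sub>R v + t *\<^sub>R w) - f (x + t *\<^sub>R v) - f (x + t *\<^sub>R w) + f x = t\<^sup>2 * ?A v w y"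
      using second_difference[OF C t td] by blast
    obtain z where z: "dist x z \<le> t * (norm w + norm v)"
      "f (x + t *\<^sub>R w + t *\<^sub>R v) - f (x + t *\<^sub>R w) - f (x + t *\<^sub>R v) + f x = t\<^sup>2 * ?A w v z"
      using second_difference[OF C t, of w v] td by (auto simp: add.commute)
    have "t\<^sup>2 * ?A v w y = t\<^sup>2 * ?A w v z"
    proof -
      have "x + t *\<^sub>R w + t *\<^sub>R v = x + t *\<^sub>R v + t *\<^sub>R w" by (simp add: add.assoc add.commute)
      from y(2) z(2)[unfolded this] show ?thesis by linarith
    qed
    then have eq: "?A v w y = ?A w v z" using t by simp
    have "dist x y < d" "dist x z < d" using y(1) z(1) td by (auto simp: add.commute)
    then have "dist (?A v w y) (?A v w x) < e" "dist (?A w v z) (?A w v x) < e"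
      using d1(2)[of y] d2(2)[of z] d(2) by (auto simp: d_def dist_commute)
    then show ?thesis using eq by (auto simp: dist_real_def)
  qed
  then have "\<bar>?A v w x - ?A w v x\<bar> \<le> e" if "0 < e" for e
    using that[THEN half_gt_zero] by fastforce
  then show ?thesis by (metis abs_le_zero_iff dense_ge eq_iff_diff_eq_0)
qed

text \<open>Extends \<open>pderiv_at\<close> to vector values, since the coefficients in the complex
  frame are complex functions.\<close>

definition partial :: "'n::finite \<Rightarrow> (real ^ 'n \<Rightarrow> 'b::real_normed_vector) \<Rightarrow> real ^ 'n \<Rightarrow> 'b" where
  "partial i f x = frechet_derivative f (at x) (axis i 1)"

lemma pderiv_at_eq_partial: "pderiv_at i f = partial i f"
  by (auto simp: pderiv_at_def partial_def)

lemma has_derivative_partial: "(f has_derivative f') (at x) \<Longrightarrow> partial i f x = f' (axis i 1)"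
  using frechet_derivative_at by (force simp: partial_def)

lemma differentiable_has_derivative: "f differentiable (at x) \<Longrightarrow> (f has_derivative frechet_derivative f (at x)) (at x)"
  by (simp add: frechet_derivative_works)

lemma differentiable_bounded_linear:
  "bounded_linear L \<Longrightarrow> f differentiable (at x) \<Longrightarrow> (\<lambda>x. L (f x)) differentiable (at x)"
  unfolding differentiable_def by (blast intro: bounded_linear.has_derivative)

lemma partial_const [simp]: "partial i (\<lambda>x. c) x = 0"
  by (simp add: partial_def)

lemma partial_add:
  "f differentiable (at x) \<Longrightarrow> g differentiable (at x) \<Longrightarrow> partial i (\<lambda>x. f x + g x) x = partial i f x + partial i g x"
  using has_derivative_partial[OF has_derivative_add[OF differentiable_has_derivative differentiable_has_derivative]] by (simp add: partial_def)

lemma partial_diff: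
  "f differentiable (at x) \<Longrightarrow> g differentiable (at x) \<Longrightarrow> partial i (\<lambda>x. f x - g x) x = partial i f x - partial i g x"
  using has_derivative_partial[OF has_derivative_diff[OF differentiable_has_derivative differentiable_has_derivative]] by (simp add: partial_def)

lemma partial_uminus:
  "f differentiable (at x) \<Longrightarrow> partial i (\<lambda>x. - f x) x = - partial i f x"
  using has_derivative_partial[OF has_derivative_minus[OF differentiable_has_derivative]] by (simp add: partial_def)

lemma partial_linear:
  "bounded_linear L \<Longrightarrow> f differentiable (at x) \<Longrightarrow> partial i (\<lambda>x. L (f x)) x = L (partial i f x)"
  using has_derivative_partial[OF bounded_linear.has_derivative[OF _ differentiable_has_derivative]] by (simp add: partial_def)

lemma partial_mult:
  fixes f g :: "real ^ 'n::finite \<Rightarrow> 'b::real_normed_algebra"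
  shows "f differentiable (at x) \<Longrightarrow> g differentiable (at x) \<Longrightarrow>
    partial i (\<lambda>x. f x * g x) x = partial i f x * g x + f x * partial i g x"
  using has_derivative_partial[OF has_derivative_mult[OF differentiable_has_derivative differentiable_has_derivative]] by (simp add: partial_def add.commute)

lemma partial_of_real:
  "f differentiable (at x) \<Longrightarrow> partial i (\<lambda>x. complex_of_real (f x)) x = of_real (partial i f x)"
  by (rule partial_linear[OF bounded_linear_of_real])

lemma partial_cong:
  assumes "open S" "x \<in> S" "\<And>y. y \<in> S \<Longrightarrow> f y = g y" "f differentiable (at x)"
  shows "partial i f x = partial i g x"
  unfolding partial_def using frechet_derivative_transform_within_open[OF assms(4,1,2,3)] by simp

lemma smooth_on_partial: "smooth_on S f \<Longrightarrow> smooth_on S (partial i f)"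
  unfolding partial_def[abs_def] by (rule smooth_on_frechet_derivative)

lemma differentiable_of_real:
  "f differentiable (at x) \<Longrightarrow> (\<lambda>x. complex_of_real (f x)) differentiable (at x)"
  by (rule differentiable_bounded_linear[OF bounded_linear_of_real])

lemma partial_commute_real:
  fixes f :: "real ^ 'n::finite \<Rightarrow> real"
  assumes "open S" "smooth_on S f" "x \<in> S"
  shows "partial i (partial j f) x = partial j (partial i f) x"
  using symmetric_second_derivative_real[of S f x "axis j 1" "axis i 1"] assms
  by (simp add: partial_def[abs_def] smooth_on_def)

lemma partial_commute:
  fixes f :: "real ^ 'n::finite \<Rightarrow> complex"
  assumes S: "open S" and f: "smooth_on S f" and x: "x \<in> S"
  shows "partial i (partial j f) x = partial j (partial i f) x"
proof -
  have comp: "L (partial i (partial j f) x) = partial i (partial j (\<lambda>x. L (f x))) x"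
    if L: "bounded_linear L" for L :: "complex \<Rightarrow> real" and i j
  proof -
    have "L (partial i (partial j f) x) = partial i (\<lambda>x. L (partial j f x)) x"
      by (rule partial_linear[OF L, symmetric]) (rule smooth_on_differentiable[OF smooth_on_partial[OF f] x])
    also have "\<dots> = partial i (partial j (\<lambda>x. L (f x))) x"
    proof (rule partial_cong[OF S x])
      show "L (partial j f y) = partial j (\<lambda>x. L (f x)) y" if "y \<in> S" for y
        by (rule partial_linear[OF L, symmetric]) (rule smooth_on_differentiable[OF f that])
      show "(\<lambda>x. L (partial j f x)) differentiable at x"
        by (rule differentiable_bounded_linear[OF L]) (rule smooth_on_differentiable[OF smooth_on_partial[OF f] x])
    qed
    finally show ?thesis .
  qed
  have "L (partial i (partial j f) x) = L (partial j (partial i f) x)" if L: "bounded_linear L" for L :: "complex \<Rightarrow> real"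
    using comp[OF L] partial_commute_real[OF S smooth_on_linear_compose[OF L S f] x] by metis
  from this[OF bounded_linear_Re] this[OF bounded_linear_Im] show ?thesis by (simp add: complex_eq_iff)
qed

lemma partial_compose:
  fixes g :: "real ^ 'm::finite \<Rightarrow> 'b::real_normed_vector" and f :: "real ^ 'n::finite \<Rightarrow> real ^ 'm"
  assumes "f differentiable (at x)" "g differentiable (at (f x))"
  shows "partial i (\<lambda>x. g (f x)) x = (\<Sum>k\<in>UNIV. partial i (\<lambda>x. f x $ k) x *\<^sub>R partial k g (f x))"
proof -
  let ?f = "frechet_derivative f (at x)" and ?g = "frechet_derivative g (at (f x))"
  have lin: "linear ?g" using assms(2) by (rule linear_frechet_derivative)
  have k: "partial i (\<lambda>x. f x $ k) x = ?f (axis i 1) $ k" for k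
    using partial_linear[OF bounded_linear_vec_nth assms(1), of i k] by (simp add: partial_def)
  have v: "v = (\<Sum>k\<in>UNIV. (v $ k) *\<^sub>R axis k 1)" for v :: "real ^ 'm"
    by (simp add: vec_eq_iff axis_def if_distrib cong: if_cong)
  have "partial i (\<lambda>x. g (f x)) x = ?g (?f (axis i 1))"
    by (rule has_derivative_partial[OF has_derivative_compose[OF differentiable_has_derivative[OF assms(1)] differentiable_has_derivative[OF assms(2)]]])
  also have "\<dots> = (\<Sum>k\<in>UNIV. (?f (axis i 1) $ k) *\<^sub>R ?g (axis k 1))"
    by (subst v) (simp add: linear_sum[OF lin] linear_cmul[OF lin])
  finally show ?thesis by (simp add: k) (simp add: partial_def)
qed

lemma jacobian_nth:
  fixes f :: "real ^ 'n::finite \<Rightarrow> real ^ 'm::finite"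
  assumes "f differentiable (at x)"
  shows "jacobian f (at x) $ k $ i = partial i (\<lambda>x. f x $ k) x"
  using partial_linear[OF bounded_linear_vec_nth assms, of i k]
  by (simp add: jacobian_def matrix_def partial_def)

section \<open>Connection and curvature in the complex frame of a coordinate field\<close>

lemma matrix_inv_inverse:
  fixes A :: "'a::semiring_1 ^ 'n::finite ^ 'm::finite"
  assumes "invertible A"
  shows "A ** matrix_inv A = mat 1" "matrix_inv A ** A = mat 1"
proof -
  have "\<exists>B. A ** B = mat 1 \<and> B ** A = mat 1" using assms by (simp add: invertible_def)
  from someI_ex[OF this] show "A ** matrix_inv A = mat 1" "matrix_inv A ** A = mat 1"
    by (simp_all add: matrix_inv_def)
qed

text \<open>\<open>matrix_inv\<close> is given by choice; Cramer's rule makes the Christoffel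
  symbols explicit in the metric coefficients, hence smooth.\<close>

lemma matrix_inv_2:
  fixes A :: "real ^ 2 ^ 2"
  assumes "det A \<noteq> 0"
  shows "matrix_inv A $ 1 $ 1 = A $ 2 $ 2 / det A" "matrix_inv A $ 1 $ 2 = - A $ 1 $ 2 / det A"
    "matrix_inv A $ 2 $ 1 = - A $ 2 $ 1 / det A" "matrix_inv A $ 2 $ 2 = A $ 1 $ 1 / det A"
proof -
  define D where "D = det A"
  define B where "B = ((\<chi> i j. (if i = j then (if i = 1 then A $ 2 $ 2 else A $ 1 $ 1) else - A $ i $ j) / D) :: real ^ 2 ^ 2)"
  have B: "B $ 1 $ 1 = A $ 2 $ 2 / D" "B $ 1 $ 2 = - A $ 1 $ 2 / D"
    "B $ 2 $ 1 = - A $ 2 $ 1 / D" "B $ 2 $ 2 = A $ 1 $ 1 / D"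
    by (simp_all add: B_def)
  have D: "D \<noteq> 0" "A $ 1 $ 1 * A $ 2 $ 2 = D + A $ 1 $ 2 * A $ 2 $ 1" using assms by (simp_all add: D_def det_2)
  have "A ** B = mat 1"
    using D by (simp add: vec_eq_iff matrix_matrix_mult_def B mat_def forall_2 sum_2 field_simps)
  moreover have "B ** A = mat 1"
    using D by (simp add: vec_eq_iff matrix_matrix_mult_def B mat_def forall_2 sum_2 field_simps)
  ultimately have AB: "invertible A" "A ** B = mat 1" by (auto simp: invertible_def)
  have "matrix_inv A = matrix_inv A ** (A ** B)" by (simp only: AB matrix_mul_rid)
  also have "\<dots> = B" by (simp only: matrix_mul_assoc matrix_inv_inverse[OF AB(1)] matrix_mul_lid)
  finally have "matrix_inv A = B" .
  with B[unfolded D_def] show "matrix_inv A $ 1 $ 1 = A $ 2 $ 2 / det A" "matrix_inv A $ 1 $ 2 = - A $ 1 $ 2 / det A"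
    "matrix_inv A $ 2 $ 1 = - A $ 2 $ 1 / det A" "matrix_inv A $ 2 $ 2 = A $ 1 $ 1 / det A" by auto
qed

definition metric_on :: "(real ^ 2) set \<Rightarrow> (real ^ 2 \<Rightarrow> real ^ 2 ^ 2) \<Rightarrow> bool" where
  "metric_on V G \<longleftrightarrow> open V \<and> smooth_on V G \<and>
     (\<forall>x\<in>V. transpose (G x) = G x \<and> (\<forall>v. v \<noteq> 0 \<longrightarrow> 0 < v \<bullet> (G x *v v)))"

text \<open>The formula of \<open>gauss_curvature\<close> for a coefficient matrix alone; the two
  agree literally in the chart selected by \<open>chart_at\<close>.\<close>

definition metric_curvature :: "(real ^ 2 \<Rightarrow> real ^ 2 ^ 2) \<Rightarrow> real ^ 2 \<Rightarrow> real" where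
  "metric_curvature G x = (\<Sum>l\<in>UNIV. G x $ l $ 1 * curvature_tensor G l 1 2 2 x) / det (G x)"

text \<open>The metric and the orientation make each tangent space a complex line.  In it \<open>\<partial>\<^sub>2\<close> is the complex
  multiple \<open>conf_root G\<close> of \<open>\<partial>\<^sub>1\<close>, and \<open>\<nabla>\<^sub>i \<partial>\<^sub>1 = conn_form G i \<partial>\<^sub>1\<close>.\<close>

definition conf_root :: "(real ^ 2 \<Rightarrow> real ^ 2 ^ 2) \<Rightarrow> real ^ 2 \<Rightarrow> complex" where
  "conf_root G x = Complex (G x $ 1 $ 2 / G x $ 1 $ 1) (sqrt (det (G x)) / G x $ 1 $ 1)"

definition conn_form :: "(real ^ 2 \<Rightarrow> real ^ 2 ^ 2) \<Rightarrow> 2 \<Rightarrow> real ^ 2 \<Rightarrow> complex" where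
  "conn_form G i x = of_real (christoffel G 1 i 1 x) + of_real (christoffel G 2 i 1 x) * conf_root G x"

text \<open>Here \<open>E\<close>, \<open>F\<close>, \<open>G\<close> are the metric coefficients,
  \<open>a1\<close>, \<open>a2\<close> and \<open>b1\<close>, \<open>b2\<close> the Christoffel
  coefficients of \<open>\<nabla>\<^sub>i \<partial>\<^sub>1\<close> and
  \<open>\<nabla>\<^sub>i \<partial>\<^sub>2\<close>, and a final \<open>i\<close> marks a
  derivative. In the differentiated quadratic equation \<open>ri\<close> has the factor 2 (E r - F),
  which is non-zero at a simple root.\<close>

lemma conf_root_derivative_algebra:
  fixes E :: complex
  assumes "Ei = 2 * (a1 * E + a2 * F)" "Fi = a1 * F + a2 * G + b1 * E + b2 * F" "Gi = 2 * (b1 * F + b2 * G)"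
    "E * r * r - 2 * F * r + G = 0" "Ei * r * r + 2 * E * r * ri - 2 * Fi * r - 2 * F * ri + Gi = 0"
    "E * r - F \<noteq> 0"
  shows "ri = b1 + b2 * r - (a1 + a2 * r) * r"
proof -
  have "2 * (E * r - F) * (ri - (b1 + b2 * r - (a1 + a2 * r) * r)) = 0"
    using assms(1-5) by algebra
  then show ?thesis using assms(6) by simp
qed

context
  fixes V :: "(real ^ 2) set" and G :: "real ^ 2 \<Rightarrow> real ^ 2 ^ 2"
  assumes VG: "metric_on V G"
begin

lemma metric_open: "open V" and metric_smooth: "smooth_on V G"
  using VG by (auto simp: metric_on_def)

lemma metric_sym: assumes "x \<in> V" shows "G x $ j $ i = G x $ i $ j"
proof -
  have "transpose (G x) $ i $ j = G x $ i $ j" using VG assms by (simp add: metric_on_def)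
  then show ?thesis by (simp add: transpose_def)
qed

lemma metric_pos11: assumes "x \<in> V" shows "0 < G x $ 1 $ 1"
proof -
  let ?v = "vector [1, 0] :: real ^ 2"
  have "?v \<noteq> 0" by (metis vector_2(1) zero_index zero_neq_one)
  then have "0 < ?v \<bullet> (G x *v ?v)" using VG assms by (simp add: metric_on_def)
  then show ?thesis by (simp add: inner_vec_def sum_2 matrix_vector_mult_def)
qed

lemma metric_det_pos: assumes x: "x \<in> V" shows "0 < det (G x)"
proof -
  \<comment> \<open>This vector is orthogonal to \<open>\<partial>\<^sub>1\<close>; its square
    length is det G times that of \<open>\<partial>\<^sub>1\<close>.\<close>
  let ?v = "vector [- G x $ 1 $ 2, G x $ 1 $ 1] :: real ^ 2"
  have "?v \<noteq> 0" using metric_pos11[OF x] by (metis less_irrefl vector_2(2) zero_index)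
  then have "0 < ?v \<bullet> (G x *v ?v)" using VG x by (simp add: metric_on_def)
  also have "\<dots> = G x $ 1 $ 1 * det (G x)"
    using metric_sym[OF x, of 1 2] by (simp add: inner_vec_def sum_2 matrix_vector_mult_def det_2 algebra_simps)
  finally show ?thesis using metric_pos11[OF x] by (simp add: zero_less_mult_iff)
qed

lemma smooth_on_metric_nth: "smooth_on V (\<lambda>x. G x $ i $ j)"
  by (intro smooth_on_vec_nth metric_open metric_smooth)

lemma smooth_on_metric_det: "smooth_on V (\<lambda>x. det (G x))"
  unfolding det_2 by (intro smooth_on_diff smooth_on_mult smooth_on_metric_nth metric_open)

lemma smooth_on_metric_inv: "smooth_on V (\<lambda>x. matrix_inv (G x) $ i $ j)"
proof -
  have s: "smooth_on V (\<lambda>x. (if i = j then (if i = 1 then G x $ 2 $ 2 else G x $ 1 $ 1) else - G x $ i $ j) / det (G x))"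
    by (rule smooth_on_divide[OF metric_open _ smooth_on_metric_det metric_det_pos])
      (cases "i = j"; cases "i = 1"; simp add: smooth_on_uminus metric_open smooth_on_metric_nth)
  have ij: "(i = 1 \<or> i = 2) \<and> (j = 1 \<or> j = 2)" using exhaust_2 by blast
  show ?thesis
    by (rule smooth_on_cong[OF metric_open _ s])
      (use ij metric_det_pos in \<open>auto simp: matrix_inv_2 less_imp_neq[symmetric]\<close>)
qed

lemma smooth_on_christoffel: "smooth_on V (christoffel G k i j)"
  unfolding christoffel_def[abs_def] pderiv_at_eq_partial
  by (intro smooth_on_mult smooth_on_sum smooth_on_diff smooth_on_add smooth_on_const smooth_on_metric_inv
      smooth_on_partial smooth_on_metric_nth metric_open)

lemma smooth_on_conf_root: "smooth_on V (conf_root G)"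
proof (rule smooth_on_cong[OF metric_open])
  show "smooth_on V (\<lambda>x. complex_of_real (G x $ 1 $ 2 / G x $ 1 $ 1) + \<i> * complex_of_real (sqrt (det (G x)) / G x $ 1 $ 1))"
    by (intro smooth_on_add smooth_on_mult smooth_on_of_real smooth_on_const smooth_on_divide
        smooth_on_sqrt smooth_on_metric_det smooth_on_metric_nth metric_open metric_pos11 metric_det_pos)
qed (simp add: conf_root_def complex_eq_iff)

lemma smooth_on_conn_form: "smooth_on V (conn_form G i)"
  unfolding conn_form_def[abs_def]
  by (intro smooth_on_add smooth_on_mult smooth_on_of_real smooth_on_christoffel smooth_on_conf_root metric_open)

lemma partial_metric_sym: assumes "x \<in> V" shows "partial k (\<lambda>y. G y $ j $ i) x = partial k (\<lambda>y. G y $ i $ j) x"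
  by (rule partial_cong[OF metric_open assms metric_sym smooth_on_differentiable[OF smooth_on_metric_nth assms]])

lemma christoffel_sym: assumes "x \<in> V" shows "christoffel G k j i x = christoffel G k i j x"
  unfolding christoffel_def pderiv_at_eq_partial using partial_metric_sym[OF assms, of _ j i]
  by (simp add: add.commute)

text \<open>The Koszul formula; multiplying by det G clears the inverse metric.\<close>

lemma christoffel_lower:
  assumes x: "x \<in> V"
  shows "(\<Sum>m\<in>UNIV. christoffel G m i j x * G x $ m $ k) =
    (partial i (\<lambda>y. G y $ j $ k) x + partial j (\<lambda>y. G y $ i $ k) x - partial k (\<lambda>y. G y $ i $ j) x) / 2"
proof -
  have k: "k = 1 \<or> k = 2" using exhaust_2 by blast
  have "det (G x) \<noteq> 0" using metric_det_pos[OF x] by simp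
  then have "det (G x) * (\<Sum>m\<in>UNIV. christoffel G m i j x * G x $ m $ k) = det (G x) *
    ((partial i (\<lambda>y. G y $ j $ k) x + partial j (\<lambda>y. G y $ i $ k) x - partial k (\<lambda>y. G y $ i $ j) x) / 2)"
    using k metric_sym[OF x, of 1 2]
    unfolding christoffel_def pderiv_at_eq_partial sum_2 matrix_inv_2[OF \<open>det (G x) \<noteq> 0\<close>]
    by (auto simp: divide_simps) (auto simp: det_2 algebra_simps)
  then show ?thesis using \<open>det (G x) \<noteq> 0\<close> by simp
qed

text \<open>Adding the two Koszul expressions leaves only the derivative in direction
  \<open>i\<close>.\<close>

lemma metric_compat:
  assumes x: "x \<in> V"
  shows "partial i (\<lambda>y. G y $ j $ k) x =
    (\<Sum>m\<in>UNIV. christoffel G m i j x * G x $ m $ k) + (\<Sum>m\<in>UNIV. christoffel G m i k x * G x $ m $ j)"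
  unfolding christoffel_lower[OF x] using partial_metric_sym[OF x] by (simp add: field_simps)

text \<open>\<open>conf_root\<close> is the root with positive imaginary part of E r^2 - 2 F r + G.
  Times E, this quadratic is (E r - F)^2 + det, and E r - F equals i sqrt det.\<close>

lemma conf_root_quadratic:
  assumes x: "x \<in> V"
  shows "of_real (G x $ 1 $ 1) * conf_root G x * conf_root G x - 2 * of_real (G x $ 1 $ 2) * conf_root G x + of_real (G x $ 2 $ 2) = 0"
    "of_real (G x $ 1 $ 1) * conf_root G x - of_real (G x $ 1 $ 2) = \<i> * of_real (sqrt (det (G x)))"
proof -
  note p = metric_pos11[OF x] metric_det_pos[OF x] metric_sym[OF x, of 1 2]
  have s: "sqrt (det (G x)) * sqrt (det (G x)) = G x $ 1 $ 1 * G x $ 2 $ 2 - G x $ 1 $ 2 * G x $ 1 $ 2"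
    using p by (simp add: det_2)
  let ?E = "complex_of_real (G x $ 1 $ 1)" and ?F = "complex_of_real (G x $ 1 $ 2)" and ?s = "complex_of_real (sqrt (det (G x)))"
  have s': "?s * ?s = ?E * of_real (G x $ 2 $ 2) - ?F * ?F"
    using arg_cong[OF s, of complex_of_real] by (simp only: of_real_mult of_real_diff)
  show 1: "?E * conf_root G x - ?F = \<i> * ?s"
    using p by (simp add: conf_root_def complex_eq_iff)
  have "?E * (?E * conf_root G x * conf_root G x - 2 * ?F * conf_root G x + of_real (G x $ 2 $ 2))
     = (?E * conf_root G x - ?F) * (?E * conf_root G x - ?F) + ?s * ?s"
    unfolding s' by (simp add: algebra_simps)
  also have "\<dots> = 0" unfolding 1 by (simp add: algebra_simps)
  finally show "?E * conf_root G x * conf_root G x - 2 * ?F * conf_root G x + of_real (G x $ 2 $ 2) = 0"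
    using p by simp
qed

text \<open>The complex structure is parallel. Computed from
  \<open>\<partial>\<^sub>2 = r \<partial>\<^sub>1\<close>, the coefficient of
  \<open>\<nabla>\<^sub>i \<partial>\<^sub>2\<close> is
  \<open>\<partial>\<^sub>i r + \<theta>\<^sub>i r\<close>; computed directly, it is the combination
  of Christoffel symbols. Instead of invoking parallelism, the proof differentiates the quadratic
  equation of r.\<close>

lemma partial_conf_root:
  assumes x: "x \<in> V"
  shows "partial i (conf_root G) x = of_real (christoffel G 1 i 2 x) + of_real (christoffel G 2 i 2 x) * conf_root G x
    - conn_form G i x * conf_root G x"
proof -
  let ?r = "conf_root G x"
  let ?g = "\<lambda>j k. complex_of_real (G x $ j $ k)" and ?dg = "\<lambda>j k. complex_of_real (partial i (\<lambda>y. G y $ j $ k) x)"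
  note dr = smooth_on_differentiable[OF smooth_on_conf_root x]
  note dg = differentiable_of_real[OF smooth_on_differentiable[OF smooth_on_metric_nth x]]
  note pg = partial_of_real[OF smooth_on_differentiable[OF smooth_on_metric_nth x]]
  have "0 = partial i (\<lambda>x. (of_real (G x $ 1 $ 1) * conf_root G x) * conf_root G x
      - (2 * of_real (G x $ 1 $ 2)) * conf_root G x + of_real (G x $ 2 $ 2)) x"
    by (subst partial_cong[OF metric_open x, of "\<lambda>_. 0", symmetric]) (use conf_root_quadratic in auto)
  also have "\<dots> = (?dg 1 1 * ?r + ?g 1 1 * partial i (conf_root G) x) * ?r + ?g 1 1 * ?r * partial i (conf_root G) x
     - (2 * ?dg 1 2 * ?r + 2 * ?g 1 2 * partial i (conf_root G) x) + ?dg 2 2"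
    by (simp add: partial_add partial_diff partial_mult pg dr dg differentiable_add differentiable_diff differentiable_mult)
  finally have e: "?dg 1 1 * ?r * ?r + 2 * ?g 1 1 * ?r * partial i (conf_root G) x - 2 * ?dg 1 2 * ?r
     - 2 * ?g 1 2 * partial i (conf_root G) x + ?dg 2 2 = 0" by (simp add: algebra_simps)
  show ?thesis
    unfolding conn_form_def
    by (rule conf_root_derivative_algebra[OF _ _ _ conf_root_quadratic(1)[OF x] e])
      (use conf_root_quadratic(2)[OF x] metric_det_pos[OF x] metric_sym[OF x, of 1 2] in
        \<open>auto simp: metric_compat[OF x] sum_2\<close>)
qed

text \<open>E is the square length of \<open>\<partial>\<^sub>1\<close>, so by metric compatibility
  its derivative is twice the inner product of \<open>\<nabla>\<^sub>i \<partial>\<^sub>1\<close>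
  with \<open>\<partial>\<^sub>1\<close>.\<close>

lemma Re_conn_form:
  assumes x: "x \<in> V"
  shows "partial i (\<lambda>y. G y $ 1 $ 1) x = 2 * G x $ 1 $ 1 * Re (conn_form G i x)"
  using metric_pos11[OF x] metric_sym[OF x, of 1 2]
  by (simp add: metric_compat[OF x] sum_2 conn_form_def conf_root_def algebra_simps)

text \<open>The real part of the connection form is half of d ln E, hence closed; curvature sits in
  the imaginary part.\<close>

lemma partial_Re_conn_form_commute:
  assumes x: "x \<in> V"
  shows "partial 1 (\<lambda>x. Re (conn_form G 2 x)) x = partial 2 (\<lambda>x. Re (conn_form G 1 x)) x"
proof -
  let ?E = "\<lambda>x. G x $ 1 $ 1" and ?t = "\<lambda>i x. Re (conn_form G i x)"
  have dE: "?E differentiable (at x)" by (rule smooth_on_differentiable[OF smooth_on_metric_nth x])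
  have dt: "?t i differentiable (at x)" for i
    by (rule smooth_on_differentiable[OF _ x]) (intro smooth_on_linear_compose[OF bounded_linear_Re] metric_open smooth_on_conn_form)
  have "partial j (partial i ?E) x = 2 * (partial j ?E x * ?t i x + ?E x * partial j (?t i) x)" for i j
  proof -
    have "partial j (partial i ?E) x = partial j (\<lambda>x. (2 * ?E x) * ?t i x) x"
      by (rule partial_cong[OF metric_open x Re_conn_form])
         (auto intro: smooth_on_differentiable[OF smooth_on_partial[OF smooth_on_metric_nth] x])
    then show ?thesis using dE dt by (simp add: partial_mult algebra_simps)
  qed
  from this[of 1 2] this[of 2 1] partial_commute_real[OF metric_open smooth_on_metric_nth x, of 1 2 1 1]
  show ?thesis using metric_pos11[OF x] by (simp add: Re_conn_form[OF x] algebra_simps)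
qed

text \<open>The curvature of a complex line bundle is multiplication by \<Omega> = d\<theta>. Its
  effect on \<open>\<partial>\<^sub>2 = r \<partial>\<^sub>1\<close> is found by commuting the
  second derivatives of r, and this is compared with the curvature tensor. Since \<Omega> is purely
  imaginary, the inner product with \<open>\<partial>\<^sub>1\<close> determines it.\<close>

lemma conn_form_curvature:
  assumes x: "x \<in> V"
  shows "partial 1 (conn_form G 2) x - partial 2 (conn_form G 1) x = - \<i> * of_real (metric_curvature G x * sqrt (det (G x)))"
proof -
  let ?r = "conf_root G" and ?t = "conn_form G" and ?c = "\<lambda>k i j x. complex_of_real (christoffel G k i j x)"
  let ?O = "partial 1 (?t 2) x - partial 2 (?t 1) x"
  have dc: "christoffel G k i j differentiable (at x)" for k i j
    by (rule smooth_on_differentiable[OF smooth_on_christoffel x])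
  have dr: "?r differentiable (at x)" by (rule smooth_on_differentiable[OF smooth_on_conf_root x])
  have dt: "?t i differentiable (at x)" for i by (rule smooth_on_differentiable[OF smooth_on_conn_form x])
  note d = differentiable_of_real[OF dc] dr dt
  have dd: "partial j (partial i ?r) x =
      of_real (partial j (christoffel G 1 i 2) x) + (of_real (partial j (christoffel G 2 i 2) x) * ?r x + ?c 2 i 2 x * partial j ?r x)
      - (partial j (?t i) x * ?r x + ?t i x * partial j ?r x)" for i j
  proof -
    have "partial j (partial i ?r) x = partial j (\<lambda>x. ?c 1 i 2 x + ?c 2 i 2 x * ?r x - ?t i x * ?r x) x"
      by (rule partial_cong[OF metric_open x partial_conf_root])
         (auto intro: smooth_on_differentiable[OF smooth_on_partial[OF smooth_on_conf_root] x])
    then show ?thesis using d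
      by (simp add: partial_add partial_diff partial_mult partial_of_real[OF dc] differentiable_add differentiable_diff differentiable_mult)
  qed
  have O: "?O * ?r x = of_real (curvature_tensor G 1 1 2 2 x) + of_real (curvature_tensor G 2 1 2 2 x) * ?r x"
    using dd[of 1 2] dd[of 2 1] partial_commute[OF metric_open smooth_on_conf_root x, of 1 2]
    unfolding curvature_tensor_def pderiv_at_eq_partial
    by (simp add: partial_conf_root[OF x] sum_2 conn_form_def[of G] christoffel_sym[OF x, of _ 1 2] algebra_simps)
  have "Re (partial 1 (?t 2) x) = Re (partial 2 (?t 1) x)"
    using partial_Re_conn_form_commute[OF x] dt by (simp add: partial_linear[OF bounded_linear_Re])
  then have Re: "Re ?O = 0" by simp
  note p = metric_pos11[OF x] metric_det_pos[OF x] metric_sym[OF x, of 1 2]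
  let ?s = "sqrt (det (G x))"
  have ss: "?s * ?s = det (G x)" using p by simp
  have "metric_curvature G x * det (G x) = (\<Sum>l\<in>UNIV. G x $ l $ 1 * curvature_tensor G l 1 2 2 x)"
    using p by (simp add: metric_curvature_def)
  also have "\<dots> = G x $ 1 $ 1 * Re (?O * ?r x)"
    unfolding O using p by (simp add: sum_2 conf_root_def algebra_simps)
  \<comment> \<open>With Re \<Omega> = 0 only the product of imaginary parts is left, and E Im r =
    sqrt det.\<close>
  also have "\<dots> = - Im ?O * ?s"
    using Re p by (simp add: conf_root_def algebra_simps)
  finally have "metric_curvature G x * (?s * ?s) = - Im ?O * ?s" unfolding ss .
  moreover have "?s \<noteq> 0" using p by simp
  ultimately have "metric_curvature G x * ?s = - Im ?O"
    by (metis mult.assoc mult_right_cancel)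
  then have "Im ?O = - (metric_curvature G x * ?s)" by linarith
  with Re show ?thesis by (simp add: complex_eq_iff)
qed

end

section \<open>The Bochner formula for harmonic maps between surfaces\<close>

text \<open>The function solves a Cauchy-Riemann equation
  \<open>(\<partial>\<^sub>1 + i \<partial>\<^sub>2) f = - k f\<close> with a zeroth order term k.
  The Laplacian is the product of this operator with
  \<open>\<partial>\<^sub>1 - i \<partial>\<^sub>2\<close>; in the Laplacian of ln |f|^2 the first
  derivatives of f cancel, leaving -2 Re of
  \<open>(\<partial>\<^sub>1 - i \<partial>\<^sub>2) k\<close>. For k = 0 this is the harmonicity of
  ln |f|^2 for holomorphic f.\<close>

lemma laplacian_ln_norm_sq:
  fixes f :: "real ^ 2 \<Rightarrow> complex"
  assumes U: "open U" and x: "x \<in> U" and f: "smooth_on U f" and nz: "\<And>y. y \<in> U \<Longrightarrow> f y \<noteq> 0"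
    and t: "smooth_on U t1" "smooth_on U t2"
    and eq: "\<And>y. y \<in> U \<Longrightarrow> partial 1 f y + \<i> * partial 2 f y = - ((t1 y + \<i> * t2 y) * f y)"
  shows "smooth_on U (\<lambda>y. ln ((cmod (f y))\<^sup>2))"
    "partial 1 (partial 1 (\<lambda>y. ln ((cmod (f y))\<^sup>2))) x + partial 2 (partial 2 (\<lambda>y. ln ((cmod (f y))\<^sup>2))) x =
      - 2 * Re (partial 1 t1 x + partial 2 t2 x + \<i> * (partial 1 t2 x - partial 2 t1 x))"
proof -
  let ?q = "\<lambda>y. Re (f y) * Re (f y) + Im (f y) * Im (f y)"
  have qn: "(cmod (f y))\<^sup>2 = ?q y" for y
    by (simp only: cmod_power2) (simp only: power2_eq_square)
  have q0: "0 < ?q y" if "y \<in> U" for y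
    using nz[OF that] by (metis qn zero_less_norm_iff zero_less_power)
  have sR: "smooth_on U (\<lambda>y. Re (f y))" and sI: "smooth_on U (\<lambda>y. Im (f y))"
    by (intro smooth_on_linear_compose[OF bounded_linear_Re U f] smooth_on_linear_compose[OF bounded_linear_Im U f])+
  have sq: "smooth_on U ?q" by (intro smooth_on_add smooth_on_mult sR sI U)
  have df: "f differentiable (at y)" if "y \<in> U" for y by (rule smooth_on_differentiable[OF f that])
  note dR = smooth_on_differentiable[OF sR] and dI = smooth_on_differentiable[OF sI]
  have hdln: "((\<lambda>y. ln (?q y)) has_derivative (\<lambda>v. frechet_derivative ?q (at y) v / ?q y)) (at y)" if "y \<in> U" for y
    using has_derivative_ln[OF q0[OF that] smooth_on_has_derivative[OF sq that]] by (simp add: divide_inverse)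
  have "smooth_on U (\<lambda>y. ln (?q y))"
    unfolding smooth_on_def
  proof
    fix k show "Ck_on k U (\<lambda>y. ln (?q y))"
    proof (cases k)
      case 0
      have "\<forall>y\<in>U. ?q y \<noteq> 0" using q0 by (metis less_irrefl)
      then show ?thesis unfolding 0 Ck_on.simps by (rule continuous_on_ln[OF smooth_on_imp_continuous_on[OF sq]])
    next
      case (Suc m)
      have "smooth_on U (\<lambda>y. frechet_derivative ?q (at y) v / ?q y)" for v
        by (rule smooth_on_divide[OF U smooth_on_frechet_derivative[OF sq] sq q0])
      then show ?thesis unfolding Suc by (intro Ck_on_SucI[OF U hdln]) (auto simp: smooth_on_def)
    qed
  qed
  then show "smooth_on U (\<lambda>y. ln ((cmod (f y))\<^sup>2))" by (simp add: qn)
  have p1: "partial i (\<lambda>y. ln (?q y)) y = 2 * Re (partial i f y / f y)" if y: "y \<in> U" for i y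
  proof -
    have "partial i (\<lambda>y. ln (?q y)) y = partial i ?q y / ?q y"
      using has_derivative_partial[OF hdln[OF y]] by (simp add: partial_def)
    also have "partial i ?q y = 2 * (Re (f y) * Re (partial i f y) + Im (f y) * Im (partial i f y))"
      using dR[OF y] dI[OF y]
      by (simp add: partial_add partial_mult differentiable_mult partial_linear[OF bounded_linear_Re df[OF y]]
          partial_linear[OF bounded_linear_Im df[OF y]])
    finally show ?thesis by (simp add: Re_divide power2_eq_square algebra_simps)
  qed
  have p2: "partial i (partial i (\<lambda>y. ln (?q y))) x =
      2 * Re (partial i (partial i f) x / f x - (partial i f x / f x) * (partial i f x / f x))" for i
  proof -
    have hd: "((\<lambda>y. partial i f y / f y) has_derivative
        (\<lambda>v. - partial i f x * (inverse (f x) * frechet_derivative f (at x) v * inverse (f x)) + frechet_derivative (partial i f) (at x) v / f x)) (at x)"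
      by (rule has_derivative_divide[OF smooth_on_has_derivative[OF smooth_on_partial[OF f] x] smooth_on_has_derivative[OF f x] nz[OF x]])
    then have d: "(\<lambda>y. partial i f y / f y) differentiable (at x)" by (auto simp: differentiable_def)
    have "partial i (partial i (\<lambda>y. ln (?q y))) x = partial i (\<lambda>y. 2 * Re (partial i f y / f y)) x"
      by (rule partial_cong[OF U x p1])
        (auto intro!: smooth_on_differentiable[OF _ x] smooth_on_partial \<open>smooth_on U (\<lambda>y. ln (?q y))\<close>)
    also have "\<dots> = 2 * Re (partial i (\<lambda>y. partial i f y / f y) x)"
      by (rule partial_linear[OF _ d]) (intro bounded_linear_mult_right bounded_linear_compose[OF bounded_linear_mult_right bounded_linear_Re])
    also have "partial i (\<lambda>y. partial i f y / f y) x = partial i (partial i f) x / f x - (partial i f x / f x) * (partial i f x / f x)"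
      using nz[OF x] has_derivative_partial[OF hd] by (simp add: partial_def[symmetric] divide_inverse)
    finally show ?thesis .
  qed
  let ?w = "\<lambda>y. partial 1 f y + \<i> * partial 2 f y" and ?k = "\<lambda>y. t1 y + \<i> * t2 y"
  have ff: "partial i f differentiable (at x)" for i by (rule smooth_on_differentiable[OF smooth_on_partial[OF f] x])
  have dt: "t1 differentiable (at x)" "t2 differentiable (at x)" using t x smooth_on_differentiable by blast+
  have pw: "partial i (partial 1 f) x + \<i> * partial i (partial 2 f) x =
      - ((partial i t1 x + \<i> * partial i t2 x) * f x + ?k x * partial i f x)" for i
  proof -
    have "partial i ?w x = partial i (\<lambda>y. - (?k y * f y)) x"
      by (rule partial_cong[OF U x eq]) (use ff in \<open>auto intro!: differentiable_add differentiable_mult\<close>)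
    then show ?thesis
      using ff dt df[OF x] by (simp add: partial_add partial_mult partial_uminus differentiable_add differentiable_mult)
  qed
  have lap: "partial 1 (partial 1 f) x + partial 2 (partial 2 f) x =
     - ((partial 1 t1 x + \<i> * partial 1 t2 x) - \<i> * (partial 2 t1 x + \<i> * partial 2 t2 x)) * f x
     - ?k x * (partial 1 f x - \<i> * partial 2 f x)"
    using pw[of 1] pw[of 2] partial_commute[OF U f x, of 1 2] i_squared by algebra
  \<comment> \<open>The sum of squares is the product of
    \<open>\<partial>\<^sub>1 f + i \<partial>\<^sub>2 f\<close> and
    \<open>\<partial>\<^sub>1 f - i \<partial>\<^sub>2 f\<close>. The equation for f turns it into
    the term that cancels the undifferentiated k in \<open>lap\<close>.\<close>
  have sqs: "partial 1 f x * partial 1 f x + partial 2 f x * partial 2 f x = - (?k x * f x) * (partial 1 f x - \<i> * partial 2 f x)"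
    using eq[OF x] i_squared by algebra
  have "(partial 1 (partial 1 f) x / f x - (partial 1 f x / f x) * (partial 1 f x / f x)) +
      (partial 2 (partial 2 f) x / f x - (partial 2 f x / f x) * (partial 2 f x / f x)) =
      (partial 1 (partial 1 f) x + partial 2 (partial 2 f) x) / f x -
      (partial 1 f x * partial 1 f x + partial 2 f x * partial 2 f x) / (f x * f x)"
    using nz[OF x] by (simp add: field_simps)
  also have "\<dots> = - ((partial 1 t1 x + \<i> * partial 1 t2 x) - \<i> * (partial 2 t1 x + \<i> * partial 2 t2 x))"
    unfolding lap sqs using nz[OF x] by (simp add: divide_simps)
  also have "\<dots> = - (partial 1 t1 x + partial 2 t2 x + \<i> * (partial 1 t2 x - partial 2 t1 x))"
    by (simp add: algebra_simps)
  finally show "partial 1 (partial 1 (\<lambda>y. ln ((cmod (f y))\<^sup>2))) x + partial 2 (partial 2 (\<lambda>y. ln ((cmod (f y))\<^sup>2))) x =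
      - 2 * Re (partial 1 t1 x + partial 2 t2 x + \<i> * (partial 1 t2 x - partial 2 t1 x))"
    unfolding qn p2 by (metis (no_types, lifting) distrib_left minus_mult_commute mult_minus_left plus_complex.sel(1) uminus_complex.sel(1))
qed

definition pullback :: "(real ^ 'n::finite \<Rightarrow> real ^ 'n ^ 'n) \<Rightarrow> (real ^ 'm::finite \<Rightarrow> real ^ 'n) \<Rightarrow> real ^ 'm \<Rightarrow> real ^ 'm ^ 'm" where
  "pullback G \<zeta> x = transpose (jacobian \<zeta> (at x)) ** G (\<zeta> x) ** jacobian \<zeta> (at x)"

text \<open>The complex number A_i for which d\<zeta>(e_i) is A_i times the target frame vector
  \<open>\<partial>\<^sub>1\<close>.\<close>

definition frame_coord :: "(real ^ 2 \<Rightarrow> real ^ 2 ^ 2) \<Rightarrow> (real ^ 2 \<Rightarrow> real ^ 2) \<Rightarrow> 2 \<Rightarrow> real ^ 2 \<Rightarrow> complex" where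
  "frame_coord G \<zeta> i x = of_real (partial i (\<lambda>x. \<zeta> x $ 1) x) + conf_root G (\<zeta> x) * of_real (partial i (\<lambda>x. \<zeta> x $ 2) x)"

definition pulled_conn :: "(real ^ 2 \<Rightarrow> real ^ 2 ^ 2) \<Rightarrow> (real ^ 2 \<Rightarrow> real ^ 2) \<Rightarrow> 2 \<Rightarrow> real ^ 2 \<Rightarrow> complex" where
  "pulled_conn G \<zeta> i x = of_real (partial i (\<lambda>x. \<zeta> x $ 1) x) * conn_form G 1 (\<zeta> x) + of_real (partial i (\<lambda>x. \<zeta> x $ 2) x) * conn_form G 2 (\<zeta> x)"

definition second_form :: "(real ^ 2 \<Rightarrow> real ^ 2 ^ 2) \<Rightarrow> (real ^ 2 \<Rightarrow> real ^ 2) \<Rightarrow> 2 \<Rightarrow> 2 \<Rightarrow> real ^ 2 \<Rightarrow> complex" where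
  "second_form G \<zeta> j i x = partial j (frame_coord G \<zeta> i) x + pulled_conn G \<zeta> j x * frame_coord G \<zeta> i x"

context
  fixes V U :: "(real ^ 2) set" and G :: "real ^ 2 \<Rightarrow> real ^ 2 ^ 2" and \<zeta> :: "real ^ 2 \<Rightarrow> real ^ 2"
  assumes VG: "metric_on V G" and U: "open U" and sm: "smooth_on U \<zeta>" and UVs: "\<zeta> ` U \<subseteq> V"
begin

private lemma UV: "x \<in> U \<Longrightarrow> \<zeta> x \<in> V"
  using UVs by blast

lemma smooth_on_zeta_nth: "smooth_on U (\<lambda>x. \<zeta> x $ k)"
  by (intro smooth_on_vec_nth U sm)

lemma smooth_on_through: "smooth_on V g \<Longrightarrow> smooth_on U (\<lambda>x. g (\<zeta> x))"
  by (rule smooth_on_compose[OF U metric_open[OF VG] _ sm]) (use UV in auto)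

lemma smooth_on_frame_coord: "smooth_on U (frame_coord G \<zeta> i)"
  unfolding frame_coord_def[abs_def]
  by (intro smooth_on_add smooth_on_mult smooth_on_of_real smooth_on_partial smooth_on_zeta_nth
      smooth_on_through[OF smooth_on_conf_root[OF VG]] U)

lemma smooth_on_pulled_conn: "smooth_on U (pulled_conn G \<zeta> i)"
  unfolding pulled_conn_def[abs_def]
  by (intro smooth_on_add smooth_on_mult smooth_on_of_real smooth_on_partial smooth_on_zeta_nth
      smooth_on_through[OF smooth_on_conn_form[OF VG]] U)

lemma partial_through:
  fixes g :: "real ^ 2 \<Rightarrow> 'b::real_normed_vector"
  assumes "x \<in> U" "smooth_on V g"
  shows "partial i (\<lambda>x. g (\<zeta> x)) x =
    partial i (\<lambda>x. \<zeta> x $ 1) x *\<^sub>R partial 1 g (\<zeta> x) + partial i (\<lambda>x. \<zeta> x $ 2) x *\<^sub>R partial 2 g (\<zeta> x)"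
  by (subst partial_compose[OF smooth_on_differentiable[OF sm assms(1)] smooth_on_differentiable[OF assms(2) UV[OF assms(1)]]])
    (simp add: sum_2)

text \<open>On each tangent space, seen as a complex line, the metric is E times the real part of
  the standard hermitian product; this rests on G22 = E |r|^2.\<close>

lemma pullback_nth:
  assumes x: "x \<in> U"
  shows "pullback G \<zeta> x $ i $ j = G (\<zeta> x) $ 1 $ 1 * Re (frame_coord G \<zeta> i x * cnj (frame_coord G \<zeta> j x))"
proof -
  note p = metric_pos11[OF VG UV[OF x]] metric_det_pos[OF VG UV[OF x]] metric_sym[OF VG UV[OF x], of 1 2]
  let ?z = "\<lambda>k i. partial i (\<lambda>x. \<zeta> x $ k) x" and ?g = "\<lambda>k l. G (\<zeta> x) $ k $ l"
  have s: "sqrt (det (G (\<zeta> x))) * sqrt (det (G (\<zeta> x))) = ?g 1 1 * ?g 2 2 - ?g 1 2 * ?g 1 2"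
    using p by (simp add: det_2)
  have g22: "?g 2 2 = ?g 1 1 * ((?g 1 2 / ?g 1 1) * (?g 1 2 / ?g 1 1) +
       (sqrt (det (G (\<zeta> x))) / ?g 1 1) * (sqrt (det (G (\<zeta> x))) / ?g 1 1))"
    using p unfolding times_divide_times_eq s by (simp add: field_simps)
  have "pullback G \<zeta> x $ i $ j = ?g 1 1 * ?z 1 i * ?z 1 j + ?g 1 2 * (?z 1 i * ?z 2 j + ?z 2 i * ?z 1 j) + ?g 2 2 * ?z 2 i * ?z 2 j"
    using p unfolding pullback_def
    by (simp add: matrix_matrix_mult_def transpose_def sum_2 jacobian_nth[OF smooth_on_differentiable[OF sm x]] algebra_simps)
  also have "\<dots> = ?g 1 1 * Re (frame_coord G \<zeta> i x * cnj (frame_coord G \<zeta> j x))"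
    unfolding g22 frame_coord_def conf_root_def using p by (simp add: field_simps)
  finally show ?thesis .
qed

text \<open>Torsion-freeness: the Christoffel symbols are symmetric and the second derivatives of
  \<zeta> commute.\<close>

lemma second_form_sym:
  assumes x: "x \<in> U"
  shows "second_form G \<zeta> 2 1 x = second_form G \<zeta> 1 2 x"
proof -
  let ?z = "\<lambda>k i x. complex_of_real (partial i (\<lambda>x. \<zeta> x $ k) x)"
  let ?zz = "\<lambda>k j i. complex_of_real (partial j (partial i (\<lambda>x. \<zeta> x $ k)) x)"
  let ?r = "conf_root G" and ?c = "\<lambda>k i j. complex_of_real (christoffel G k i j (\<zeta> x))"
  have dz: "partial i (\<lambda>x. \<zeta> x $ k) differentiable (at x)" for i k
    by (rule smooth_on_differentiable[OF smooth_on_partial[OF smooth_on_zeta_nth] x])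
  have dr: "(\<lambda>x. ?r (\<zeta> x)) differentiable (at x)"
    by (rule smooth_on_differentiable[OF smooth_on_through[OF smooth_on_conf_root[OF VG]] x])
  have pr: "partial j (\<lambda>x. ?r (\<zeta> x)) x = ?z 1 j x * partial 1 ?r (\<zeta> x) + ?z 2 j x * partial 2 ?r (\<zeta> x)" for j
    using partial_through[OF x smooth_on_conf_root[OF VG]] by (simp add: scaleR_conv_of_real)
  have pA: "partial j (frame_coord G \<zeta> i) x = ?zz 1 j i +
     (partial j (\<lambda>x. ?r (\<zeta> x)) x * ?z 2 i x + ?r (\<zeta> x) * ?zz 2 j i)" for i j
    unfolding frame_coord_def[abs_def] using dz dr
    by (simp add: partial_add partial_mult partial_of_real differentiable_of_real differentiable_mult)
  have zz: "?zz k 1 2 = ?zz k 2 1" for k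
    using partial_commute_real[OF U smooth_on_zeta_nth x] by metis
  show ?thesis
    unfolding second_form_def pA pr pulled_conn_def frame_coord_def partial_conf_root[OF VG UV[OF x]] conn_form_def zz
    using christoffel_sym[OF VG UV[OF x], of _ 1 2] by (simp add: algebra_simps)
qed

lemma partial_metric11_through:
  assumes x: "x \<in> U"
  shows "partial j (\<lambda>x. G (\<zeta> x) $ 1 $ 1) x = 2 * G (\<zeta> x) $ 1 $ 1 * Re (pulled_conn G \<zeta> j x)"
  using partial_through[OF x smooth_on_metric_nth[OF VG, of 1 1], of j]
  by (simp add: Re_conn_form[OF VG UV[OF x]] pulled_conn_def algebra_simps)

text \<open>Metric compatibility, pulled back. The derivative of the factor E contributes 2 Re of
  \<open>pulled_conn\<close>, which is what completes the two ordinary derivatives of the frame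
  coefficients to covariant ones.\<close>

lemma partial_pullback_nth:
  assumes x: "x \<in> U"
  shows "partial j (\<lambda>x. pullback G \<zeta> x $ i $ k) x = G (\<zeta> x) $ 1 $ 1 *
    Re (second_form G \<zeta> j i x * cnj (frame_coord G \<zeta> k x) + frame_coord G \<zeta> i x * cnj (second_form G \<zeta> j k x))"
proof -
  let ?E = "\<lambda>x. G (\<zeta> x) $ 1 $ 1" and ?A = "frame_coord G \<zeta>" and ?T = "pulled_conn G \<zeta>"
  have dE: "?E differentiable (at x)"
    by (rule smooth_on_differentiable[OF smooth_on_through[OF smooth_on_metric_nth[OF VG]] x])
  have dA: "?A i differentiable (at x)" for i by (rule smooth_on_differentiable[OF smooth_on_frame_coord x])
  have dc: "(\<lambda>x. cnj (?A k x)) differentiable (at x)" by (rule differentiable_bounded_linear[OF bounded_linear_cnj dA])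
  have dR: "(\<lambda>x. Re (?A i x * cnj (?A k x))) differentiable (at x)"
    by (rule differentiable_bounded_linear[OF bounded_linear_Re differentiable_mult[OF dA dc]])
  have sE: "smooth_on U (\<lambda>x. ?E x * Re (?A i x * cnj (?A k x)))"
    by (intro smooth_on_mult smooth_on_through smooth_on_metric_nth VG U smooth_on_linear_compose[OF bounded_linear_Re]
       smooth_on_linear_compose[OF bounded_linear_cnj] smooth_on_frame_coord)
  have "partial j (\<lambda>x. pullback G \<zeta> x $ i $ k) x = partial j (\<lambda>x. ?E x * Re (?A i x * cnj (?A k x))) x"
    by (rule partial_cong[OF U x pullback_nth[symmetric] smooth_on_differentiable[OF sE x], symmetric])
  also have "\<dots> = 2 * ?E x * Re (?T j x) * Re (?A i x * cnj (?A k x)) +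
     ?E x * Re (partial j (?A i) x * cnj (?A k x) + ?A i x * cnj (partial j (?A k) x))"
    unfolding partial_mult[OF dE dR] partial_metric11_through[OF x] partial_linear[OF bounded_linear_Re differentiable_mult[OF dA dc]]
        partial_mult[OF dA dc] partial_linear[OF bounded_linear_cnj dA] by (simp add: algebra_simps)
  also have "\<dots> = ?E x * Re (second_form G \<zeta> j i x * cnj (?A k x) + ?A i x * cnj (second_form G \<zeta> j k x))"
    unfolding second_form_def by (simp add: algebra_simps)
  finally show ?thesis .
qed

text \<open>\<open>second_form\<close> is the second fundamental form of \<open>\<zeta>\<close> expressed in the complex frame \<open>\<partial>\<^sub>1\<close>, so its
  trace is the tension field; the hypothesis says that the stress-energy tensor is divergence free.\<close>

lemma tension_vanishes:
  assumes x: "x \<in> U" and J: "det (jacobian \<zeta> (at x)) \<noteq> 0"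
    and eq: "\<And>k. (\<Sum>i\<in>UNIV. partial i (\<lambda>x. pullback G \<zeta> x $ i $ k) x) =
       (\<Sum>i\<in>UNIV. partial k (\<lambda>x. pullback G \<zeta> x $ i $ i) x) / 2"
  shows "second_form G \<zeta> 1 1 x + second_form G \<zeta> 2 2 x = 0"
proof -
  let ?A = "\<lambda>i. frame_coord G \<zeta> i x" and ?N = "\<lambda>j i. second_form G \<zeta> j i x"
  let ?T = "?N 1 1 + ?N 2 2"
  note p = metric_pos11[OF VG UV[OF x]] metric_det_pos[OF VG UV[OF x]]
  note e = eq[unfolded sum_2 partial_pullback_nth[OF x], unfolded second_form_sym[OF x]]
  have e2: "2 * (a + b) = c" if "a + b = c / 2" for a b c :: real using that by simp
  \<comment> \<open>By symmetry of \<open>second_form\<close>, half the derivative of the trace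
    cancels the terms in which the second factor is differentiated. The inner product of
    \<open>?T\<close> with d\<zeta>(e_k) remains.\<close>
  have "G (\<zeta> x) $ 1 $ 1 * Re (?T * cnj (?A 1)) = 0" "G (\<zeta> x) $ 1 $ 1 * Re (?T * cnj (?A 2)) = 0"
    using e2[OF e[of 1]] e2[OF e[of 2]] by (simp_all add: second_form_sym[OF x] algebra_simps)
  then have R: "Re (?T * cnj (?A 1)) = 0" "Re (?T * cnj (?A 2)) = 0" using p by simp_all
  have "Im (cnj (?A 1) * ?A 2) * G (\<zeta> x) $ 1 $ 1 = sqrt (det (G (\<zeta> x))) * det (jacobian \<zeta> (at x))"
    unfolding frame_coord_def conf_root_def det_2[of "jacobian \<zeta> (at x)"] jacobian_nth[OF smooth_on_differentiable[OF sm x]]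
    using p by (simp add: field_simps)
  then have I: "Im (cnj (?A 1) * ?A 2) \<noteq> 0" using p J by auto
  \<comment> \<open>Cramer's rule for two real equations: the imaginary part is their determinant,
    and it is a positive multiple of the Jacobian.\<close>
  have "Re ?T * Im (cnj (?A 1) * ?A 2) = 0" "Im ?T * Im (cnj (?A 1) * ?A 2) = 0"
    using R by (simp_all, algebra+)
  then show ?thesis using I by (auto simp: complex_eq_iff)
qed

text \<open>Exterior derivative and pullback commute: the second derivatives of \<zeta> cancel, and
  the area form acquires the Jacobian determinant.\<close>

lemma pulled_conn_curvature:
  assumes x: "x \<in> U"
  shows "partial 1 (pulled_conn G \<zeta> 2) x - partial 2 (pulled_conn G \<zeta> 1) x =
    - \<i> * of_real (metric_curvature G (\<zeta> x) * sqrt (det (G (\<zeta> x))) * det (jacobian \<zeta> (at x)))"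
proof -
  let ?z = "\<lambda>k i x. complex_of_real (partial i (\<lambda>x. \<zeta> x $ k) x)"
  let ?zz = "\<lambda>k j i. complex_of_real (partial j (partial i (\<lambda>x. \<zeta> x $ k)) x)"
  let ?t = "\<lambda>k x. conn_form G k (\<zeta> x)"
  have dz: "partial i (\<lambda>x. \<zeta> x $ k) differentiable (at x)" for i k
    by (rule smooth_on_differentiable[OF smooth_on_partial[OF smooth_on_zeta_nth] x])
  have dt: "?t k differentiable (at x)" for k
    by (rule smooth_on_differentiable[OF smooth_on_through[OF smooth_on_conn_form[OF VG]] x])
  have pt: "partial j (?t k) x = ?z 1 j x * partial 1 (conn_form G k) (\<zeta> x) + ?z 2 j x * partial 2 (conn_form G k) (\<zeta> x)" for j k
    using partial_through[OF x smooth_on_conn_form[OF VG]] by (simp add: scaleR_conv_of_real)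
  have pp: "partial j (pulled_conn G \<zeta> i) x = (?zz 1 j i * ?t 1 x + ?z 1 i x * partial j (?t 1) x) +
     (?zz 2 j i * ?t 2 x + ?z 2 i x * partial j (?t 2) x)" for i j
    unfolding pulled_conn_def[abs_def] using dz dt
    by (simp add: partial_add partial_mult partial_of_real differentiable_of_real differentiable_mult)
  have zz: "?zz k 1 2 = ?zz k 2 1" for k
    using partial_commute_real[OF U smooth_on_zeta_nth x] by metis
  have "partial 1 (pulled_conn G \<zeta> 2) x - partial 2 (pulled_conn G \<zeta> 1) x =
     (partial 1 (conn_form G 2) (\<zeta> x) - partial 2 (conn_form G 1) (\<zeta> x)) * (?z 1 1 x * ?z 2 2 x - ?z 1 2 x * ?z 2 1 x)"
    unfolding pp pt zz by (simp add: algebra_simps)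
  also have "?z 1 1 x * ?z 2 2 x - ?z 1 2 x * ?z 2 1 x = of_real (det (jacobian \<zeta> (at x)))"
    by (simp add: det_2 jacobian_nth[OF smooth_on_differentiable[OF sm x]])
  finally show ?thesis unfolding conn_form_curvature[OF VG UV[OF x]] by simp
qed

end

text \<open>For a linear map \<open>A\<close> with singular values \<open>p \<ge> q > 0\<close> and \<open>S = A\<^sup>T A\<close>, this is the square
  \<open>((p - q) / (p + q))\<^sup>2\<close> of the modulus of its Beltrami coefficient (or of that of its conjugate).\<close>

definition dilatation :: "real ^ 2 ^ 2 \<Rightarrow> real" where
  "dilatation S = (trace S - 2 * sqrt (det S)) / (trace S + 2 * sqrt (det S))"

lemma trace_2: "trace (S :: real ^ 2 ^ 2) = S $ 1 $ 1 + S $ 2 $ 2"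
  by (simp add: trace_def sum_2)

lemma dilatation_scale:
  assumes "0 < l" shows "dilatation (l *\<^sub>R S) = dilatation S"
proof -
  have "det (l *\<^sub>R S) = l\<^sup>2 * det S" by (simp add: det_2 power2_eq_square algebra_simps)
  then have "sqrt (det (l *\<^sub>R S)) = l * sqrt (det S)" using assms by (simp add: real_sqrt_mult)
  moreover have "trace (l *\<^sub>R S) = l * trace S" by (simp add: trace_2 algebra_simps)
  ultimately have "dilatation (l *\<^sub>R S) = (l * (trace S - 2 * sqrt (det S))) / (l * (trace S + 2 * sqrt (det S)))"
    by (simp add: dilatation_def algebra_simps)
  then show ?thesis using assms by (simp add: dilatation_def)
qed

lemma smooth_on_pullback:
  fixes G :: "real ^ 2 \<Rightarrow> real ^ 2 ^ 2" and \<zeta> :: "real ^ 2 \<Rightarrow> real ^ 2"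
  assumes VG: "metric_on V G" and U: "open U" and sm: "smooth_on U \<zeta>" and UVs: "\<zeta> ` U \<subseteq> V"
  shows "smooth_on U (\<lambda>x. pullback G \<zeta> x $ i $ j)"
proof (rule smooth_on_cong[OF U pullback_nth[OF VG U sm UVs, symmetric]])
  show "smooth_on U (\<lambda>x. G (\<zeta> x) $ 1 $ 1 * Re (frame_coord G \<zeta> i x * cnj (frame_coord G \<zeta> j x)))"
    by (intro smooth_on_mult smooth_on_through[OF VG U sm UVs] smooth_on_metric_nth VG U smooth_on_linear_compose[OF bounded_linear_Re]
       smooth_on_linear_compose[OF bounded_linear_cnj] smooth_on_frame_coord[OF VG U sm UVs])
qed

lemma pullback_sym:
  fixes G :: "real ^ 2 \<Rightarrow> real ^ 2 ^ 2" and \<zeta> :: "real ^ 2 \<Rightarrow> real ^ 2"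
  assumes VG: "metric_on V G" and U: "open U" and sm: "smooth_on U \<zeta>" and UVs: "\<zeta> ` U \<subseteq> V" and x: "x \<in> U"
  shows "pullback G \<zeta> x $ j $ i = pullback G \<zeta> x $ i $ j"
  unfolding pullback_nth[OF VG U sm UVs x] by (simp add: mult_ac)

context
  fixes V U :: "(real ^ 2) set" and G :: "real ^ 2 \<Rightarrow> real ^ 2 ^ 2" and \<zeta> :: "real ^ 2 \<Rightarrow> real ^ 2"
  assumes VG: "metric_on V G" and U: "open U" and sm: "smooth_on U \<zeta>" and UVs: "\<zeta> ` U \<subseteq> V"
    and J: "\<And>x. x \<in> U \<Longrightarrow> det (jacobian \<zeta> (at x)) \<noteq> 0"
begin

private lemma in_V: "x \<in> U \<Longrightarrow> \<zeta> x \<in> V"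
  using UVs by blast

text \<open>Both sides are the signed area of the parallelogram spanned by d\<zeta>(e_1) and
  d\<zeta>(e_2).\<close>

lemma frame_coord_orientation:
  assumes x: "x \<in> U"
  shows "G (\<zeta> x) $ 1 $ 1 * Im (cnj (frame_coord G \<zeta> 1 x) * frame_coord G \<zeta> 2 x) =
    sqrt (det (G (\<zeta> x))) * det (jacobian \<zeta> (at x))"
  unfolding frame_coord_def conf_root_def det_2[of "jacobian \<zeta> (at x)"] jacobian_nth[OF smooth_on_differentiable[OF sm x]]
  using metric_pos11[OF VG in_V[OF x]] by (simp add: field_simps)

lemma det_pullback: assumes x: "x \<in> U"
  shows "det (pullback G \<zeta> x) = det (G (\<zeta> x)) * (det (jacobian \<zeta> (at x)))\<^sup>2" "0 < det (pullback G \<zeta> x)"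
proof -
  show "det (pullback G \<zeta> x) = det (G (\<zeta> x)) * (det (jacobian \<zeta> (at x)))\<^sup>2"
    by (simp add: pullback_def det_mul power2_eq_square)
  then show "0 < det (pullback G \<zeta> x)" using metric_det_pos[OF VG in_V[OF x]] J[OF x] by simp
qed

lemma trace_pullback: assumes x: "x \<in> U"
  shows "trace (pullback G \<zeta> x) = G (\<zeta> x) $ 1 $ 1 * ((cmod (frame_coord G \<zeta> 1 x))\<^sup>2 + (cmod (frame_coord G \<zeta> 2 x))\<^sup>2)"
  unfolding trace_2 pullback_nth[OF VG U sm UVs x] cmod_power2 by (simp add: power2_eq_square algebra_simps)

lemma cmod_frame_sum_diff:
  "(cmod (A - \<i> * B))\<^sup>2 = (cmod A)\<^sup>2 + (cmod B)\<^sup>2 + 2 * Im (cnj A * B)"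
  "(cmod (A + \<i> * B))\<^sup>2 = (cmod A)\<^sup>2 + (cmod B)\<^sup>2 - 2 * Im (cnj A * B)"
  unfolding cmod_power2 by (simp_all add: power2_eq_square algebra_simps)

text \<open>Write A_i for the frame coefficients and I for Im (cnj A_1 * A_2). Then |a|^2 and |b|^2
  are |A_1|^2 + |A_2|^2 plus and minus 2 I. Times E, the sum of squares is the trace of the pullback
  and |I| the root of its determinant, while I has the sign of the Jacobian.\<close>

lemma dilatation_pullback:
  assumes x: "x \<in> U"
  defines "a \<equiv> frame_coord G \<zeta> 1 x - \<i> * frame_coord G \<zeta> 2 x"
    and "b \<equiv> frame_coord G \<zeta> 1 x + \<i> * frame_coord G \<zeta> 2 x"
  shows "0 < det (jacobian \<zeta> (at x)) \<Longrightarrow> cmod b < cmod a \<and> dilatation (pullback G \<zeta> x) = (cmod b)\<^sup>2 / (cmod a)\<^sup>2"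
    "det (jacobian \<zeta> (at x)) < 0 \<Longrightarrow> cmod a < cmod b \<and> dilatation (pullback G \<zeta> x) = (cmod a)\<^sup>2 / (cmod b)\<^sup>2"
proof -
  let ?E = "G (\<zeta> x) $ 1 $ 1" and ?I = "Im (cnj (frame_coord G \<zeta> 1 x) * frame_coord G \<zeta> 2 x)"
  note p = metric_pos11[OF VG in_V[OF x]] metric_det_pos[OF VG in_V[OF x]]
  have "sqrt (det (pullback G \<zeta> x)) = sqrt (det (G (\<zeta> x))) * \<bar>det (jacobian \<zeta> (at x))\<bar>"
    by (simp add: det_pullback[OF x] real_sqrt_mult)
  also have "\<dots> = \<bar>?E * ?I\<bar>" unfolding frame_coord_orientation[OF x] using p by (simp add: abs_mult)
  finally have sq: "sqrt (det (pullback G \<zeta> x)) = ?E * \<bar>?I\<bar>" using p by (simp add: abs_mult)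
  have "dilatation (pullback G \<zeta> x) = (?E * ((cmod (frame_coord G \<zeta> 1 x))\<^sup>2 + (cmod (frame_coord G \<zeta> 2 x))\<^sup>2 - 2 * \<bar>?I\<bar>)) /
     (?E * ((cmod (frame_coord G \<zeta> 1 x))\<^sup>2 + (cmod (frame_coord G \<zeta> 2 x))\<^sup>2 + 2 * \<bar>?I\<bar>))"
    unfolding dilatation_def sq trace_pullback[OF x] by (simp add: algebra_simps)
  then have d: "dilatation (pullback G \<zeta> x) = ((cmod (frame_coord G \<zeta> 1 x))\<^sup>2 + (cmod (frame_coord G \<zeta> 2 x))\<^sup>2 - 2 * \<bar>?I\<bar>) /
     ((cmod (frame_coord G \<zeta> 1 x))\<^sup>2 + (cmod (frame_coord G \<zeta> 2 x))\<^sup>2 + 2 * \<bar>?I\<bar>)"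
    using p by simp
  have sgn: "0 < det (jacobian \<zeta> (at x)) \<Longrightarrow> 0 < ?E * ?I" "det (jacobian \<zeta> (at x)) < 0 \<Longrightarrow> ?E * ?I < 0"
    unfolding frame_coord_orientation[OF x] using p by (auto intro: mult_pos_neg)
  show "cmod b < cmod a \<and> dilatation (pullback G \<zeta> x) = (cmod b)\<^sup>2 / (cmod a)\<^sup>2" if "0 < det (jacobian \<zeta> (at x))"
  proof -
    have I: "0 < ?I" using sgn(1)[OF that] p by (simp add: zero_less_mult_iff)
    have "(cmod b)\<^sup>2 < (cmod a)\<^sup>2" unfolding a_def b_def cmod_frame_sum_diff using I by simp
    then have "cmod b < cmod a" by (rule power_less_imp_less_base) simp
    then show ?thesis unfolding d using I by (simp add: a_def b_def cmod_frame_sum_diff)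
  qed
  show "cmod a < cmod b \<and> dilatation (pullback G \<zeta> x) = (cmod a)\<^sup>2 / (cmod b)\<^sup>2" if "det (jacobian \<zeta> (at x)) < 0"
  proof -
    have I: "?I < 0" using sgn(2)[OF that] p by (simp add: mult_less_0_iff)
    have "(cmod a)\<^sup>2 < (cmod b)\<^sup>2" unfolding a_def b_def cmod_frame_sum_diff using I by simp
    then have "cmod a < cmod b" by (rule power_less_imp_less_base) simp
    then show ?thesis 
      unfolding d a_def b_def cmod_frame_sum_diff abs_of_neg[OF I] by (simp add: algebra_simps)
  qed
qed

lemma dilatation_bounds:
  assumes x: "x \<in> U" shows "0 \<le> dilatation (pullback G \<zeta> x)" "dilatation (pullback G \<zeta> x) < 1"
proof -
  have aux: "(cmod b)\<^sup>2 / (cmod a)\<^sup>2 < 1 \<and> 0 \<le> (cmod b)\<^sup>2 / (cmod a)\<^sup>2" if "cmod b < cmod a" for a b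
  proof -
    have "(cmod b)\<^sup>2 < (cmod a)\<^sup>2" using that by (simp add: power_strict_mono)
    moreover have "0 < (cmod a)\<^sup>2" using calculation by (smt (verit) zero_le_power2)
    ultimately show ?thesis by simp
  qed
  show "0 \<le> dilatation (pullback G \<zeta> x)" "dilatation (pullback G \<zeta> x) < 1"
    using dilatation_pullback[OF x] J[OF x] aux by (metis linorder_neqE_linordered_idom)+
qed

text \<open>Zero dilatation annihilates \<open>a\<close> or \<open>b\<close>, so the second frame
  coefficient is i or -i times the first: the images of e_1 and e_2 are orthogonal and equally
  long.\<close>

lemma dilatation_0_conformal:
  assumes x: "x \<in> U" and 0: "dilatation (pullback G \<zeta> x) = 0"
  shows "\<exists>l. pullback G \<zeta> x = l *\<^sub>R mat 1"
proof -
  let ?A = "\<lambda>i. frame_coord G \<zeta> i x"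
  have "?A 1 + \<i> * ?A 2 = 0 \<or> ?A 1 - \<i> * ?A 2 = 0"
    using dilatation_pullback[OF x] J[OF x] 0 by (cases "0 < det (jacobian \<zeta> (at x))") fastforce+
  then have "?A 2 = \<i> * ?A 1 \<or> ?A 2 = - (\<i> * ?A 1)"
    by (auto simp: complex_eq_iff)
  then have "Re (?A 1 * cnj (?A 2)) = 0" "Re (?A 2 * cnj (?A 1)) = 0" "Re (?A 2 * cnj (?A 2)) = Re (?A 1 * cnj (?A 1))"
    by (auto simp: algebra_simps)
  then show ?thesis
    unfolding vec_eq_iff forall_2 pullback_nth[OF VG U sm UVs x] by (auto simp: mat_def)
qed

lemma continuous_on_dilatation: "continuous_on U (\<lambda>x. dilatation (pullback G \<zeta> x))"
proof -
  have c: "continuous_on U (\<lambda>x. pullback G \<zeta> x $ i $ j)" for i j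
    by (rule smooth_on_imp_continuous_on[OF smooth_on_pullback[OF VG U sm UVs]])
  have "trace (pullback G \<zeta> x) + 2 * sqrt (det (pullback G \<zeta> x)) \<noteq> 0" if x: "x \<in> U" for x
  proof -
    have "0 \<le> trace (pullback G \<zeta> x)" unfolding trace_pullback[OF x] using metric_pos11[OF VG in_V[OF x]] by simp
    moreover have "0 < sqrt (det (pullback G \<zeta> x))" using det_pullback(2)[OF x] by simp
    ultimately show ?thesis by linarith
  qed
  then have nz: "\<forall>x\<in>U. trace (pullback G \<zeta> x) + 2 * sqrt (det (pullback G \<zeta> x)) \<noteq> 0" by blast
  have "continuous_on U (\<lambda>x. trace (pullback G \<zeta> x))" "continuous_on U (\<lambda>x. det (pullback G \<zeta> x))"
    unfolding trace_2 det_2 by (intro continuous_intros c)+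
  then show ?thesis unfolding dilatation_def by (intro continuous_intros nz)
qed

context
  assumes tension: "\<And>x. x \<in> U \<Longrightarrow> second_form G \<zeta> 1 1 x + second_form G \<zeta> 2 2 x = 0"
begin

text \<open>Applied to \<open>a\<close>, the Cauchy-Riemann operator produces the trace of
  \<open>second_form\<close>, zero by \<open>tension\<close>, its antisymmetric part, zero by
  symmetry, and the connection term. For \<open>b\<close> the conjugate operator does the same, so
  \<open>laplacian_ln_norm_sq\<close> is applied to the conjugate of \<open>b\<close>. Conjugation
  keeps the divergence part D and reverses the curvature part C.\<close>

lemma frame_combination_laplacian:
  assumes W: "open W" "W \<subseteq> U" and x: "x \<in> W"
  defines "a \<equiv> \<lambda>x. frame_coord G \<zeta> 1 x - \<i> * frame_coord G \<zeta> 2 x"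
    and "b \<equiv> \<lambda>x. frame_coord G \<zeta> 1 x + \<i> * frame_coord G \<zeta> 2 x"
    and "D \<equiv> 2 * Re (partial 1 (pulled_conn G \<zeta> 1) x + partial 2 (pulled_conn G \<zeta> 2) x)"
    and "C \<equiv> 2 * (metric_curvature G (\<zeta> x) * sqrt (det (G (\<zeta> x))) * det (jacobian \<zeta> (at x)))"
  shows "(\<And>y. y \<in> W \<Longrightarrow> a y \<noteq> 0) \<Longrightarrow> smooth_on W (\<lambda>y. ln ((cmod (a y))\<^sup>2)) \<and>
      partial 1 (partial 1 (\<lambda>y. ln ((cmod (a y))\<^sup>2))) x + partial 2 (partial 2 (\<lambda>y. ln ((cmod (a y))\<^sup>2))) x = - D - C"
    "(\<And>y. y \<in> W \<Longrightarrow> b y \<noteq> 0) \<Longrightarrow> smooth_on W (\<lambda>y. ln ((cmod (b y))\<^sup>2)) \<and>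
      partial 1 (partial 1 (\<lambda>y. ln ((cmod (b y))\<^sup>2))) x + partial 2 (partial 2 (\<lambda>y. ln ((cmod (b y))\<^sup>2))) x = - D + C"
proof -
  let ?A = "frame_coord G \<zeta>" and ?T = "pulled_conn G \<zeta>"
  note sA = smooth_on_frame_coord[OF VG U sm UVs] and sT = smooth_on_pulled_conn[OF VG U sm UVs]
  have dA: "?A i differentiable (at y)" if "y \<in> U" for i y using smooth_on_differentiable[OF sA that] .
  have dT: "?T i differentiable (at y)" if "y \<in> U" for i y using smooth_on_differentiable[OF sT that] .
  have pA: "partial j (?A i) y = second_form G \<zeta> j i y - ?T j y * ?A i y" for i j y
    by (simp add: second_form_def)
  have ab: "partial j a y = partial j (?A 1) y - \<i> * partial j (?A 2) y"
    "partial j b y = partial j (?A 1) y + \<i> * partial j (?A 2) y" if "y \<in> U" for j y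
    unfolding a_def b_def using dA[OF that] by (simp_all add: partial_add partial_diff partial_mult differentiable_mult)
  have sa: "smooth_on W a" and sb: "smooth_on W b"
    unfolding a_def b_def by (intro smooth_on_add smooth_on_diff smooth_on_mult smooth_on_const W(1) smooth_on_subset[OF sA W(2)])+
  have sT': "smooth_on W (?T i)" "smooth_on W (\<lambda>y. cnj (?T i y))" for i
    by (intro smooth_on_subset[OF sT W(2)] smooth_on_linear_compose[OF bounded_linear_cnj] W(1))+
  have scb: "smooth_on W (\<lambda>y. cnj (b y))" by (intro smooth_on_linear_compose[OF bounded_linear_cnj] W sb)
  have xU: "x \<in> U" using W x by auto
  have curv: "partial 1 (?T 2) x - partial 2 (?T 1) x = - \<i> * of_real (C / 2)"
    unfolding pulled_conn_curvature[OF VG U sm UVs xU] C_def by simp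
  have ea: "partial 1 a y + \<i> * partial 2 a y = - ((?T 1 y + \<i> * ?T 2 y) * a y)" if "y \<in> W" for y
  proof -
    have y: "y \<in> U" using that W by auto
    have "partial 1 a y + \<i> * partial 2 a y = (second_form G \<zeta> 1 1 y + second_form G \<zeta> 2 2 y)
       + \<i> * (second_form G \<zeta> 2 1 y - second_form G \<zeta> 1 2 y) - (?T 1 y + \<i> * ?T 2 y) * a y"
      unfolding ab[OF y] pA unfolding a_def by (simp add: algebra_simps)
    then show ?thesis by (simp add: tension[OF y] second_form_sym[OF VG U sm UVs y])
  qed
  have eb: "partial 1 (\<lambda>y. cnj (b y)) y + \<i> * partial 2 (\<lambda>y. cnj (b y)) y = - ((cnj (?T 1 y) + \<i> * cnj (?T 2 y)) * cnj (b y))" if "y \<in> W" for y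
  proof -
    have y: "y \<in> U" using that W by auto
    have "partial 1 b y - \<i> * partial 2 b y = (second_form G \<zeta> 1 1 y + second_form G \<zeta> 2 2 y)
       + \<i> * (second_form G \<zeta> 1 2 y - second_form G \<zeta> 2 1 y) - (?T 1 y - \<i> * ?T 2 y) * b y"
      unfolding ab[OF y] pA unfolding b_def by (simp add: algebra_simps)
    then have "partial 1 b y - \<i> * partial 2 b y = - ((?T 1 y - \<i> * ?T 2 y) * b y)"
      by (simp add: tension[OF y] second_form_sym[OF VG U sm UVs y])
    from arg_cong[OF this, of cnj] show ?thesis
      by (simp add: partial_linear[OF bounded_linear_cnj smooth_on_differentiable[OF sb that]])
  qed
  show "smooth_on W (\<lambda>y. ln ((cmod (a y))\<^sup>2)) \<and>
      partial 1 (partial 1 (\<lambda>y. ln ((cmod (a y))\<^sup>2))) x + partial 2 (partial 2 (\<lambda>y. ln ((cmod (a y))\<^sup>2))) x = - D - C"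
    if nz: "\<And>y. y \<in> W \<Longrightarrow> a y \<noteq> 0"
    using laplacian_ln_norm_sq[OF W(1) x sa nz sT'(1) sT'(1) ea] unfolding curv D_def by simp
  show "smooth_on W (\<lambda>y. ln ((cmod (b y))\<^sup>2)) \<and>
      partial 1 (partial 1 (\<lambda>y. ln ((cmod (b y))\<^sup>2))) x + partial 2 (partial 2 (\<lambda>y. ln ((cmod (b y))\<^sup>2))) x = - D + C"
    if nz: "\<And>y. y \<in> W \<Longrightarrow> b y \<noteq> 0"
  proof -
    have nz': "cnj (b y) \<noteq> 0" if "y \<in> W" for y using nz[OF that] by simp
    have pc: "partial j (\<lambda>y. cnj (?T i y)) x = cnj (partial j (?T i) x)" for i j
      by (rule partial_linear[OF bounded_linear_cnj dT[OF xU]])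
    have "Im (partial 1 (?T 2) x) - Im (partial 2 (?T 1) x) = - C / 2"
      using arg_cong[OF curv, of Im] by simp
    then show ?thesis
      using laplacian_ln_norm_sq[OF W(1) x scb nz' sT'(2) sT'(2) eb] unfolding pc D_def by simp
  qed
qed

text \<open>In the difference of the two logarithms D cancels and C doubles. For negative Jacobian
  \<open>a\<close> and \<open>b\<close> exchange roles, hence the absolute value.\<close>

lemma laplacian_ln_dilatation:
  assumes x: "x \<in> U" and pos: "0 < dilatation (pullback G \<zeta> x)"
  defines "f \<equiv> \<lambda>x. ln (dilatation (pullback G \<zeta> x))"
  shows "\<exists>W. open W \<and> x \<in> W \<and> W \<subseteq> U \<and> (\<forall>y\<in>W. 0 < dilatation (pullback G \<zeta> y)) \<and> smooth_on W f \<and>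
    partial 1 (partial 1 f) x + partial 2 (partial 2 f) x =
      4 * metric_curvature G (\<zeta> x) * sqrt (det (G (\<zeta> x))) * \<bar>det (jacobian \<zeta> (at x))\<bar>"
proof -
  let ?A = "frame_coord G \<zeta>"
  define a where "a = (\<lambda>x. ?A 1 x - \<i> * ?A 2 x)"
  define b where "b = (\<lambda>x. ?A 1 x + \<i> * ?A 2 x)"
  define P where "P = (\<lambda>x. dilatation (pullback G \<zeta> x))"
  let ?J = "\<lambda>y. det (jacobian \<zeta> (at y))"
  have cJ: "continuous_on U ?J"
  proof (rule continuous_on_eq)
    have nz: "\<forall>x\<in>U. sqrt (det (G (\<zeta> x))) \<noteq> 0"
      using metric_det_pos[OF VG in_V] by (metis less_irrefl real_sqrt_gt_0_iff)
    show "continuous_on U (\<lambda>x. G (\<zeta> x) $ 1 $ 1 * Im (cnj (?A 1 x) * ?A 2 x) / sqrt (det (G (\<zeta> x))))"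
      by (intro continuous_intros smooth_on_imp_continuous_on[OF smooth_on_frame_coord[OF VG U sm UVs]]
         smooth_on_imp_continuous_on[OF smooth_on_through[OF VG U sm UVs]] metric_smooth[OF VG] smooth_on_metric_det[OF VG] nz)
    show "G (\<zeta> x) $ 1 $ 1 * Im (cnj (?A 1 x) * ?A 2 x) / sqrt (det (G (\<zeta> x))) = ?J x" if "x \<in> U" for x
      unfolding frame_coord_orientation[OF that] using metric_det_pos[OF VG in_V[OF that]] by simp
  qed
  \<comment> \<open>On \<open>W\<close> the Jacobian keeps the sign it has at \<open>x\<close>, so
    the same one of \<open>a\<close> and \<open>b\<close> is the smaller throughout; positive
    dilatation keeps that one away from zero.\<close>
  define W where "W = (if 0 < ?J x then U \<inter> ?J -` {0<..} \<inter> (U \<inter> P -` {0<..}) else U \<inter> ?J -` {..<0} \<inter> (U \<inter> P -` {0<..}))"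
  have W: "open W" "W \<subseteq> U" and xW: "x \<in> W"
    using continuous_open_preimage[OF continuous_on_dilatation U, of "{0<..}"]
      continuous_open_preimage[OF cJ U, of "{0<..}"] continuous_open_preimage[OF cJ U, of "{..<0}"] x pos J[OF x]
    by (auto simp: W_def P_def intro: open_Int)
  have WP: "0 < P y" if "y \<in> W" for y using that by (auto simp: W_def split: if_splits)
  note dil = dilatation_pullback[folded a_def b_def P_def]
  have fP: "f = (\<lambda>x. ln (P x))" by (simp add: f_def P_def)
  have dd: "partial i (partial i (\<lambda>y. ln ((cmod (h y))\<^sup>2) - ln ((cmod (g y))\<^sup>2))) x =
     partial i (partial i (\<lambda>y. ln ((cmod (h y))\<^sup>2))) x - partial i (partial i (\<lambda>y. ln ((cmod (g y))\<^sup>2))) x"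
    if "smooth_on W (\<lambda>y. ln ((cmod (h y))\<^sup>2))" "smooth_on W (\<lambda>y. ln ((cmod (g y))\<^sup>2))" for h g :: "real ^ 2 \<Rightarrow> complex" and i
  proof -
    have sd: "smooth_on W (\<lambda>y. ln ((cmod (h y))\<^sup>2) - ln ((cmod (g y))\<^sup>2))" by (intro smooth_on_diff that W)
    have "partial i (partial i (\<lambda>y. ln ((cmod (h y))\<^sup>2) - ln ((cmod (g y))\<^sup>2))) x =
      partial i (\<lambda>y. partial i (\<lambda>y. ln ((cmod (h y))\<^sup>2)) y - partial i (\<lambda>y. ln ((cmod (g y))\<^sup>2)) y) x"
      by (rule partial_cong[OF W(1) xW])
        (use that smooth_on_differentiable[OF smooth_on_partial[OF sd] xW] in \<open>auto intro!: partial_diff smooth_on_differentiable\<close>)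
    then show ?thesis
      by (simp add: partial_diff smooth_on_differentiable[OF smooth_on_partial xW] that)
  qed
  have main: "smooth_on W f \<and> partial 1 (partial 1 f) x + partial 2 (partial 2 f) x = L1 - L2"
    if h: "smooth_on W (\<lambda>y. ln ((cmod (h y))\<^sup>2)) \<and>
      partial 1 (partial 1 (\<lambda>y. ln ((cmod (h y))\<^sup>2))) x + partial 2 (partial 2 (\<lambda>y. ln ((cmod (h y))\<^sup>2))) x = L1"
     and g: "smooth_on W (\<lambda>y. ln ((cmod (g y))\<^sup>2)) \<and>
      partial 1 (partial 1 (\<lambda>y. ln ((cmod (g y))\<^sup>2))) x + partial 2 (partial 2 (\<lambda>y. ln ((cmod (g y))\<^sup>2))) x = L2"
     and eq: "\<And>y. y \<in> W \<Longrightarrow> g y \<noteq> 0 \<and> h y \<noteq> 0 \<and> P y = (cmod (h y))\<^sup>2 / (cmod (g y))\<^sup>2" for h g L1 L2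
  proof -
    let ?d = "\<lambda>y. ln ((cmod (h y))\<^sup>2) - ln ((cmod (g y))\<^sup>2)"
    have sd: "smooth_on W ?d" using h g by (intro smooth_on_diff W) auto
    have eqf: "?d y = f y" if "y \<in> W" for y using eq[OF that] by (simp add: fP ln_div)
    have sf: "smooth_on W f" by (rule smooth_on_cong[OF W(1) eqf sd])
    have p1: "partial i ?d y = partial i f y" if "y \<in> W" for i y
      by (rule partial_cong[OF W(1) that eqf smooth_on_differentiable[OF sd that]])
    have "partial i (partial i ?d) x = partial i (partial i f) x" for i
      by (rule partial_cong[OF W(1) xW p1 smooth_on_differentiable[OF smooth_on_partial[OF sd] xW]])
    then show ?thesis using sf dd[of h g] h g by (metis (no_types, lifting) add_diff_add)
  qed
  define D where "D = 2 * Re (partial 1 (pulled_conn G \<zeta> 1) x + partial 2 (pulled_conn G \<zeta> 2) x)"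
  define C where "C = 2 * (metric_curvature G (\<zeta> x) * sqrt (det (G (\<zeta> x))) * ?J x)"
  have la: "smooth_on W (\<lambda>y. ln ((cmod (a y))\<^sup>2)) \<and>
      partial 1 (partial 1 (\<lambda>y. ln ((cmod (a y))\<^sup>2))) x + partial 2 (partial 2 (\<lambda>y. ln ((cmod (a y))\<^sup>2))) x = - D - C"
    if "\<And>y. y \<in> W \<Longrightarrow> a y \<noteq> 0"
    using that unfolding a_def D_def C_def by (rule frame_combination_laplacian(1)[OF W xW])
  have lb: "smooth_on W (\<lambda>y. ln ((cmod (b y))\<^sup>2)) \<and>
      partial 1 (partial 1 (\<lambda>y. ln ((cmod (b y))\<^sup>2))) x + partial 2 (partial 2 (\<lambda>y. ln ((cmod (b y))\<^sup>2))) x = - D + C"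
    if "\<And>y. y \<in> W \<Longrightarrow> b y \<noteq> 0"
    using that unfolding b_def D_def C_def by (rule frame_combination_laplacian(2)[OF W xW])
  have "smooth_on W f \<and> partial 1 (partial 1 f) x + partial 2 (partial 2 f) x =
      4 * metric_curvature G (\<zeta> x) * sqrt (det (G (\<zeta> x))) * \<bar>?J x\<bar>"
  proof (cases "0 < ?J x")
    case True
    then have "0 < ?J y \<and> y \<in> U" if "y \<in> W" for y using that by (auto simp: W_def)
    then have e: "a y \<noteq> 0 \<and> b y \<noteq> 0 \<and> P y = (cmod (b y))\<^sup>2 / (cmod (a y))\<^sup>2" if "y \<in> W" for y
      using dil(1)[of y] WP[OF that] that by (auto simp: a_def b_def P_def)
    then have a0: "\<And>y. y \<in> W \<Longrightarrow> a y \<noteq> 0" and b0: "\<And>y. y \<in> W \<Longrightarrow> b y \<noteq> 0" by auto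
    show ?thesis using main[OF lb[OF b0] la[OF a0] e] True by (simp add: C_def)
  next
    case False
    then have "?J y < 0 \<and> y \<in> U" if "y \<in> W" for y using that by (auto simp: W_def)
    then have e: "b y \<noteq> 0 \<and> a y \<noteq> 0 \<and> P y = (cmod (a y))\<^sup>2 / (cmod (b y))\<^sup>2" if "y \<in> W" for y
      using dil(2)[of y] WP[OF that] that by (auto simp: a_def b_def P_def)
    then have a0: "\<And>y. y \<in> W \<Longrightarrow> a y \<noteq> 0" and b0: "\<And>y. y \<in> W \<Longrightarrow> b y \<noteq> 0" by auto
    show ?thesis using main[OF la[OF a0] lb[OF b0] e] False by (simp add: C_def)
  qed
  then show ?thesis using W xW WP unfolding P_def by blast
qed

end

end

section \<open>First variation of the energy\<close>

lemma integral_translate_compact_support: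
  fixes f :: "'a::euclidean_space \<Rightarrow> real"
  assumes "\<And>x. f x \<noteq> 0 \<Longrightarrow> x \<in> cbox a b" "\<And>x. f (c + x) \<noteq> 0 \<Longrightarrow> x \<in> cbox a b"
  shows "integral (cbox a b) (\<lambda>x. f (c + x)) = integral (cbox a b) f"
proof -
  have "integral (cbox a b) (\<lambda>x. f (c + x)) = integral (cbox (a + c) (b + c)) f"
    using integral_shift_cbox_plus[of a b f c] by (simp add: o_def)
  also have "\<dots> = integral UNIV (\<lambda>x. if x \<in> cbox (a + c) (b + c) then f x else 0)"
    by (rule integral_restrict_UNIV[symmetric])
  also have "(\<lambda>x. if x \<in> cbox (a + c) (b + c) then f x else 0) = (\<lambda>x. if x \<in> cbox a b then f x else 0)"
  proof
    fix x
    have "x \<in> cbox (a + c) (b + c) \<longleftrightarrow> x - c \<in> cbox a b"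
      by (auto simp: mem_box inner_diff inner_add algebra_simps)
    then show "(if x \<in> cbox (a + c) (b + c) then f x else 0) = (if x \<in> cbox a b then f x else 0)"
      using assms(1)[of x] assms(2)[of "x - c"] by auto
  qed
  also have "integral UNIV \<dots> = integral (cbox a b) f" by (rule integral_restrict_UNIV)
  finally show ?thesis .
qed

text \<open>For |t| < \<delta> the translates of \<open>f\<close> by t e_i keep their support in the
  box, so their integrals do not depend on t; differentiating under the integral at t = 0 gives the
  claim. The radius 2 \<delta> is the room for the translation.\<close>

lemma integral_partial_compact_support:
  fixes f :: "real ^ 'n::finite \<Rightarrow> real"
  assumes f: "smooth_on UNIV f" and supp: "\<And>x. f x \<noteq> 0 \<Longrightarrow> x \<in> cball x0 \<delta>" and box: "cball x0 (2 * \<delta>) \<subseteq> cbox a b"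
    and "0 < \<delta>"
  shows "integral (cbox a b) (partial i f) = 0"
proof -
  let ?U = "{-\<delta><..<\<delta>}"
  let ?h = "\<lambda>t. integral (cbox a b) (\<lambda>x. f (t *\<^sub>R axis i 1 + x))"
  have hd: "((\<lambda>t. f (t *\<^sub>R axis i 1 + x)) has_real_derivative partial i f (t *\<^sub>R axis i 1 + x)) (at t)" for t x
  proof -
    have "((\<lambda>t. t *\<^sub>R axis i 1 + x) has_derivative (\<lambda>s. s *\<^sub>R axis i 1)) (at t)"
      by (auto intro!: derivative_eq_intros)
    from has_derivative_compose[OF this smooth_on_has_derivative[OF f UNIV_I]]
    show ?thesis
      using linear_cmul[OF has_derivative_linear[OF smooth_on_has_derivative[OF f UNIV_I]]]
      by (simp add: has_field_derivative_def partial_def mult_commute_abs)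
  qed
  have cf: "continuous_on S f" "continuous_on S (partial i f)" for S
    using smooth_on_imp_continuous_on[OF f] smooth_on_imp_continuous_on[OF smooth_on_partial[OF f]] continuous_on_subset by blast+
  have "(?h has_real_derivative integral (cbox a b) (\<lambda>x. partial i f (0 *\<^sub>R axis i 1 + x))) (at 0 within ?U)"
  proof (rule leibniz_rule_field_derivative)
    show "((\<lambda>t. f (t *\<^sub>R axis i 1 + x)) has_real_derivative partial i f (t *\<^sub>R axis i 1 + x)) (at t within ?U)" for t x
      using hd by (rule has_field_derivative_at_within)
    show "(\<lambda>x. f (t *\<^sub>R axis i 1 + x)) integrable_on cbox a b" for t
      by (intro integrable_continuous continuous_on_compose2[OF cf(1)[of UNIV]] continuous_intros) auto
    show "continuous_on (?U \<times> cbox a b) (\<lambda>(t, x). partial i f (t *\<^sub>R axis i 1 + x))"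
      unfolding case_prod_beta by (intro continuous_on_compose2[OF cf(2)[of UNIV]] continuous_intros) auto
  qed (use \<open>0 < \<delta>\<close> in auto)
  then have D: "(?h has_real_derivative integral (cbox a b) (partial i f)) (at 0)"
    using at_within_open[of 0 ?U] \<open>0 < \<delta>\<close> by simp
  have "?h t = integral (cbox a b) f" if "t \<in> ?U" for t
  proof (rule integral_translate_compact_support)
    show "x \<in> cbox a b" if "f x \<noteq> 0" for x
      using supp[OF that] box \<open>0 < \<delta>\<close> by (metis mem_cball mult_2 add_increasing less_imp_le order_trans subsetD le_add_same_cancel1)
    show "x \<in> cbox a b" if *: "f (t *\<^sub>R axis i 1 + x) \<noteq> 0" for x
    proof -
      have "dist x0 x \<le> dist x0 (t *\<^sub>R axis i 1 + x) + dist (t *\<^sub>R axis i 1 + x) x" by (rule dist_triangle)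
      also have "dist (t *\<^sub>R axis i 1 + x) x \<le> \<delta>" using \<open>t \<in> ?U\<close> by (auto simp: dist_norm norm_axis_1)
      finally have "dist x0 x \<le> 2 * \<delta>" using supp[OF *] by simp
      then show ?thesis using box by auto
    qed
  qed
  then have "(?h has_real_derivative 0) (at 0)"
    using \<open>0 < \<delta>\<close> by (intro has_field_derivative_transform_within_open[OF DERIV_const, where S = ?U]) auto
  with D show ?thesis by (rule DERIV_unique)
qed

text \<open>The energy density of \<open>x \<mapsto> \<zeta> (x + t \<eta>(x) e\<^sub>k)\<close> when \<open>P\<close> is the pullback metric of \<open>\<zeta>\<close>.\<close>

definition varied_density ::
    "(real ^ 'n::finite \<Rightarrow> real ^ 'n ^ 'n) \<Rightarrow> (real ^ 'n \<Rightarrow> real) \<Rightarrow> 'n \<Rightarrow> real \<Rightarrow> real ^ 'n \<Rightarrow> real" where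
  "varied_density P \<eta> k t x = (let y = x + (t * \<eta> x) *\<^sub>R axis k 1 in
     \<Sum>i\<in>UNIV. P y $ i $ i + 2 * t * partial i \<eta> x * P y $ i $ k + t\<^sup>2 * (partial i \<eta> x)\<^sup>2 * P y $ k $ k)"

text \<open>Differentiation under the integral sign; at t = 0 the quadratic term of
  \<open>varied_density\<close> drops out.\<close>

lemma varied_density_derivative:
  fixes P :: "real ^ 'n::finite \<Rightarrow> real ^ 'n ^ 'n"
  assumes W: "open W" and P: "\<And>i j. smooth_on W (\<lambda>x. P x $ i $ j)" and \<eta>: "smooth_on UNIV \<eta>"
    and in_W: "\<And>t x. \<bar>t\<bar> < \<epsilon> \<Longrightarrow> x \<in> cbox a b \<Longrightarrow> x + (t * \<eta> x) *\<^sub>R axis k 1 \<in> W" and "0 < \<epsilon>"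
  shows "((\<lambda>t. integral (cbox a b) (varied_density P \<eta> k t)) has_real_derivative
     integral (cbox a b) (\<lambda>x. \<Sum>i\<in>UNIV. \<eta> x * partial k (\<lambda>x. P x $ i $ i) x + 2 * partial i \<eta> x * P x $ i $ k)) (at 0)"
proof -
  let ?U = "{-\<epsilon><..<\<epsilon>}" and ?y = "\<lambda>t x. x + (t * \<eta> x) *\<^sub>R axis k 1"
  let ?p = "\<lambda>i j x. P x $ i $ j" and ?n = "\<lambda>i x. partial i \<eta> x"
  let ?e' = "\<lambda>t x. \<Sum>i\<in>UNIV. \<eta> x * partial k (?p i i) (?y t x)
     + 2 * ?n i x * (?p i k (?y t x) + t * (\<eta> x * partial k (?p i k) (?y t x)))
     + (?n i x)\<^sup>2 * (2 * t * ?p k k (?y t x) + t\<^sup>2 * (\<eta> x * partial k (?p k k) (?y t x)))"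
  have hd: "((\<lambda>t. ?p i j (?y t x)) has_real_derivative \<eta> x * partial k (?p i j) (?y t x)) (at t)"
    if "\<bar>t\<bar> < \<epsilon>" "x \<in> cbox a b" for t x i j
  proof -
    have "((\<lambda>t. ?y t x) has_derivative (\<lambda>s. (s * \<eta> x) *\<^sub>R axis k 1)) (at t)"
      by (auto intro!: derivative_eq_intros)
    from has_derivative_compose[OF this smooth_on_has_derivative[OF P[of i j] in_W[OF that]]]
    show ?thesis
      using linear_cmul[OF has_derivative_linear[OF smooth_on_has_derivative[OF P[of i j] in_W[OF that]]]]
      by (simp add: has_field_derivative_def partial_def mult.assoc mult_commute_abs)
  qed
  have cy: "continuous_on (?U \<times> cbox a b) (\<lambda>z. ?y (fst z) (snd z))"
    by (intro continuous_intros continuous_on_compose2[OF smooth_on_imp_continuous_on[OF \<eta>]]) auto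
  have yW: "(\<lambda>z. ?y (fst z) (snd z)) ` (?U \<times> cbox a b) \<subseteq> W" using in_W by auto
  have cp: "continuous_on (?U \<times> cbox a b) (\<lambda>z. ?p i j (?y (fst z) (snd z)))"
       "continuous_on (?U \<times> cbox a b) (\<lambda>z. partial l (?p i j) (?y (fst z) (snd z)))" for i j l
    by (rule continuous_on_compose2[OF smooth_on_imp_continuous_on[OF P] cy yW]
        continuous_on_compose2[OF smooth_on_imp_continuous_on[OF smooth_on_partial[OF P]] cy yW])+
  have cn: "continuous_on (?U \<times> cbox a b) (\<lambda>z. ?n i (snd z))" "continuous_on (?U \<times> cbox a b) (\<lambda>z. \<eta> (snd z))" for i
    by (rule continuous_on_compose2[OF smooth_on_imp_continuous_on[OF smooth_on_partial[OF \<eta>]] continuous_on_snd[OF continuous_on_id] subset_UNIV]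
        continuous_on_compose2[OF smooth_on_imp_continuous_on[OF \<eta>] continuous_on_snd[OF continuous_on_id] subset_UNIV])+
  have "((\<lambda>t. integral (cbox a b) (varied_density P \<eta> k t)) has_real_derivative integral (cbox a b) (?e' 0)) (at 0 within ?U)"
  proof (rule leibniz_rule_field_derivative)
    fix t x assume t: "t \<in> ?U" and x: "x \<in> cbox a b"
    have t': "\<bar>t\<bar> < \<epsilon>" using t by auto
    show "((\<lambda>t. varied_density P \<eta> k t x) has_real_derivative ?e' t x) (at t within ?U)"
      unfolding varied_density_def Let_def
      by (rule has_field_derivative_at_within, rule DERIV_sum)
        (auto intro!: derivative_eq_intros hd[OF t' x] simp: algebra_simps power2_eq_square)
  next
    fix t assume t: "t \<in> ?U"
    have "continuous_on (?U \<times> cbox a b) (\<lambda>z. varied_density P \<eta> k (fst z) (snd z))"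
      unfolding varied_density_def Let_def by (intro continuous_intros cp cn)
    then have "continuous_on (cbox a b) (\<lambda>x. varied_density P \<eta> k (fst (t, x)) (snd (t, x)))"
      by (rule continuous_on_compose2) (use t in \<open>auto intro!: continuous_intros\<close>)
    then show "varied_density P \<eta> k t integrable_on cbox a b" by (simp add: integrable_continuous)
  next
    show "continuous_on (?U \<times> cbox a b) (\<lambda>(t, x). ?e' t x)"
      unfolding case_prod_beta by (intro continuous_intros cp cn)
  qed (use \<open>0 < \<epsilon>\<close> in auto)
  then show ?thesis
    using at_within_open[of 0 ?U] \<open>0 < \<epsilon>\<close> by simp
qed

text \<open>If B bounds |\<eta>| on the ball of radius \<delta>, then |t| < \<delta> / B displaces
  its points by less than \<delta>.\<close>

lemma bump_translate_in:
  fixes \<eta> :: "'a::euclidean_space \<Rightarrow> real"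
  assumes \<eta>: "continuous_on UNIV \<eta>" and supp: "\<And>x. \<eta> x \<noteq> 0 \<Longrightarrow> dist x0 x < \<delta>" and "0 < \<delta>" and "norm e = 1"
  obtains \<epsilon> where "0 < \<epsilon>" "\<And>t x. \<bar>t\<bar> < \<epsilon> \<Longrightarrow> \<eta> x \<noteq> 0 \<Longrightarrow> dist x0 (x + (t * \<eta> x) *\<^sub>R e) < 2 * \<delta>"
proof -
  have "compact (\<eta> ` cball x0 \<delta>)"
    by (intro compact_continuous_image continuous_on_subset[OF \<eta>] compact_cball) auto
  then obtain B where B: "0 < B" "\<And>x. x \<in> cball x0 \<delta> \<Longrightarrow> \<bar>\<eta> x\<bar> \<le> B"
    using compact_imp_bounded bounded_pos by (metis imageI real_norm_def)
  have "dist x0 (x + (t * \<eta> x) *\<^sub>R e) < 2 * \<delta>" if "\<bar>t\<bar> < \<delta> / B" "\<eta> x \<noteq> 0" for t x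
  proof -
    have x: "dist x0 x < \<delta>" using supp[OF that(2)] .
    have "\<bar>t * \<eta> x\<bar> \<le> \<bar>t\<bar> * B" using B(2)[of x] x by (simp add: abs_mult mult_left_mono)
    also have "\<dots> < \<delta>" using that(1) B(1) by (simp add: pos_less_divide_eq)
    finally have "dist x (x + (t * \<eta> x) *\<^sub>R e) < \<delta>" using \<open>norm e = 1\<close> by (simp add: dist_norm)
    then show ?thesis using x dist_triangle[of x0 "x + (t * \<eta> x) *\<^sub>R e" x] by simp
  qed
  then show ?thesis using that[of "\<delta> / B"] B(1) \<open>0 < \<delta>\<close> by simp
qed

text \<open>The fundamental lemma of the calculus of variations. After integration by parts the
  first variation is -2 times the integral of \<eta> F, where F is the k-th component of the
  divergence of P - (trace P / 2) I. If F were non-zero at \<open>x0\<close>, a bump supported where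
  F keeps its sign would give a contradiction.\<close>

lemma stationary_imp_divergence_free:
  fixes P :: "real ^ 'n::finite \<Rightarrow> real ^ 'n ^ 'n"
  assumes W: "open W" and P: "\<And>i j. smooth_on W (\<lambda>x. P x $ i $ j)" and cW: "cbox a b \<subseteq> W" and x0: "x0 \<in> box a b"
    and stat: "\<And>\<delta> \<eta>. 0 < \<delta> \<Longrightarrow> cball x0 (2 * \<delta>) \<subseteq> box a b \<Longrightarrow> smooth_on UNIV \<eta> \<Longrightarrow> (\<And>x. \<eta> x \<noteq> 0 \<longleftrightarrow> dist x0 x < \<delta>) \<Longrightarrow>
       ((\<lambda>t. integral (cbox a b) (varied_density P \<eta> k t)) has_real_derivative 0) (at 0)"
  shows "(\<Sum>i\<in>UNIV. partial i (\<lambda>x. P x $ i $ k) x0) = (\<Sum>i\<in>UNIV. partial k (\<lambda>x. P x $ i $ i) x0) / 2"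
proof (rule ccontr)
  let ?p = "\<lambda>i j x. P x $ i $ j"
  define F where "F = (\<lambda>x. (\<Sum>i\<in>UNIV. partial i (?p i k) x) - (\<Sum>i\<in>UNIV. partial k (?p i i) x) / 2)"
  define s where "s = sgn (F x0)"
  assume "\<not> ?thesis"
  then have F0: "F x0 \<noteq> 0" by (simp add: F_def)
  have "continuous_on W F"
    unfolding F_def by (intro continuous_intros smooth_on_imp_continuous_on[OF smooth_on_partial[OF P]]) auto
  then have cF: "continuous_on (cbox a b) F" using cW continuous_on_subset by blast
  have "continuous_on (box a b) (\<lambda>x. s * F x)"
    using cF box_subset_cbox by (intro continuous_intros) (blast intro: continuous_on_subset)
  then have "open (box a b \<inter> (\<lambda>x. s * F x) -` {0<..})" by (intro continuous_open_preimage) auto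
  moreover have "x0 \<in> box a b \<inter> (\<lambda>x. s * F x) -` {0<..}" using x0 F0 by (auto simp: s_def sgn_if)
  ultimately obtain r where r: "0 < r" "cball x0 r \<subseteq> box a b \<inter> (\<lambda>x. s * F x) -` {0<..}"
    using open_contains_cball by blast
  define \<delta> where "\<delta> = r / 2"
  have d: "0 < \<delta>" "cball x0 (2 * \<delta>) \<subseteq> box a b" using r by (auto simp: \<delta>_def)
  obtain \<eta> :: "real ^ 'n \<Rightarrow> real" where \<eta>: "smooth_on UNIV \<eta>" "\<And>x. 0 \<le> \<eta> x" "\<And>x. \<eta> x \<noteq> 0 \<longleftrightarrow> dist x0 x < \<delta>"
    using bump_exists[OF d(1), where ?x0.0 = x0] by blast
  have c\<eta>: "continuous_on S \<eta>" for S using smooth_on_imp_continuous_on[OF \<eta>(1)] continuous_on_subset by blast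
  have supp: "dist x0 x < \<delta>" if "\<eta> x \<noteq> 0" for x using that \<eta>(3) by blast
  have ne: "norm (axis k 1 :: real ^ 'n) = 1" by (simp add: norm_axis_1)
  obtain \<epsilon> where eps: "0 < \<epsilon>" "\<And>t x. \<bar>t\<bar> < \<epsilon> \<Longrightarrow> \<eta> x \<noteq> 0 \<Longrightarrow> dist x0 (x + (t * \<eta> x) *\<^sub>R axis k 1) < 2 * \<delta>"
    using bump_translate_in[OF c\<eta> supp d(1) ne] by blast
  have in_W: "x + (t * \<eta> x) *\<^sub>R axis k 1 \<in> W" if "\<bar>t\<bar> < \<epsilon>" "x \<in> cbox a b" for t x
  proof (cases "\<eta> x = 0")
    case True then show ?thesis using that cW by auto
  next
    case False
    then have "x + (t * \<eta> x) *\<^sub>R axis k 1 \<in> box a b" using eps(2)[OF that(1) False] d(2) by (auto simp: less_imp_le)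
    then show ?thesis using cW box_subset_cbox by blast
  qed
  let ?d = "\<lambda>x. \<Sum>i\<in>UNIV. \<eta> x * partial k (?p i i) x + 2 * partial i \<eta> x * ?p i k x"
  have i0: "integral (cbox a b) ?d = 0"
    using DERIV_unique[OF varied_density_derivative[OF W P \<eta>(1) in_W eps(1)] stat[OF d \<eta>(1,3)]] .
  \<comment> \<open>\<open>P\<close> is controlled on \<open>W\<close> only, but the product
    vanishes outside the closed ball of radius \<delta>. It is therefore smooth everywhere and
    integrates by parts without boundary terms.\<close>
  have prod_smooth: "smooth_on UNIV (\<lambda>x. \<eta> x * ?p i k x)" for i
  proof (rule smooth_on_local)
    fix x :: "real ^ 'n"
    show "\<exists>A. open A \<and> x \<in> A \<and> smooth_on A (\<lambda>x. \<eta> x * ?p i k x)"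
    proof (cases "x \<in> cball x0 \<delta>")
      case True
      then have "x \<in> cball x0 (2 * \<delta>)" using d(1) by simp
      then have "x \<in> W" using d(2) cW box_subset_cbox by blast
      then show ?thesis by (intro exI[of _ W]) (auto intro!: W smooth_on_mult P smooth_on_subset[OF \<eta>(1)])
    next
      case False
      have "smooth_on (- cball x0 \<delta>) (\<lambda>x. \<eta> x * ?p i k x)"
        by (rule smooth_on_cong[OF _ _ smooth_on_const[of _ 0]]) (use \<eta>(3) in force)+
      then show ?thesis using False by (intro exI[of _ "- cball x0 \<delta>"]) auto
    qed
  qed
  have ip: "integral (cbox a b) (partial i (\<lambda>x. \<eta> x * ?p i k x)) = 0" for i
  proof (rule integral_partial_compact_support[OF prod_smooth])
    show "x \<in> cball x0 \<delta>" if "\<eta> x * ?p i k x \<noteq> 0" for x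
      using that \<eta>(3)[of x] by (auto simp: less_imp_le)
  qed (use d box_subset_cbox in auto)
  have int: "f integrable_on cbox a b" if "continuous_on (cbox a b) f" for f :: "real ^ 'n \<Rightarrow> real"
    using that by (rule integrable_continuous)
  have "?d x = (\<Sum>i\<in>UNIV. 2 * partial i (\<lambda>x. \<eta> x * ?p i k x) x) - 2 * (\<eta> x * F x)" if "x \<in> cbox a b" for x
  proof -
    have "partial i (\<lambda>x. \<eta> x * ?p i k x) x = partial i \<eta> x * ?p i k x + \<eta> x * partial i (?p i k) x" for i
      using that cW by (intro partial_mult smooth_on_differentiable[OF \<eta>(1)] smooth_on_differentiable[OF P]) auto
    then show ?thesis
      by (simp add: F_def sum.distrib sum_distrib_left sum_subtractf algebra_simps)
  qed
  then have "integral (cbox a b) ?d = integral (cbox a b) (\<lambda>x. (\<Sum>i\<in>UNIV. 2 * partial i (\<lambda>x. \<eta> x * ?p i k x) x) - 2 * (\<eta> x * F x))"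
    by (rule integral_cong)
  also have "\<dots> = (\<Sum>i\<in>UNIV. 2 * integral (cbox a b) (partial i (\<lambda>x. \<eta> x * ?p i k x))) - 2 * integral (cbox a b) (\<lambda>x. \<eta> x * F x)"
  proof -
    have c: "continuous_on (cbox a b) (partial i (\<lambda>x. \<eta> x * ?p i k x))" for i
      using smooth_on_imp_continuous_on[OF smooth_on_partial[OF prod_smooth]] continuous_on_subset by blast
    have "(\<lambda>x. \<Sum>i\<in>UNIV. 2 * partial i (\<lambda>x. \<eta> x * ?p i k x) x) integrable_on cbox a b"
      "(\<lambda>x. 2 * (\<eta> x * F x)) integrable_on cbox a b"
      by (intro int continuous_intros c c\<eta> cF)+
    then show ?thesis
      by (subst integral_diff) (simp_all add: integral_sum int c continuous_on_mult_const continuous_intros)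
  qed
  also have "\<dots> = - 2 * integral (cbox a b) (\<lambda>x. \<eta> x * F x)" by (simp add: ip)
  finally have "integral (cbox a b) (\<lambda>x. \<eta> x * F x) = 0" using i0 by simp
  moreover have cc: "continuous_on (cbox a b) (\<lambda>x. s * (\<eta> x * F x))" by (intro continuous_intros c\<eta> cF)
  ultimately have hi: "((\<lambda>x. s * (\<eta> x * F x)) has_integral 0) (cbox a b)"
    using integrable_integral[OF int[OF cc]] by simp
  have "s * (\<eta> x0 * F x0) = 0"
  proof (rule has_integral_0_cbox_imp_0[OF cc _ hi])
    show "0 \<le> s * (\<eta> x * F x)" if "x \<in> box a b" for x
    proof (cases "\<eta> x = 0")
      case False
      then have "x \<in> cball x0 r" using \<eta>(3)[of x] by (simp add: \<delta>_def) (use r(1) in linarith)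
      then have "0 < s * F x" using r(2) by auto
      then have "0 \<le> \<eta> x * (s * F x)" using \<eta>(2) by (simp add: less_imp_le)
      then show ?thesis by (simp add: mult_ac)
    qed simp
  qed (use x0 box_subset_cbox in auto)
  then have "\<eta> x0 = 0" using F0 by (simp add: s_def sgn_zero_iff)
  then show False using \<eta>(3)[of x0] d(1) by simp
qed

section \<open>Charts and coordinate changes\<close>

context
  fixes X :: "'a topology" and c :: "('a, 'e::topological_space) chart"
  assumes c: "is_chart X c"
begin

lemma chart_open: "openin X (fst c)" "open (chart_image c)"
  using c by (auto simp: is_chart_def)

lemma chart_subset: "fst c \<subseteq> topspace X"
  using chart_open(1) by (rule openin_subset)

private lemma homeo: "homeomorphic_map (subtopology X (fst c)) (top_of_set (chart_image c)) (snd c)"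
  using c by (auto simp: is_chart_def)

private lemma top_fst: "topspace (subtopology X (fst c)) = fst c"
  using chart_subset by auto

lemma chart_inj: "inj_on (snd c) (fst c)"
  using homeomorphic_imp_injective_map[OF homeo] unfolding top_fst .

lemma chart_inv_left: "p \<in> fst c \<Longrightarrow> chart_inv c (snd c p) = p"
  by (simp add: chart_inv_def chart_inj)

lemma chart_inv_in: "x \<in> chart_image c \<Longrightarrow> chart_inv c x \<in> fst c"
  by (simp add: chart_inv_def chart_image_def inv_into_into)

lemma chart_inv_right: "x \<in> chart_image c \<Longrightarrow> snd c (chart_inv c x) = x"
  by (simp add: chart_inv_def chart_image_def f_inv_into_f)

lemma chart_in_image: "p \<in> fst c \<Longrightarrow> snd c p \<in> chart_image c"
  by (simp add: chart_image_def)

lemma chart_image_open: "openin X A \<Longrightarrow> A \<subseteq> fst c \<Longrightarrow> open (snd c ` A)"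
proof -
  assume A: "openin X A" "A \<subseteq> fst c"
  then have "openin (subtopology X (fst c)) A"
    using chart_open(1) by (simp add: openin_open_subtopology)
  then have "openin (top_of_set (chart_image c)) (snd c ` A)"
    using homeomorphic_imp_open_map[OF homeo] by (simp add: open_map_def)
  then show ?thesis using chart_open(2) by (simp add: openin_open_eq)
qed

lemma chart_continuous: "continuous_map (subtopology X (fst c)) euclidean (snd c)"
  using homeomorphic_imp_continuous_map[OF homeo] by (simp add: continuous_map_in_subtopology)

lemma chart_preimage_open: "open B \<Longrightarrow> openin X {p \<in> fst c. snd c p \<in> B}"
proof -
  assume "open B"
  then have "openin (subtopology X (fst c)) {p \<in> fst c. snd c p \<in> B}"
    using openin_continuous_map_preimage[OF chart_continuous, of B] unfolding top_fst by simp
  then show ?thesis using chart_open(1) by (simp add: openin_open_subtopology)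
qed

lemma chart_inv_continuous: "continuous_map (top_of_set (chart_image c)) X (chart_inv c)"
proof -
  obtain g where g: "homeomorphic_maps (subtopology X (fst c)) (top_of_set (chart_image c)) (snd c) g"
    using homeo by (auto simp: homeomorphic_map_maps)
  then have cg: "continuous_map (top_of_set (chart_image c)) (subtopology X (fst c)) g"
    and gx: "\<And>x. x \<in> chart_image c \<Longrightarrow> snd c (g x) = x" by (auto simp: homeomorphic_maps_def)
  have "g x = chart_inv c x" if x: "x \<in> chart_image c" for x
  proof -
    have "g x \<in> fst c" using continuous_map_image_subset_topspace[OF cg] x top_fst by auto
    then show ?thesis using gx[OF x] chart_inv_left by metis
  qed
  then have "continuous_map (top_of_set (chart_image c)) (subtopology X (fst c)) (chart_inv c)"
    using continuous_map_eq[OF cg] by simp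
  then show ?thesis by (simp add: continuous_map_in_subtopology)
qed

lemma chart_inv_image: "A \<subseteq> chart_image c \<Longrightarrow> chart_inv c ` A = {p \<in> fst c. snd c p \<in> A}"
  using chart_inv_left chart_inv_in chart_inv_right by (force simp: image_iff)

end

lemma local_dom_iff:
  assumes "is_chart X c"
  shows "x \<in> local_dom c d f \<longleftrightarrow> x \<in> chart_image c \<and> f (chart_inv c x) \<in> fst d"
  using chart_inv_left[OF assms] chart_inv_right[OF assms] chart_inv_in[OF assms]
  by (force simp: local_dom_def chart_image_def image_iff)

lemma local_dom_memI:
  "p \<in> fst c \<Longrightarrow> f p \<in> fst d \<Longrightarrow> snd c p \<in> local_dom c d f"
  by (auto simp: local_dom_def)

lemma local_rep_apply: "local_rep c d f x = snd d (f (chart_inv c x))"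
  by (simp add: local_rep_def)

lemma local_dom_open:
  assumes "is_chart X c" "is_chart Y d" "continuous_map X Y f"
  shows "open (local_dom c d f)"
proof -
  have "openin X {p \<in> topspace X. f p \<in> fst d}"
    using openin_continuous_map_preimage[OF assms(3) chart_open(1)[OF assms(2)]] .
  then have "openin X (fst c \<inter> {p \<in> topspace X. f p \<in> fst d})"
    by (intro openin_Int chart_open(1)[OF assms(1)])
  moreover have "fst c \<inter> {p \<in> topspace X. f p \<in> fst d} = fst c \<inter> f -` fst d"
    using chart_subset[OF assms(1)] by auto
  ultimately show ?thesis unfolding local_dom_def by (intro chart_image_open[OF assms(1)]) auto
qed

section \<open>Jacobian matrices, inverse matrices and the data of an oriented Riemannian
  manifold\<close>

lemma jacobian_eqI:
  fixes f :: "real ^ 'n::finite \<Rightarrow> real ^ 'm::finite"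
  assumes "(f has_derivative (\<lambda>h. A *v h)) (at x)" shows "jacobian f (at x) = A"
  using frechet_derivative_at[OF assms, symmetric] by (simp add: jacobian_def)

lemma jacobian_has_derivative:
  fixes f :: "real ^ 'n::finite \<Rightarrow> real ^ 'm::finite"
  assumes "f differentiable (at x)" shows "(f has_derivative (\<lambda>h. jacobian f (at x) *v h)) (at x)"
  using assms jacobian_works by blast

lemma jacobian_compose:
  fixes f :: "real ^ 'n::finite \<Rightarrow> real ^ 'm::finite" and g :: "real ^ 'm \<Rightarrow> real ^ 'l::finite"
  assumes "f differentiable (at x)" "g differentiable (at (f x))"
  shows "jacobian (\<lambda>x. g (f x)) (at x) = jacobian g (at (f x)) ** jacobian f (at x)"
    and "(\<lambda>x. g (f x)) differentiable (at x)"
proof -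
  have "((\<lambda>x. g (f x)) has_derivative (\<lambda>h. jacobian g (at (f x)) *v (jacobian f (at x) *v h))) (at x)"
    by (rule has_derivative_compose[OF jacobian_has_derivative[OF assms(1)] jacobian_has_derivative[OF assms(2)]])
  then show "jacobian (\<lambda>x. g (f x)) (at x) = jacobian g (at (f x)) ** jacobian f (at x)"
    "(\<lambda>x. g (f x)) differentiable (at x)"
    by (auto intro!: jacobian_eqI simp: matrix_vector_mul_assoc differentiable_def)
qed

lemma jacobian_cong:
  assumes "open S" "x \<in> S" "\<And>y. y \<in> S \<Longrightarrow> f y = g y" "f differentiable (at x)"
  shows "jacobian f (at x) = jacobian g (at x)" "g differentiable (at x)"
proof -
  show "jacobian f (at x) = jacobian g (at x)"
    unfolding jacobian_def using frechet_derivative_transform_within_open[OF assms(4,1,2,3)] by simp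
  show "g differentiable (at x)"
    using has_derivative_transform_within_open[OF differentiable_has_derivative[OF assms(4)] assms(1,2,3)] by (auto simp: differentiable_def)
qed

lemma matrix_inv_eqI:
  fixes A B :: "real ^ 'n::finite ^ 'n"
  assumes "A ** B = mat 1" shows "matrix_inv A = B" "invertible A"
proof -
  have BA: "B ** A = mat 1" using assms matrix_left_right_inverse by blast
  then show inv: "invertible A" using assms by (auto simp: invertible_def)
  have "matrix_inv A = matrix_inv A ** (A ** B)" by (simp only: assms matrix_mul_rid)
  also have "\<dots> = B" by (simp only: matrix_mul_assoc matrix_inv_inverse[OF inv] matrix_mul_lid)
  finally show "matrix_inv A = B" .
qed

lemma posdef_invertible:
  fixes A :: "real ^ 'n::finite ^ 'n"
  assumes "\<And>v. v \<noteq> 0 \<Longrightarrow> 0 < v \<bullet> (A *v v)" shows "invertible A"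
proof -
  have "v = 0" if "A *v v = 0" for v using assms[of v] that by force
  then show ?thesis by (simp add: invertible_left_inverse matrix_left_invertible_ker)
qed

lemma charts_is_chart: "oriented_riemannian_manifold M \<Longrightarrow> c \<in> charts M \<Longrightarrow> is_chart (mtop M) c"
  by (auto simp: oriented_riemannian_manifold_def maximal_atlas_def)

lemma charts_compat: "oriented_riemannian_manifold M \<Longrightarrow> c \<in> charts M \<Longrightarrow> d \<in> charts M \<Longrightarrow> oriented_compat c d"
  by (auto simp: oriented_riemannian_manifold_def maximal_atlas_def)

lemma charts_cover: "oriented_riemannian_manifold M \<Longrightarrow> p \<in> topspace (mtop M) \<Longrightarrow> \<exists>c\<in>charts M. p \<in> fst c"
  unfolding oriented_riemannian_manifold_def maximal_atlas_def by blast

lemma chart_at_in: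
  assumes "oriented_riemannian_manifold M" "p \<in> topspace (mtop M)"
  shows "chart_at M p \<in> charts M" "p \<in> fst (chart_at M p)"
proof -
  have "\<exists>c. c \<in> charts M \<and> p \<in> fst c" using charts_cover[OF assms] by blast
  from someI_ex[OF this] show "chart_at M p \<in> charts M" "p \<in> fst (chart_at M p)" by (auto simp: chart_at_def)
qed

lemma metric_props:
  assumes "oriented_riemannian_manifold M" "c \<in> charts M"
  shows "smooth_on (chart_image c) (metric M c)"
    "x \<in> chart_image c \<Longrightarrow> transpose (metric M c x) = metric M c x"
    "x \<in> chart_image c \<Longrightarrow> v \<noteq> 0 \<Longrightarrow> 0 < v \<bullet> (metric M c x *v v)"
    "x \<in> chart_image c \<Longrightarrow> invertible (metric M c x)"
  using assms posdef_invertible by (auto simp: oriented_riemannian_manifold_def)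

lemma metric_transform:
  assumes "oriented_riemannian_manifold M" "c \<in> charts M" "d \<in> charts M" "x \<in> local_dom c d id"
  shows "metric M c x = transpose (jacobian (local_rep c d id) (at x)) ** metric M d (local_rep c d id x) **
          jacobian (local_rep c d id) (at x)"
  using assms by (auto simp: oriented_riemannian_manifold_def)

lemma chart_change:
  assumes M: "oriented_riemannian_manifold M" and c: "c \<in> charts M" "d \<in> charts M"
  shows "open (local_dom c d id)" "smooth_on (local_dom c d id) (local_rep c d id)"
    "x \<in> local_dom c d id \<Longrightarrow> 0 < det (jacobian (local_rep c d id) (at x))"
  using charts_compat[OF M c] local_dom_open[OF charts_is_chart[OF M c(1)] charts_is_chart[OF M c(2)] continuous_map_id]
  by (auto simp: oriented_compat_def)

text \<open>The endomorphism of the tangent space relating the pulled back metric to the metric of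
  \<open>M\<close>. A change of charts conjugates it, so its trace, the square norm of the
  differential, and its determinant are independent of charts.\<close>

definition strain :: "('a, 'm::finite) riemannian \<Rightarrow> ('b, 'n::finite) riemannian \<Rightarrow> ('a, real ^ 'm) chart \<Rightarrow> ('b, real ^ 'n) chart \<Rightarrow>
    ('a \<Rightarrow> 'b) \<Rightarrow> 'a \<Rightarrow> real ^ 'm ^ 'm" where
  "strain M N c d f p = matrix_inv (metric M c (snd c p)) ** pullback (metric N d) (local_rep c d f) (snd c p)"

text \<open>Differentiability is assumed in one pair of charts and carried to the other by the
  coordinate changes; the second pair will be the one chosen by \<open>chart_at\<close>.\<close>

lemma local_rep_chain:
  fixes M :: "('a, 'm::finite) riemannian" and N :: "('b, 'n::finite) riemannian"
  assumes M: "oriented_riemannian_manifold M" and N: "oriented_riemannian_manifold N"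
    and f: "continuous_map (mtop M) (mtop N) f"
    and c: "c \<in> charts M" "c' \<in> charts M" "p \<in> fst c" "p \<in> fst c'"
    and d: "d \<in> charts N" "d' \<in> charts N" "f p \<in> fst d" "f p \<in> fst d'"
    and diff: "local_rep c' d' f differentiable (at (snd c' p))"
  shows "local_rep c d f differentiable (at (snd c p))"
    "jacobian (local_rep c d f) (at (snd c p)) = jacobian (local_rep d' d id) (at (snd d' (f p))) **
       jacobian (local_rep c' d' f) (at (snd c' p)) ** jacobian (local_rep c c' id) (at (snd c p))"
proof -
  note isc = charts_is_chart[OF M c(1)] charts_is_chart[OF M c(2)] and isd = charts_is_chart[OF N d(1)] charts_is_chart[OF N d(2)]
  let ?x = "snd c p"
  let ?h = "\<lambda>x. local_rep d' d id (local_rep c' d' f (local_rep c c' id x))"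
  define S where "S = local_dom c d f \<inter> local_dom c d' f \<inter> local_dom c c' id"
  have S: "open S" "?x \<in> S" unfolding S_def
    using local_dom_open[OF isc(1) isd(1) f] local_dom_open[OF isc(1) isd(2) f] chart_change(1)[OF M c(1,2)] c d
    by (auto intro!: local_dom_memI)
  have 0: "local_rep c c' id ?x = snd c' p" using chart_inv_left[OF isc(1) c(3)] by (simp add: local_rep_apply)
  have 1: "local_rep c' d' f (snd c' p) = snd d' (f p)" using chart_inv_left[OF isc(2) c(4)] by (simp add: local_rep_apply)
  have eq: "?h x = local_rep c d f x" if "x \<in> S" for x
    using that chart_inv_left[OF isc(2)] chart_inv_left[OF isd(2)]
    by (auto simp: S_def local_dom_iff[OF isc(1)] local_rep_apply)
  have dc: "local_rep c c' id differentiable (at ?x)"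
    by (rule smooth_on_differentiable[OF chart_change(2)[OF M c(1,2)]]) (use c in \<open>auto intro!: local_dom_memI\<close>)
  have dd: "local_rep d' d id differentiable (at (snd d' (f p)))"
    by (rule smooth_on_differentiable[OF chart_change(2)[OF N d(2,1)]]) (use d in \<open>auto intro!: local_dom_memI\<close>)
  note j1 = jacobian_compose[OF dc, of "local_rep c' d' f", unfolded 0, OF diff]
  note j2 = jacobian_compose[OF j1(2), of "local_rep d' d id", unfolded 0 1, OF dd]
  show "local_rep c d f differentiable (at ?x)" by (rule jacobian_cong(2)[OF S eq j2(2)])
  show "jacobian (local_rep c d f) (at ?x) = jacobian (local_rep d' d id) (at (snd d' (f p))) **
       jacobian (local_rep c' d' f) (at (snd c' p)) ** jacobian (local_rep c c' id) (at ?x)"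
    using jacobian_cong(1)[OF S eq j2(2)] j1(1) j2(1) by (simp add: matrix_mul_assoc)
qed

text \<open>With A the Jacobian of the coordinate change of \<open>M\<close>, the inverse of
  \<open>A\<^sup>T g A\<close> brings a factor that cancels the \<open>A\<^sup>T\<close> of the
  pullback. The coordinate change of \<open>N\<close> is absorbed by the transformation law of its
  metric.\<close>

lemma strain_similar:
  fixes M :: "('a, 'm::finite) riemannian" and N :: "('b, 'n::finite) riemannian"
  assumes M: "oriented_riemannian_manifold M" and N: "oriented_riemannian_manifold N"
    and f: "continuous_map (mtop M) (mtop N) f"
    and c: "c \<in> charts M" "c' \<in> charts M" "p \<in> fst c" "p \<in> fst c'"
    and d: "d \<in> charts N" "d' \<in> charts N" "f p \<in> fst d" "f p \<in> fst d'"
    and diff: "local_rep c' d' f differentiable (at (snd c' p))"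
  obtains A where "invertible A" "strain M N c d f p = matrix_inv A ** strain M N c' d' f p ** A"
proof -
  note isc = charts_is_chart[OF M c(1)] charts_is_chart[OF M c(2)] and isd = charts_is_chart[OF N d(1)] charts_is_chart[OF N d(2)]
  define A where "A = jacobian (local_rep c c' id) (at (snd c p))"
  define B where "B = jacobian (local_rep d' d id) (at (snd d' (f p)))"
  define J' where "J' = jacobian (local_rep c' d' f) (at (snd c' p))"
  define g where "g = metric M c' (snd c' p)"
  define h where "h = metric N d (snd d (f p))"
  have x: "local_rep c c' id (snd c p) = snd c' p" using chart_inv_left[OF isc(1) c(3)] by (simp add: local_rep_apply)
  have y: "local_rep d' d id (snd d' (f p)) = snd d (f p)" using chart_inv_left[OF isd(2) d(4)] by (simp add: local_rep_apply)
  have z: "local_rep c d f (snd c p) = snd d (f p)" "local_rep c' d' f (snd c' p) = snd d' (f p)"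
    using chart_inv_left[OF isc(1) c(3)] chart_inv_left[OF isc(2) c(4)] by (simp_all add: local_rep_apply)
  have mem: "snd c p \<in> local_dom c c' id" "snd d' (f p) \<in> local_dom d' d id"
    using c d by (auto intro!: local_dom_memI)
  have gc: "metric M c (snd c p) = transpose A ** g ** A"
    using metric_transform[OF M c(1,2) mem(1)] unfolding x A_def g_def .
  have hd: "metric N d' (snd d' (f p)) = transpose B ** h ** B"
    using metric_transform[OF N d(2,1) mem(2)] unfolding y B_def h_def .
  have J: "jacobian (local_rep c d f) (at (snd c p)) = B ** J' ** A"
    using local_rep_chain(2)[OF M N f c d diff] by (simp add: A_def B_def J'_def)
  have "0 < det A" unfolding A_def by (rule chart_change(3)[OF M c(1,2)]) (use c in \<open>auto intro!: local_dom_memI\<close>)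
  then have A: "invertible A" by (simp add: invertible_det_nz)
  have tA: "transpose (matrix_inv A) ** transpose A = mat 1" "transpose A ** transpose (matrix_inv A) = mat 1"
    using matrix_inv_inverse[OF A] by (metis matrix_transpose_mul transpose_mat)+
  have g: "invertible g" unfolding g_def by (rule metric_props(4)[OF M c(2)]) (use c in \<open>auto simp: chart_image_def\<close>)
  have "(transpose A ** g ** A) ** (matrix_inv A ** matrix_inv g ** transpose (matrix_inv A)) =
     transpose A ** (g ** ((A ** matrix_inv A) ** matrix_inv g)) ** transpose (matrix_inv A)"
    by (simp only: matrix_mul_assoc)
  also have "\<dots> = mat 1"
    by (simp only: matrix_inv_inverse[OF A] matrix_mul_lid matrix_inv_inverse[OF g] matrix_mul_rid tA)
  finally have inv: "matrix_inv (metric M c (snd c p)) = matrix_inv A ** matrix_inv g ** transpose (matrix_inv A)"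
    unfolding gc by (rule matrix_inv_eqI(1))
  have "strain M N c d f p = matrix_inv A ** matrix_inv g ** ((transpose (matrix_inv A) ** transpose A) **
       (transpose J' ** (transpose B ** h ** B) ** J' ** A))"
    unfolding strain_def pullback_def inv z J h_def[symmetric] by (simp add: matrix_transpose_mul matrix_mul_assoc)
  also have "\<dots> = matrix_inv A ** strain M N c' d' f p ** A"
    unfolding tA strain_def pullback_def z hd[symmetric] J'_def[symmetric] g_def[symmetric] by (simp add: matrix_mul_assoc)
  finally show ?thesis using that A by blast
qed

lemma similar_trace_det:
  fixes A S :: "real ^ 'n::finite ^ 'n"
  assumes "invertible A"
  shows "trace (matrix_inv A ** S ** A) = trace S" "det (matrix_inv A ** S ** A) = det S"
proof -
  have "trace (matrix_inv A ** S ** A) = trace (A ** (matrix_inv A ** S))" by (rule trace_mul_sym)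
  then show "trace (matrix_inv A ** S ** A) = trace S" by (simp add: matrix_mul_assoc matrix_inv_inverse[OF assms])
  have "det (matrix_inv A) * det A = 1" using matrix_inv_inverse(2)[OF assms] by (metis det_I det_mul)
  then show "det (matrix_inv A ** S ** A) = det S" by (simp add: det_mul mult_ac)
qed

text \<open>\<open>diff_norm_sq\<close> is evaluated in the charts chosen by
  \<open>chart_at\<close>; invariance of the trace under similarity allows any pair of
  charts.\<close>

lemma diff_norm_sq_eq_trace:
  fixes M :: "('a, 'm::finite) riemannian" and N :: "('b, 'n::finite) riemannian"
  assumes M: "oriented_riemannian_manifold M" and N: "oriented_riemannian_manifold N"
    and f: "continuous_map (mtop M) (mtop N) f"
    and c: "c \<in> charts M" "p \<in> fst c" and d: "d \<in> charts N" "f p \<in> fst d"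
    and diff: "local_rep c d f differentiable (at (snd c p))"
  shows "diff_norm_sq M N f p = trace (strain M N c d f p)"
proof -
  have p: "p \<in> topspace (mtop M)" "f p \<in> topspace (mtop N)"
    using chart_subset[OF charts_is_chart[OF M c(1)]] chart_subset[OF charts_is_chart[OF N d(1)]] c d by auto
  note ca = chart_at_in[OF M p(1)] and da = chart_at_in[OF N p(2)]
  obtain A where A: "invertible A" "strain M N (chart_at M p) (chart_at N (f p)) f p = matrix_inv A ** strain M N c d f p ** A"
    by (rule strain_similar[OF M N f ca(1) c(1) ca(2) c(2) da(1) d(1) da(2) d(2) diff])
  have "local_rep (chart_at M p) (chart_at N (f p)) f (snd (chart_at M p) p) = snd (chart_at N (f p)) (f p)"
    using chart_inv_left[OF charts_is_chart[OF M ca(1)] ca(2)] by (simp add: local_rep_apply)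
  then have "diff_norm_sq M N f p = trace (strain M N (chart_at M p) (chart_at N (f p)) f p)"
    by (simp add: diff_norm_sq_def Let_def strain_def pullback_def)
  then show ?thesis unfolding A(2) similar_trace_det[OF A(1)] .
qed

section \<open>Energy in a chart and transplanted variations\<close>

text \<open>\<open>is_volume_measure\<close> prescribes the measure of sets inside charts. On
  \<Omega> this identifies \<mu> with the image under \<open>chart_inv c\<close> of Lebesgue measure
  with density sqrt det g, and the integral is transported along that image.\<close>

lemma volume_integral_in_chart:
  fixes M :: "('a, 'm::finite) riemannian" and h :: "real ^ 'm \<Rightarrow> real"
  assumes M: "oriented_riemannian_manifold M" and c: "c \<in> charts M" and \<mu>: "is_volume_measure M \<mu>"
    and B: "open B" "B \<subseteq> chart_image c" and h: "continuous_on B h"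
    and w: "continuous_on B (\<lambda>x. sqrt (det (metric M c x)))" "\<And>x. x \<in> B \<Longrightarrow> 0 \<le> det (metric M c x)"
    and f: "\<And>p. p \<in> fst c \<Longrightarrow> snd c p \<in> B \<Longrightarrow> f p = h (snd c p)"
  shows "(LINT p:{p \<in> fst c. snd c p \<in> B}|\<mu>. f p) = (LINT x:B|lborel. sqrt (det (metric M c x)) * h x)"
proof -
  note isc = charts_is_chart[OF M c]
  define \<Omega> where "\<Omega> = {p \<in> fst c. snd c p \<in> B}"
  let ?T = "chart_inv c" and ?w = "\<lambda>x. sqrt (det (metric M c x))"
  let ?L = "restrict_space lborel B"
  let ?\<nu> = "restrict_space \<mu> \<Omega>" and ?\<nu>' = "density ?L (\<lambda>x. ennreal (?w x))"
  have sp: "space \<mu> = topspace (mtop M)"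
    and sets: "sets \<mu> = sigma_sets (topspace (mtop M)) {U. openin (mtop M) U}"
    and em: "A \<in> sets \<mu> \<Longrightarrow> A \<subseteq> fst c \<Longrightarrow> emeasure \<mu> A = (\<integral>\<^sup>+x\<in>snd c ` A. ennreal (?w x) \<partial>lborel)" for A
    using \<mu> c by (auto simp: is_volume_measure_def)
  have op: "openin (mtop M) \<Omega>" unfolding \<Omega>_def by (rule chart_preimage_open[OF isc B(1)])
  have open_sets: "U \<in> sets \<mu>" if "openin (mtop M) U" for U
    unfolding sets using that by (auto intro: sigma_sets.Basic)
  have \<Omega>: "\<Omega> \<in> sets \<mu>" "\<Omega> \<subseteq> fst c" using open_sets[OF op] by (auto simp: \<Omega>_def)
  have \<Omega>sp: "\<Omega> \<inter> space \<mu> \<in> sets \<mu>" "\<Omega> \<subseteq> space \<mu>" using \<Omega> sets.sets_into_space[OF \<Omega>(1)] by auto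
  have space_nu: "space ?\<nu> = \<Omega>" using \<Omega>sp by (auto simp: space_restrict_space)
  have Bsp: "B \<inter> space lborel \<in> sets lborel" using B by simp
  have T\<Omega>: "?T x \<in> \<Omega>" "snd c (?T x) = x" if "x \<in> B" for x
    using that B(2) chart_inv_in[OF isc] chart_inv_right[OF isc] by (auto simp: \<Omega>_def)
  have Tmeas: "?T \<in> measurable ?L ?\<nu>"
  proof (rule measurable_restrict_space2)
    show "?T \<in> space ?L \<rightarrow> \<Omega>" using T\<Omega> by (auto simp: space_restrict_space)
    show "?T \<in> measurable ?L \<mu>"
    proof (rule measurable_sigma_sets[OF sets])
      show "{U. openin (mtop M) U} \<subseteq> Pow (topspace (mtop M))" using openin_subset by auto
      show "?T \<in> space ?L \<rightarrow> topspace (mtop M)"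
        using T\<Omega> \<Omega>sp sp by (auto simp: space_restrict_space)
      fix U assume "U \<in> {U. openin (mtop M) U}"
      then have "openin (top_of_set (chart_image c)) {x \<in> chart_image c. ?T x \<in> U}"
        using openin_continuous_map_preimage[OF chart_inv_continuous[OF isc], of U] by simp
      then have "open {x \<in> chart_image c. ?T x \<in> U}" using chart_open(2)[OF isc] by (simp add: openin_open_eq)
      then have "open ({x \<in> chart_image c. ?T x \<in> U} \<inter> B)" using B(1) by (rule open_Int)
      moreover have "?T -` U \<inter> space ?L = {x \<in> chart_image c. ?T x \<in> U} \<inter> B"
        using B(2) by (auto simp: space_restrict_space)
      ultimately show "?T -` U \<inter> space ?L \<in> sets ?L"
        by (simp add: sets_restrict_space_iff[OF Bsp])
    qed
  qed
  have wmeas: "?w \<in> borel_measurable ?L" and hmeas: "h \<in> borel_measurable ?L"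
    using borel_measurable_continuous_on_restrict[OF w(1)] borel_measurable_continuous_on_restrict[OF h]
    by (simp_all cong: measurable_cong_sets add: sets_restrict_space)
  have "?\<nu> = distr ?\<nu>' ?\<nu> ?T"
  proof (rule measure_eqI)
    fix A assume A: "A \<in> sets ?\<nu>"
    then have A': "A \<in> sets \<mu>" "A \<subseteq> \<Omega>" using sets_restrict_space_iff[OF \<Omega>sp(1)] by auto
    have im: "?T -` A \<inter> B = snd c ` A"
      using A'(2) T\<Omega> chart_inv_left[OF isc] \<Omega>(2) by (force simp: \<Omega>_def image_iff)
    have pre: "?T -` A \<inter> space ?L \<in> sets ?L" using measurable_sets[OF Tmeas A] .
    have "emeasure (distr ?\<nu>' ?\<nu> ?T) A = emeasure ?\<nu>' (?T -` A \<inter> space ?L)"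
      by (subst emeasure_distr) (use A Tmeas in \<open>auto simp: measurable_density_eq2\<close>)
    also have "\<dots> = (\<integral>\<^sup>+ x. ennreal (?w x) * indicator (?T -` A \<inter> space ?L) x \<partial>?L)"
      by (rule emeasure_density) (use wmeas pre in auto)
    also have "\<dots> = (\<integral>\<^sup>+ x. ennreal (?w x) * indicator (?T -` A \<inter> space ?L) x * indicator B x \<partial>lborel)"
      by (rule nn_integral_restrict_space[OF Bsp])
    also have "\<dots> = (\<integral>\<^sup>+x\<in>snd c ` A. ennreal (?w x) \<partial>lborel)"
      unfolding im[symmetric] by (intro nn_integral_cong) (auto simp: space_restrict_space indicator_def)
    also have "\<dots> = emeasure ?\<nu> A"
      using em[OF A'(1)] A'(2) \<Omega>(2) emeasure_restrict_space[OF \<Omega>sp(1) A'(2)] by auto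
    finally show "emeasure ?\<nu> A = emeasure (distr ?\<nu>' ?\<nu> ?T) A" by simp
  qed simp
  note nu = this
  have cmeas: "snd c \<in> measurable ?\<nu> (restrict_space borel B)"
  proof (rule measurable_restrict_space2)
    show "snd c \<in> space ?\<nu> \<rightarrow> B" unfolding space_nu by (auto simp: \<Omega>_def)
    show "snd c \<in> borel_measurable ?\<nu>"
    proof (rule borel_measurableI)
      fix S :: "(real ^ 'm) set" assume "open S"
      then have "openin (mtop M) {p \<in> fst c. snd c p \<in> S \<inter> B}" using chart_preimage_open[OF isc] B(1) by blast
      moreover have "snd c -` S \<inter> space ?\<nu> = {p \<in> fst c. snd c p \<in> S \<inter> B}" unfolding space_nu by (auto simp: \<Omega>_def)
      moreover have "{p \<in> fst c. snd c p \<in> S \<inter> B} \<subseteq> \<Omega>" by (auto simp: \<Omega>_def)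
      ultimately show "snd c -` S \<inter> space ?\<nu> \<in> sets ?\<nu>"
        using open_sets by (simp add: sets_restrict_space_iff[OF \<Omega>sp(1)])
    qed
  qed
  have "(\<lambda>p. h (snd c p)) \<in> borel_measurable ?\<nu>"
    using measurable_compose[OF cmeas borel_measurable_continuous_on_restrict[OF h]] .
  then have fmeas: "f \<in> borel_measurable ?\<nu>"
    by (subst measurable_cong[of _ _ "\<lambda>p. h (snd c p)"]) (use f space_nu in \<open>auto simp: \<Omega>_def\<close>)
  have "(LINT p:\<Omega>|\<mu>. f p) = integral\<^sup>L ?\<nu> f"
    unfolding set_lebesgue_integral_def by (rule integral_restrict_space[OF \<Omega>sp(1), symmetric])
  also have "\<dots> = integral\<^sup>L (distr ?\<nu>' ?\<nu> ?T) f" using nu by simp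
  also have "\<dots> = integral\<^sup>L ?\<nu>' (\<lambda>x. f (?T x))"
    by (rule integral_distr[OF _ fmeas]) (use Tmeas in \<open>simp add: measurable_density_eq2\<close>)
  also have "\<dots> = integral\<^sup>L ?L (\<lambda>x. ?w x *\<^sub>R f (?T x))"
    by (rule integral_density) (use wmeas w(2) measurable_compose[OF Tmeas fmeas] in \<open>auto simp: space_restrict_space\<close>)
  also have "\<dots> = (LINT x:B|lborel. ?w x *\<^sub>R f (?T x))"
    unfolding set_lebesgue_integral_def by (rule integral_restrict_space[OF Bsp])
  also have "\<dots> = (LINT x:B|lborel. ?w x * h x)"
    using T\<Omega> f B by (intro set_lebesgue_integral_cong) (auto simp: \<Omega>_def)
  finally show ?thesis unfolding \<Omega>_def .
qed

lemma cylinder_chart_inv: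
  assumes c: "is_chart X c" and t: "t \<in> I" "x \<in> chart_image c"
  shows "chart_inv (I \<times> fst c, map_prod id (snd c)) (t, x) = (t, chart_inv c x)"
proof -
  have "inj_on (map_prod id (snd c)) (I \<times> fst c)"
    using chart_inj[OF c] by (auto simp: inj_on_def)
  moreover have "(t, chart_inv c x) \<in> I \<times> fst c" using t chart_inv_in[OF c] by auto
  moreover have "map_prod id (snd c) (t, chart_inv c x) = (t, x)" using chart_inv_right[OF c t(2)] by simp
  ultimately have "inv_into (I \<times> fst c) (map_prod id (snd c)) (t, x) = (t, chart_inv c x)"
    using inv_into_f_f[of "map_prod id (snd c)" "I \<times> fst c" "(t, chart_inv c x)"] by (simp only:)
  then show ?thesis by (simp only: chart_inv_def[of "(I \<times> fst c, map_prod id (snd c))"] fst_conv snd_conv)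
qed

text \<open>The composite of \<open>f\<close> with the deformation x + t \<eta>(x) e of the domain
  in the coordinates of \<open>c\<close>, continued by \<open>f\<close>. Every value is a value of
  \<open>f\<close>, so no chart of the target enters.\<close>

definition chart_variation ::
    "('a, 'e::real_normed_vector) chart \<Rightarrow> ('e \<Rightarrow> real) \<Rightarrow> 'e \<Rightarrow> 'e set \<Rightarrow> ('a \<Rightarrow> 'b) \<Rightarrow> real \<Rightarrow> 'a \<Rightarrow> 'b" where
  "chart_variation c \<eta> e B f t p =
     (if p \<in> fst c \<and> snd c p \<in> B then f (chart_inv c (snd c p + (t * \<eta> (snd c p)) *\<^sub>R e)) else f p)"

text \<open>Two open sets cover the manifold: on \<Omega> the variation is \<open>f\<close> after a
  smooth deformation in coordinates, off the compact set K it is \<open>f\<close> itself, and on the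
  overlap \<eta> vanishes. K is closed because \<open>M\<close> is Hausdorff.\<close>

lemma chart_variation_smooth:
  fixes M :: "('a, 'm::finite) riemannian" and N :: "('b, 'n::finite) riemannian"
  assumes M: "oriented_riemannian_manifold M" and N: "oriented_riemannian_manifold N" and f: "smooth_map M N f"
    and c: "c \<in> charts M" and B: "open B" "B \<subseteq> chart_image c"
    and \<eta>: "smooth_on UNIV \<eta>" "\<And>x. \<eta> x \<noteq> 0 \<Longrightarrow> x \<in> C" and C: "compact C" "C \<subseteq> B" and "0 < \<epsilon>"
    and stay: "\<And>t x. \<bar>t\<bar> < \<epsilon> \<Longrightarrow> x \<in> B \<Longrightarrow> x + (t * \<eta> x) *\<^sub>R e \<in> B"
  shows "smooth_variation M N f {p \<in> fst c. snd c p \<in> B} \<epsilon> (chart_variation c \<eta> e B f)"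
proof -
  note isc = charts_is_chart[OF M c]
  let ?F = "chart_variation c \<eta> e B f" and ?X = "mtop M" and ?Y = "mtop N"
  define I where "I = {-\<epsilon><..<\<epsilon>}"
  define \<Omega> where "\<Omega> = {p \<in> fst c. snd c p \<in> B}"
  define K where "K = {p \<in> fst c. snd c p \<in> C}"
  define \<psi> where "\<psi> = (\<lambda>t x. x + (t * \<eta> x) *\<^sub>R e)"
  have stay': "\<psi> t x \<in> B" if "t \<in> I" "x \<in> B" for t x using stay that by (auto simp: \<psi>_def I_def)
  have opI: "open I" by (simp add: I_def)
  have sf: "smooth_on (local_dom c' d f) (local_rep c' d f)"
    if "c' \<in> charts M" "d \<in> charts N" for c' d using f that by (auto simp: smooth_map_def)
  have cf: "continuous_map ?X ?Y f" using f by (auto simp: smooth_map_def)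
  have Cc: "C \<subseteq> chart_image c" using C B by auto
  have "compactin (top_of_set (chart_image c)) C" using C Cc by (simp add: compactin_subtopology)
  then have "compactin ?X (chart_inv c ` C)" by (rule image_compactin[OF _ chart_inv_continuous[OF isc]])
  then have K: "compactin ?X K" unfolding K_def chart_inv_image[OF isc Cc] .
  have "Hausdorff_space ?X" using M by (simp add: oriented_riemannian_manifold_def)
  then have Kc: "closedin ?X K" using K compactin_imp_closedin by blast
  have K\<Omega>: "K \<subseteq> \<Omega>" using C by (auto simp: K_def \<Omega>_def)
  have op: "openin ?X \<Omega>" "openin ?X (topspace ?X - K)"
    using chart_preimage_open[OF isc B(1)] Kc by (auto simp: \<Omega>_def)
  have F\<Omega>: "?F t p = f (chart_inv c (\<psi> t (snd c p)))" if "p \<in> \<Omega>" for t p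
    using that by (simp add: chart_variation_def \<Omega>_def \<psi>_def)
  have FK: "?F t p = f p" if "p \<notin> K" for t p
  proof (cases "p \<in> \<Omega>")
    case True
    then have "\<eta> (snd c p) = 0" using that \<eta>(2) by (auto simp: K_def \<Omega>_def)
    then show ?thesis using True chart_inv_left[OF isc] by (simp add: F\<Omega> \<psi>_def \<Omega>_def)
  next
    case False then show ?thesis by (auto simp: chart_variation_def \<Omega>_def)
  qed
  have F0: "?F 0 p = f p" for p using chart_inv_left[OF isc] by (simp add: chart_variation_def)
  have c\<psi>: "continuous_on S (\<lambda>z. \<psi> (fst z) (snd z))" for S
    unfolding \<psi>_def by (intro continuous_intros continuous_on_compose2[OF smooth_on_imp_continuous_on[OF \<eta>(1)]]) auto
  let ?XX = "prod_topology (top_of_set I) ?X"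
  have cont: "continuous_map ?XX ?Y (\<lambda>(t, p). ?F t p)"
  proof (rule pasting_lemma[where I = UNIV and T = "\<lambda>b. I \<times> (if b then \<Omega> else topspace ?X - K)"
        and f = "\<lambda>b z. if b then f (chart_inv c (\<psi> (fst z) (snd c (snd z)))) else f (snd z)"])
    show "openin ?XX (I \<times> (if b then \<Omega> else topspace ?X - K))" for b
      using op by (auto simp: openin_prod_Times_iff)
    show "continuous_map (subtopology ?XX (I \<times> (if b then \<Omega> else topspace ?X - K))) ?Y
        (\<lambda>z. if b then f (chart_inv c (\<psi> (fst z) (snd c (snd z)))) else f (snd z))" for b
    proof (cases b)
      case False
      have "continuous_map ?XX ?Y (f \<circ> snd)" by (rule continuous_map_compose[OF continuous_map_snd cf])
      then show ?thesis using False by (auto simp: o_def intro: continuous_map_from_subtopology)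
    next
      case True
      let ?Z = "subtopology ?XX (I \<times> \<Omega>)"
      have tZ: "topspace ?Z = I \<times> \<Omega>" using openin_subset[OF op(1)] by auto
      have "continuous_map ?Z ?X snd" by (intro continuous_map_from_subtopology continuous_map_snd)
      then have "continuous_map ?Z (subtopology ?X (fst c)) snd"
        by (auto simp: continuous_map_in_subtopology tZ \<Omega>_def)
      from continuous_map_compose[OF this chart_continuous[OF isc]]
      have 1: "continuous_map ?Z euclidean (\<lambda>z. snd c (snd z))" by (simp add: o_def)
      have "continuous_map ?Z (top_of_set I) fst" by (intro continuous_map_from_subtopology continuous_map_fst)
      then have 2: "continuous_map ?Z euclidean fst" by (simp add: continuous_map_in_subtopology)
      have "continuous_map ?Z euclidean (\<lambda>z. (fst z, snd c (snd z)))"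
        using continuous_map_pairedI[OF 2 1] by simp
      then have "continuous_map ?Z euclidean ((\<lambda>z. \<psi> (fst z) (snd z)) \<circ> (\<lambda>z. (fst z, snd c (snd z))))"
        by (rule continuous_map_compose) (use c\<psi>[of UNIV] in simp)
      then have "continuous_map ?Z euclidean (\<lambda>z. \<psi> (fst z) (snd c (snd z)))" by (simp add: o_def)
      moreover have "\<psi> (fst z) (snd c (snd z)) \<in> chart_image c" if "z \<in> topspace ?Z" for z
        using that stay' B(2) unfolding tZ by (auto simp: \<Omega>_def)
      ultimately have "continuous_map ?Z (top_of_set (chart_image c)) (\<lambda>z. \<psi> (fst z) (snd c (snd z)))"
        by (auto simp: continuous_map_in_subtopology)
      from continuous_map_compose[OF continuous_map_compose[OF this chart_inv_continuous[OF isc]] cf]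
      show ?thesis using True by (simp add: o_def)
    qed
    show "(if i then f (chart_inv c (\<psi> (fst x) (snd c (snd x)))) else f (snd x)) =
         (if j then f (chart_inv c (\<psi> (fst x) (snd c (snd x)))) else f (snd x))"
      if "x \<in> topspace ?XX \<inter> (I \<times> (if i then \<Omega> else topspace ?X - K)) \<inter> (I \<times> (if j then \<Omega> else topspace ?X - K))" for i j x
      using that F\<Omega>[of "snd x" "fst x"] FK[of "snd x" "fst x"] by (auto split: if_splits)
    show "\<exists>j. j \<in> UNIV \<and> x \<in> I \<times> (if j then \<Omega> else topspace ?X - K) \<and>
        (case x of (t, p) \<Rightarrow> ?F t p) = (if j then f (chart_inv c (\<psi> (fst x) (snd c (snd x)))) else f (snd x))"
      if "x \<in> topspace ?XX" for x
    proof (cases "snd x \<in> \<Omega>")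
      case True then show ?thesis using that F\<Omega> by (intro exI[of _ True]) (auto simp: case_prod_beta)
    next
      case False then show ?thesis using that K\<Omega> FK by (intro exI[of _ False]) (auto simp: case_prod_beta)
    qed
  qed
  have smooth: "smooth_on (local_dom cc d (\<lambda>(t, p). ?F t p)) (local_rep cc d (\<lambda>(t, p). ?F t p))"
    if cc: "cc \<in> charts (cylinder \<epsilon> M)" and d: "d \<in> charts N" for cc d
  proof -
    obtain c' where c': "c' \<in> charts M" and ccd: "cc = (I \<times> fst c', map_prod id (snd c'))"
      using cc by (auto simp: cylinder_def I_def)
    note isc' = charts_is_chart[OF M c'] and isd = charts_is_chart[OF N d]
    have rep: "local_rep cc d (\<lambda>(t, p). ?F t p) (t, x) = snd d (?F t (chart_inv c' x))" if "t \<in> I" "x \<in> chart_image c'" for t x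
      unfolding local_rep_def ccd by (simp add: cylinder_chart_inv[OF isc' that])
    show ?thesis
    proof (rule smooth_on_local)
      fix z assume "z \<in> local_dom cc d (\<lambda>(t, p). ?F t p)"
      then obtain t q where z: "z = (t, snd c' q)" and t: "t \<in> I" and q: "q \<in> fst c'" "?F t q \<in> fst d"
        by (auto simp: local_dom_def ccd)
      show "\<exists>A. open A \<and> z \<in> A \<and> smooth_on A (local_rep cc d (\<lambda>(t, p). ?F t p))"
      proof (cases "q \<in> \<Omega>")
        case True
        define D0 where "D0 = snd c' ` (fst c' \<inter> \<Omega>)"
        let ?cc = "local_rep c' c id"
        have oD0: "open D0" unfolding D0_def
          by (rule chart_image_open[OF isc']) (use op chart_open(1)[OF isc'] in auto)
        have D0: "D0 \<subseteq> local_dom c' c id" "D0 \<subseteq> chart_image c'" by (auto simp: D0_def local_dom_def \<Omega>_def chart_image_def)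
        have D0inv: "chart_inv c' x \<in> \<Omega>" if "x \<in> D0" for x using that chart_inv_left[OF isc'] by (auto simp: D0_def)
        have oID: "open (I \<times> D0)" using opI oD0 by (rule open_Times)
        have s1: "smooth_on (I \<times> D0) (\<lambda>z. ?cc (snd z))"
          by (rule smooth_on_compose[OF oID oD0 _ _ smooth_on_subset[OF chart_change(2)[OF M c' c] D0(1)]])
             (auto intro!: smooth_on_bounded_linear bounded_linear_snd oID)
        have s2: "smooth_on (I \<times> D0) (\<lambda>z. \<psi> (fst z) (?cc (snd z)))"
          unfolding \<psi>_def
          by (intro smooth_on_add smooth_on_scaleR smooth_on_mult smooth_on_const s1 oID
              smooth_on_bounded_linear[OF bounded_linear_fst] smooth_on_compose[OF oID open_UNIV subset_UNIV s1 \<eta>(1)])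
        \<comment> \<open>The displaced point must lie where \<open>f\<close> is represented in the
          charts \<open>c\<close> and \<open>d\<close>; by continuity of the displacement this is an
          open condition.\<close>
        define A where "A = (I \<times> D0) \<inter> (\<lambda>z. \<psi> (fst z) (?cc (snd z))) -` local_dom c d f"
        have oA: "open A" unfolding A_def
          by (rule continuous_open_preimage[OF smooth_on_imp_continuous_on[OF s2] oID local_dom_open[OF isc isd cf]])
        have ccq: "?cc (snd c' q) = snd c q" using chart_inv_left[OF isc' q(1)] by (simp add: local_rep_apply)
        have inB: "\<psi> t (?cc x) \<in> B" if "t \<in> I" "x \<in> D0" for t x
          using stay'[OF that(1)] D0inv[OF that(2)] by (auto simp: local_rep_apply \<Omega>_def)
        have zA: "z \<in> A"
          using t q True inB[of t "snd c' q"] B(2) F\<Omega>[OF True]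
          by (auto simp: A_def z D0_def ccq local_dom_iff[OF isc])
        have "smooth_on A (\<lambda>z. local_rep c d f (\<psi> (fst z) (?cc (snd z))))"
          by (rule smooth_on_compose[OF oA local_dom_open[OF isc isd cf] _ smooth_on_subset[OF s2] sf[OF c d]])
            (auto simp: A_def)
        then have "smooth_on A (local_rep cc d (\<lambda>(t, p). ?F t p))"
        proof (rule smooth_on_cong[OF oA, rotated])
          fix y assume "y \<in> A"
          then have y: "fst y \<in> I" "snd y \<in> D0" by (auto simp: A_def)
          show "local_rep c d f (\<psi> (fst y) (?cc (snd y))) = local_rep cc d (\<lambda>(t, p). ?F t p) y"
            using rep[OF y(1) subsetD[OF D0(2) y(2)]] F\<Omega>[OF D0inv[OF y(2)]] by (simp add: local_rep_apply)
        qed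
        then show ?thesis using oA zA by blast
      next
        case False
        then have qK: "q \<notin> K" using K\<Omega> by auto
        define D1 where "D1 = snd c' ` (fst c' \<inter> (topspace ?X - K)) \<inter> local_dom c' d f"
        have oD1: "open D1" unfolding D1_def
          by (intro open_Int local_dom_open[OF isc' isd cf] chart_image_open[OF isc'])
            (use op chart_open(1)[OF isc'] in auto)
        have oID: "open (I \<times> D1)" using opI oD1 by (rule open_Times)
        have zA: "z \<in> I \<times> D1"
          using t q qK FK[OF qK] chart_subset[OF isc'] by (auto simp: z D1_def intro!: local_dom_memI)
        have "smooth_on (I \<times> D1) (\<lambda>z. local_rep c' d f (snd z))"
          by (rule smooth_on_compose[OF oID oD1 _ smooth_on_bounded_linear[OF bounded_linear_snd oID] smooth_on_subset[OF sf[OF c' d]]])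
             (auto simp: D1_def)
        then have "smooth_on (I \<times> D1) (local_rep cc d (\<lambda>(t, p). ?F t p))"
        proof (rule smooth_on_cong[OF oID, rotated])
          fix y assume "y \<in> I \<times> D1"
          then have y: "fst y \<in> I" "snd y \<in> chart_image c'" "chart_inv c' (snd y) \<notin> K"
            using chart_inv_left[OF isc'] by (auto simp: D1_def chart_image_def)
          show "local_rep c' d f (snd y) = local_rep cc d (\<lambda>(t, p). ?F t p) y"
            using rep[OF y(1,2)] FK[OF y(3)] by (simp add: local_rep_apply)
        qed
        then show ?thesis using oID zA by blast
      qed
    qed
  qed
  have "continuous_map (mtop (cylinder \<epsilon> M)) (mtop N) (\<lambda>(t, p). ?F t p)"
    using cont by (simp add: cylinder_def I_def)
  then have "smooth_map (cylinder \<epsilon> M) N (\<lambda>(t, p). ?F t p)"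
    unfolding smooth_map_def using smooth by blast
  moreover have "\<exists>K. compactin ?X K \<and> K \<subseteq> \<Omega> \<and> (\<forall>t\<in>{-\<epsilon><..<\<epsilon>}. \<forall>p\<in>topspace ?X - K. ?F t p = f p)"
    using K K\<Omega> FK by blast
  ultimately show ?thesis
    unfolding smooth_variation_def \<Omega>_def[symmetric] using \<open>0 < \<epsilon>\<close> F0 by blast
qed

text \<open>\<open>D\<close> is the Jacobian of the deformation x + t \<eta>(x) e_k, namely the
  identity plus t times the gradient \<open>n\<close> of \<eta> in row k.\<close>

lemma trace_flow_pullback:
  fixes P D :: "real ^ 2 ^ 2"
  assumes D: "\<And>i j. D $ i $ j = (if i = j then 1 else 0) + (if i = k then t * n j else 0)"
    and P: "P $ 2 $ 1 = P $ 1 $ 2"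
  shows "trace (transpose D ** P ** D) =
    (\<Sum>i\<in>UNIV. P $ i $ i + 2 * t * n i * P $ i $ k + t\<^sup>2 * (n i)\<^sup>2 * P $ k $ k)"
proof -
  have "k = 1 \<or> k = 2" using exhaust_2 by blast
  then show ?thesis
    by (auto simp: trace_2 sum_2 matrix_matrix_mult_def transpose_def D P power2_eq_square algebra_simps)
qed

definition isothermal_chart :: "('a, 2) riemannian \<Rightarrow> ('a, real ^ 2) chart \<Rightarrow> bool" where
  "isothermal_chart M c \<longleftrightarrow> c \<in> charts M \<and> (\<forall>x\<in>chart_image c. \<exists>l. metric M c x = l *\<^sub>R mat 1)"

lemma metric_on_chart:
  "oriented_riemannian_surface N \<Longrightarrow> d \<in> charts N \<Longrightarrow> metric_on (chart_image d) (metric N d)"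
  using metric_props[of N d] chart_open(2)[OF charts_is_chart] by (simp add: metric_on_def)

lemma isothermal_metric:
  assumes M: "oriented_riemannian_surface M" and c: "isothermal_chart M c" and x: "x \<in> chart_image c"
  defines "l \<equiv> metric M c x $ 1 $ 1"
  shows "metric M c x = l *\<^sub>R mat 1" "0 < l" "sqrt (det (metric M c x)) = l"
    "matrix_inv (metric M c x) = (1 / l) *\<^sub>R mat 1"
proof -
  have cM: "c \<in> charts M" using c by (simp add: isothermal_chart_def)
  obtain l' where l': "metric M c x = l' *\<^sub>R mat 1" using c x by (auto simp: isothermal_chart_def)
  then show 1: "metric M c x = l *\<^sub>R mat 1" by (simp add: l_def mat_def)
  show l: "0 < l" unfolding l_def by (rule metric_pos11[OF metric_on_chart[OF M cM] x])
  have "det (metric M c x) = l * l" unfolding 1 by (simp add: det_2 mat_def)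
  then show "sqrt (det (metric M c x)) = l" using l by simp
  have "(l *\<^sub>R mat 1) ** ((1 / l) *\<^sub>R mat 1 :: real ^ 2 ^ 2) = mat 1"
    using l by (simp add: vec_eq_iff matrix_matrix_mult_def mat_def forall_2 sum_2)
  then show "matrix_inv (metric M c x) = (1 / l) *\<^sub>R mat 1" unfolding 1 by (rule matrix_inv_eqI(1))
qed

lemma strain_isothermal:
  assumes M: "oriented_riemannian_surface M" and c: "isothermal_chart M c" and p: "p \<in> fst c"
  shows "strain M N c d f p = (1 / metric M c (snd c p) $ 1 $ 1) *\<^sub>R pullback (metric N d) (local_rep c d f) (snd c p)"
  unfolding strain_def
proof -
  have cM: "c \<in> charts M" using c by (simp add: isothermal_chart_def)
  have x: "snd c p \<in> chart_image c" using p by (simp add: chart_image_def)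
  show "matrix_inv (metric M c (snd c p)) ** pullback (metric N d) (local_rep c d f) (snd c p) =
     (1 / metric M c (snd c p) $ 1 $ 1) *\<^sub>R pullback (metric N d) (local_rep c d f) (snd c p)"
    unfolding isothermal_metric(4)[OF M c x] 
    by (simp add: vec_eq_iff matrix_matrix_mult_def mat_def forall_2 sum_2)
qed

lemma chart_jacobian_setting:
  fixes M :: "('a, 2) riemannian" and N :: "('b, 2) riemannian"
  assumes M: "oriented_riemannian_surface M" and N: "oriented_riemannian_surface N" and f: "smooth_map M N f"
    and c: "c \<in> charts M" and d: "d \<in> charts N"
  shows "open (local_dom c d f)" "smooth_on (local_dom c d f) (local_rep c d f)"
    "local_rep c d f ` local_dom c d f \<subseteq> chart_image d"
  using f c d local_dom_open[OF charts_is_chart[OF M c] charts_is_chart[OF N d]]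
    chart_inv_in[OF charts_is_chart[OF M c]]
  by (auto simp: smooth_map_def local_dom_iff[OF charts_is_chart[OF M c]] local_rep_apply chart_image_def)

text \<open>Conformal invariance in dimension two: in an isothermal chart the area density l cancels
  the factor 1 / l of the inverse metric, leaving the Euclidean integral of the trace of the
  pullback. By the chain rule the pullback of the varied map is the pullback of \<open>f\<close> at
  the displaced point, transformed by the Jacobian of the deformation.\<close>

lemma energy_chart_variation:
  fixes M :: "('a, 2) riemannian" and N :: "('b, 2) riemannian"
  assumes M: "oriented_riemannian_surface M" and N: "oriented_riemannian_surface N" and f: "smooth_map M N f"
    and \<mu>: "is_volume_measure M \<mu>"
    and c: "isothermal_chart M c" and d: "d \<in> charts N" and ab: "cbox a b \<subseteq> local_dom c d f"
    and \<eta>: "smooth_on UNIV \<eta>" "\<And>x. \<eta> x \<noteq> 0 \<Longrightarrow> x \<in> box a b"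
    and stay: "\<And>x. x \<in> box a b \<Longrightarrow> x + (t * \<eta> x) *\<^sub>R axis k 1 \<in> box a b"
    and cF: "continuous_map (mtop M) (mtop N) (chart_variation c \<eta> (axis k 1) (box a b) f t)"
  shows "energy M N \<mu> {p \<in> fst c. snd c p \<in> box a b} (chart_variation c \<eta> (axis k 1) (box a b) f t) =
     1 / 2 * integral (cbox a b) (varied_density (pullback (metric N d) (local_rep c d f)) \<eta> k t)"
proof -
  let ?F = "chart_variation c \<eta> (axis k 1) (box a b) f t"
  have cM: "c \<in> charts M" using c by (simp add: isothermal_chart_def)
  note isc = charts_is_chart[OF M cM] and isd = charts_is_chart[OF N d]
  define W where "W = local_dom c d f"
  define \<zeta> where "\<zeta> = local_rep c d f"
  define G where "G = metric N d"
  define P where "P = pullback G \<zeta>"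
  define l where "l = (\<lambda>x. metric M c x $ 1 $ 1)"
  define \<psi> where "\<psi> = (\<lambda>x. x + (t * \<eta> x) *\<^sub>R axis k 1)"
  have \<psi>x: "x + (t * \<eta> x) *\<^sub>R axis k 1 = \<psi> x" for x by (simp add: \<psi>_def)
  let ?v = "varied_density P \<eta> k t"
  note set = chart_jacobian_setting[OF M N f cM d, folded W_def \<zeta>_def]
  have VG: "metric_on (chart_image d) G" unfolding G_def by (rule metric_on_chart[OF N d])
  have sP: "smooth_on W (\<lambda>x. P x $ i $ j)" for i j unfolding P_def by (rule smooth_on_pullback[OF VG set])
  have WB: "box a b \<subseteq> chart_image c" "cbox a b \<subseteq> chart_image c" "box a b \<subseteq> W" "cbox a b \<subseteq> W"
    using ab box_subset_cbox[of a b] by (auto simp: W_def local_dom_iff[OF isc])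
  have \<psi>: "\<psi> x \<in> cbox a b" if "x \<in> cbox a b" for x
  proof (cases "x \<in> box a b")
    case True then show ?thesis using stay box_subset_cbox[of a b] by (auto simp: \<psi>_def)
  next
    case False
    then have "\<eta> x = 0" using \<eta>(2) by blast
    then show ?thesis using that by (simp add: \<psi>_def)
  qed
  have s\<psi>: "smooth_on UNIV \<psi>" unfolding \<psi>_def
    by (intro smooth_on_add smooth_on_scaleR smooth_on_mult smooth_on_const \<eta> smooth_on_ident open_UNIV)
  have cv: "continuous_on (cbox a b) ?v"
  proof -
    have c1: "continuous_on (cbox a b) (\<lambda>x. P (\<psi> x) $ i $ j)" for i j
      by (rule continuous_on_compose2[OF smooth_on_imp_continuous_on[OF sP] continuous_on_subset[OF smooth_on_imp_continuous_on[OF s\<psi>]]])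
        (use \<psi> WB in auto)
    have c2: "continuous_on (cbox a b) (partial i \<eta>)" for i
      by (rule continuous_on_subset[OF smooth_on_imp_continuous_on[OF smooth_on_partial[OF \<eta>(1)]]]) auto
    show ?thesis unfolding varied_density_def Let_def \<psi>x
      by (intro continuous_on_sum continuous_on_add continuous_on_mult continuous_on_power continuous_on_const c1 c2)
  qed
  have cl: "continuous_on (box a b) l" unfolding l_def
    by (rule continuous_on_subset[OF smooth_on_imp_continuous_on[OF smooth_on_metric_nth[OF metric_on_chart[OF M cM]]] WB(1)])
  have lp: "0 < l x" "sqrt (det (metric M c x)) = l x" if "x \<in> box a b" for x
    using isothermal_metric(2,3)[OF M c] that WB(1) by (auto simp: l_def)
  have jac: "local_rep c d ?F differentiable (at x) \<and> local_rep c d ?F x = \<zeta> (\<psi> x) \<and>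
      jacobian (local_rep c d ?F) (at x) = jacobian \<zeta> (at (\<psi> x)) ** jacobian \<psi> (at x)" if x: "x \<in> box a b" for x
  proof -
    have eq: "\<zeta> (\<psi> y) = local_rep c d ?F y" if "y \<in> box a b" for y
      using that chart_inv_in[OF isc] chart_inv_right[OF isc] WB(1)
      by (auto simp: \<zeta>_def \<psi>_def local_rep_apply chart_variation_def)
    have d1: "\<psi> differentiable (at x)" by (rule smooth_on_differentiable[OF s\<psi> UNIV_I])
    have d2: "\<zeta> differentiable (at (\<psi> x))"
      by (rule smooth_on_differentiable[OF set(2)]) (use stay[OF x] WB(3) in \<open>auto simp: \<psi>_def\<close>)
    note jc = jacobian_compose[OF d1 d2]
    show ?thesis using jacobian_cong[OF open_box x eq jc(2)] jc(1) eq[OF x] by simp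
  qed
  have j\<psi>: "jacobian \<psi> (at x) $ i $ j = (if i = j then 1 else 0) + (if i = k then t * partial j \<eta> x else 0)" for x i j
  proof -
    have "((\<lambda>x. \<psi> x $ i) has_derivative (\<lambda>h. h $ i + (t * frechet_derivative \<eta> (at x) h) * axis k 1 $ i)) (at x)"
      unfolding \<psi>_def using smooth_on_has_derivative[OF \<eta>(1) UNIV_I, of x]
      by (auto intro!: derivative_eq_intros bounded_linear.has_derivative[OF bounded_linear_vec_nth])
    from has_derivative_partial[OF this, of j] show ?thesis
      unfolding jacobian_nth[OF smooth_on_differentiable[OF s\<psi> UNIV_I]] by (auto simp: partial_def axis_def)
  qed
  have dn: "diff_norm_sq M N ?F p = ?v (snd c p) / l (snd c p)" if p: "p \<in> fst c" "snd c p \<in> box a b" for p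
  proof -
    let ?x = "snd c p"
    have Fp: "?F p \<in> fst d"
      using stay[OF p(2)] WB(3) p by (auto simp: chart_variation_def W_def local_dom_iff[OF isc])
    have y: "\<psi> ?x \<in> W" using stay[OF p(2)] WB(3) by (auto simp: \<psi>_def)
    have "diff_norm_sq M N ?F p = trace (strain M N c d ?F p)"
      by (rule diff_norm_sq_eq_trace[OF M N cF cM p(1) d Fp]) (use jac[OF p(2)] in blast)
    also have "\<dots> = trace (pullback G (local_rep c d ?F) ?x) / l ?x"
      unfolding strain_isothermal[OF M c p(1)] G_def[symmetric] l_def by (simp add: trace_2 add_divide_distrib)
    also have "pullback G (local_rep c d ?F) ?x = transpose (jacobian \<psi> (at ?x)) ** P (\<psi> ?x) ** jacobian \<psi> (at ?x)"
      using jac[OF p(2)] by (simp add: pullback_def P_def matrix_transpose_mul matrix_mul_assoc)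
    also have "trace \<dots> = ?v ?x"
      unfolding varied_density_def Let_def \<psi>x
      by (rule trace_flow_pullback[OF j\<psi>]) (unfold P_def, rule pullback_sym[OF VG set y])
    finally show ?thesis .
  qed
  have cvb: "continuous_on (box a b) ?v" using continuous_on_subset[OF cv box_subset_cbox] .
  have "(LINT p:{p \<in> fst c. snd c p \<in> box a b}|\<mu>. diff_norm_sq M N ?F p) =
      (LINT x:box a b|lborel. sqrt (det (metric M c x)) * (?v x / l x))"
  proof (rule volume_integral_in_chart[where h = "\<lambda>x. ?v x / l x" and f = "diff_norm_sq M N ?F", OF M cM \<mu> open_box WB(1) _ _ _ dn])
    show "continuous_on (box a b) (\<lambda>x. ?v x / l x)"
      using lp by (intro continuous_on_divide cvb cl) (metis less_irrefl)
    show "continuous_on (box a b) (\<lambda>x. sqrt (det (metric M c x)))"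
      using cl by (rule continuous_on_eq) (simp add: lp)
    show "0 \<le> det (metric M c x)" if "x \<in> box a b" for x
      using lp[OF that] by (metis less_imp_le real_sqrt_ge_0_iff)
  qed
  also have "\<dots> = (LINT x:box a b|lborel. ?v x)"
  proof (rule set_lebesgue_integral_cong)
    show "\<forall>x. x \<in> box a b \<longrightarrow> sqrt (det (metric M c x)) * (?v x / l x) = ?v x"
      using lp by (metis less_irrefl nonzero_mult_div_cancel_left times_divide_eq_right)
  qed simp
  also have "\<dots> = integral (box a b) ?v"
  proof (rule set_borel_integral_eq_integral(2))
    have "set_integrable lborel (cbox a b) ?v"
      unfolding set_integrable_def by (rule borel_integrable_compact[OF compact_cbox cv])
    then show "set_integrable lborel (box a b) ?v" by (rule set_integrable_subset) (auto simp: box_subset_cbox)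
  qed
  also have "\<dots> = integral (cbox a b) ?v" by (rule integral_open_interval)
  finally show ?thesis unfolding energy_def P_def G_def \<zeta>_def by simp
qed

text \<open>The closure lies in the image of the closed box, which is compact and, as
  \<open>M\<close> is Hausdorff, closed; connectedness comes from convexity of the box.\<close>

lemma box_chart_relatively_compact:
  fixes M :: "('a, 'm::finite) riemannian"
  assumes M: "oriented_riemannian_manifold M" and c: "c \<in> charts M" and ab: "cbox a b \<subseteq> chart_image c"
  shows "relatively_compact_domain (mtop M) {p \<in> fst c. snd c p \<in> box a b}"
proof -
  note isc = charts_is_chart[OF M c]
  have H: "Hausdorff_space (mtop M)" using M by (simp add: oriented_riemannian_manifold_def)
  have ab': "box a b \<subseteq> chart_image c" using ab box_subset_cbox by blast
  have eq: "{p \<in> fst c. snd c p \<in> box a b} = chart_inv c ` box a b" by (rule chart_inv_image[OF isc ab', symmetric])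
  have "connectedin (top_of_set (chart_image c)) (box a b)"
    using ab' convex_connected[OF convex_box(2)] by (simp add: connectedin_subtopology)
  then have con: "connectedin (mtop M) (chart_inv c ` box a b)"
    by (rule connectedin_continuous_map_image[OF chart_inv_continuous[OF isc]])
  have "compactin (top_of_set (chart_image c)) (cbox a b)" using ab by (simp add: compactin_subtopology)
  then have K: "compactin (mtop M) (chart_inv c ` cbox a b)"
    by (rule image_compactin[OF _ chart_inv_continuous[OF isc]])
  then have Kc: "closedin (mtop M) (chart_inv c ` cbox a b)" using H compactin_imp_closedin by blast
  have "mtop M closure_of (chart_inv c ` box a b) \<subseteq> chart_inv c ` cbox a b"
    by (rule closure_of_minimal[OF _ Kc]) (use box_subset_cbox in blast)
  then have "compactin (mtop M) (mtop M closure_of (chart_inv c ` box a b))"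
    by (rule closed_compactin[OF K]) simp
  then show ?thesis
    unfolding relatively_compact_domain_def eq using con chart_preimage_open[OF isc open_box, of a b] eq by simp
qed

text \<open>Small deformations in direction e_k inside a box around \<open>x0\<close> are admissible
  variations. Their energy over the box is half the integral of \<open>varied_density\<close>, so
  harmonicity supplies the hypothesis of \<open>stationary_imp_divergence_free\<close>.\<close>

lemma harmonic_divergence_free:
  fixes M :: "('a, 2) riemannian" and N :: "('b, 2) riemannian"
  assumes M: "oriented_riemannian_surface M" and N: "oriented_riemannian_surface N" and f: "harmonic_map M N f"
    and c: "isothermal_chart M c" and d: "d \<in> charts N" and x0: "x0 \<in> local_dom c d f"
  defines "P \<equiv> pullback (metric N d) (local_rep c d f)"
  shows "(\<Sum>i\<in>UNIV. partial i (\<lambda>x. P x $ i $ k) x0) = (\<Sum>i\<in>UNIV. partial k (\<lambda>x. P x $ i $ i) x0) / 2"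
proof -
  obtain \<mu> where sf: "smooth_map M N f" and \<mu>: "is_volume_measure M \<mu>"
    and stat: "\<And>\<Omega> \<epsilon> F. relatively_compact_domain (mtop M) \<Omega> \<Longrightarrow> smooth_variation M N f \<Omega> \<epsilon> F \<Longrightarrow>
       ((\<lambda>t. energy M N \<mu> \<Omega> (F t)) has_real_derivative 0) (at 0)"
    using f unfolding harmonic_map_def by blast
  have cM: "c \<in> charts M" using c by (simp add: isothermal_chart_def)
  note isc = charts_is_chart[OF M cM]
  note set = chart_jacobian_setting[OF M N sf cM d]
  have VG: "metric_on (chart_image d) (metric N d)" by (rule metric_on_chart[OF N d])
  obtain a b where ab: "cbox a b \<subseteq> local_dom c d f" "x0 \<in> box a b"
    using open_contains_cbox[OF set(1) x0] by metis
  have abc: "cbox a b \<subseteq> chart_image c" "box a b \<subseteq> chart_image c"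
    using ab(1) box_subset_cbox[of a b] by (auto simp: local_dom_iff[OF isc])
  show ?thesis
  proof (rule stationary_imp_divergence_free[OF set(1) _ ab])
    show "smooth_on (local_dom c d f) (\<lambda>x. P x $ i $ j)" for i j
      unfolding P_def by (rule smooth_on_pullback[OF VG set])
    fix \<delta> :: real and \<eta> :: "real ^ 2 \<Rightarrow> real" assume \<delta>: "0 < \<delta>" "cball x0 (2 * \<delta>) \<subseteq> box a b" and \<eta>: "smooth_on UNIV \<eta>" "\<And>x. (\<eta> x \<noteq> 0) = (dist x0 x < \<delta>)"
    have supp: "dist x0 x < \<delta>" if "\<eta> x \<noteq> 0" for x using that \<eta>(2) by blast
    have ne: "norm (axis k 1 :: real ^ 2) = 1" by (simp add: norm_axis_1)
    obtain \<epsilon> where eps: "0 < \<epsilon>" "\<And>t x. \<bar>t\<bar> < \<epsilon> \<Longrightarrow> \<eta> x \<noteq> 0 \<Longrightarrow> dist x0 (x + (t * \<eta> x) *\<^sub>R axis k 1) < 2 * \<delta>"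
      using bump_translate_in[OF smooth_on_imp_continuous_on[OF \<eta>(1)] supp \<delta>(1) ne] by blast
    have sub: "cball x0 \<delta> \<subseteq> box a b" using \<delta> by auto
    have stay: "x + (t * \<eta> x) *\<^sub>R axis k 1 \<in> box a b" if "\<bar>t\<bar> < \<epsilon>" "x \<in> box a b" for t x
    proof (cases "\<eta> x = 0")
      case False
      then show ?thesis using eps(2)[OF that(1) False] \<delta>(2) by (auto simp: less_imp_le)
    qed (use that in simp)
    let ?F = "chart_variation c \<eta> (axis k 1) (box a b) f" and ?\<Omega> = "{p \<in> fst c. snd c p \<in> box a b}"
    have var: "smooth_variation M N f ?\<Omega> \<epsilon> ?F"
      by (rule chart_variation_smooth[OF M N sf cM open_box abc(2) \<eta>(1) _ compact_cball sub eps(1) stay])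
        (use supp in \<open>auto simp: less_imp_le\<close>)
    have D: "((\<lambda>t. energy M N \<mu> ?\<Omega> (?F t)) has_real_derivative 0) (at 0)"
      by (rule stat[OF box_chart_relatively_compact[OF M cM abc(1)] var])
    have en: "energy M N \<mu> ?\<Omega> (?F t) = 1 / 2 * integral (cbox a b) (varied_density P \<eta> k t)" if t: "\<bar>t\<bar> < \<epsilon>" for t
      unfolding P_def
    proof (rule energy_chart_variation[OF M N sf \<mu> c d ab(1) \<eta>(1) _ stay[OF t]])
      show "x \<in> box a b" if "\<eta> x \<noteq> 0" for x using supp[OF that] sub by (auto simp: less_imp_le)
      have "continuous_map (prod_topology (top_of_set {-\<epsilon><..<\<epsilon>}) (mtop M)) (mtop N) (\<lambda>(t, p). ?F t p)"
        using var by (simp add: smooth_variation_def smooth_map_def cylinder_def)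
      moreover have "continuous_map (mtop M) (prod_topology (top_of_set {-\<epsilon><..<\<epsilon>}) (mtop M)) (\<lambda>p. (t, p))"
        using t by (intro continuous_map_pairedI) (auto simp: continuous_map_in_subtopology)
      ultimately have "continuous_map (mtop M) (mtop N) ((\<lambda>(t, p). ?F t p) \<circ> (\<lambda>p. (t, p)))"
        using continuous_map_compose by blast
      then show "continuous_map (mtop M) (mtop N) (?F t)" by (simp add: o_def)
    qed
    have "((\<lambda>t. 1 / 2 * integral (cbox a b) (varied_density P \<eta> k t)) has_real_derivative 0) (at 0)"
      by (rule has_field_derivative_transform_within_open[OF D, where S = "{-\<epsilon><..<\<epsilon>}"]) (use eps(1) en in auto)
    from DERIV_cmult[OF this, of 2]
    show "((\<lambda>t. integral (cbox a b) (varied_density P \<eta> k t)) has_real_derivative 0) (at 0)" by simp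
  qed
qed

section \<open>The distortion of a harmonic local diffeomorphism\<close>

definition complex_to_vec :: "complex \<Rightarrow> real ^ 2" where
  "complex_to_vec z = vector [Re z, Im z]"

lemma vec_complex_inverse [simp]:
  "complex_to_vec (vec_to_complex v) = v" "vec_to_complex (complex_to_vec z) = z"
  by (simp_all add: complex_to_vec_def vec_to_complex_def vec_eq_iff forall_2 complex_eq_iff)

lemma bounded_linear_complex_to_vec: "bounded_linear complex_to_vec"
proof -
  have "linear complex_to_vec" by (rule linearI) (simp_all add: complex_to_vec_def vec_eq_iff forall_2)
  then show ?thesis by (simp add: linear_conv_bounded_linear)
qed

lemma charts_underlying_curve:
  "charts (underlying_curve M) = {(fst c, vec_to_complex \<circ> snd c) |c. isothermal_chart M c}"
  by (auto simp: underlying_curve_def isothermal_chart_def)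

lemma mtop_underlying_curve [simp]: "mtop (underlying_curve M) = mtop M"
  by (simp add: underlying_curve_def)

lemma dilatation_cong: "trace S = trace T \<Longrightarrow> det S = det T \<Longrightarrow> dilatation S = dilatation T"
  by (simp add: dilatation_def)

text \<open>Built from \<open>strain\<close> rather than from the pullback matrix because
  \<open>chart_at M p\<close> may fail to be isothermal. As \<open>dilatation\<close> sees only
  trace and determinant, the value does not depend on the charts.\<close>

definition distortion :: "('a, 2) riemannian \<Rightarrow> ('b, 2) riemannian \<Rightarrow> ('a \<Rightarrow> 'b) \<Rightarrow> 'a \<Rightarrow> real" where
  "distortion M N f p = dilatation (strain M N (chart_at M p) (chart_at N (f p)) f p)"

text \<open>Smoothness is recorded in isothermal charts of \<open>M\<close> because these are the
  charts of \<open>underlying_curve M\<close>, relative to which the local diffeomorphism is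
  given.\<close>

definition local_inverse_on ::
    "('a, 2) riemannian \<Rightarrow> ('b, 2) riemannian \<Rightarrow> ('a \<Rightarrow> 'b) \<Rightarrow> 'a set \<Rightarrow> 'b set \<Rightarrow> ('b \<Rightarrow> 'a) \<Rightarrow> bool" where
  "local_inverse_on M N f W V g \<longleftrightarrow> openin (mtop M) W \<and> openin (mtop N) V \<and>
    (\<forall>q\<in>W. f q \<in> V \<and> g (f q) = q) \<and> (\<forall>q\<in>V. g q \<in> W \<and> f (g q) = q) \<and>
    continuous_map (subtopology (mtop N) V) (mtop M) g \<and>
    (\<forall>c d. isothermal_chart M c \<longrightarrow> d \<in> charts N \<longrightarrow>
       smooth_on (snd d ` (fst d \<inter> V \<inter> g -` (fst c \<inter> W))) (\<lambda>y. snd c (g (chart_inv d y))))"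

text \<open>The charts of the curve are complex valued; composing with \<open>complex_to_vec\<close>
  returns the smoothness of the inverse to the real charts of \<open>M\<close>.\<close>

lemma local_diffeomorphism_inverse:
  fixes M :: "('a, 2) riemannian" and N :: "('b, 2) riemannian" and f :: "'a \<Rightarrow> 'b"
  assumes M: "oriented_riemannian_surface M" and N: "oriented_riemannian_surface N"
    and ld: "local_diffeomorphism (underlying_curve M) N f" and p: "p \<in> topspace (mtop M)"
  shows "\<exists>W V g. p \<in> W \<and> local_inverse_on M N f W V g"
proof -
  obtain W V where W: "openin (mtop M) W" "p \<in> W" and V: "openin (mtop N) V"
    and diff: "diffeomorphism (open_part (underlying_curve M) W) (open_part N V) f"
    using ld p unfolding local_diffeomorphism_def by auto
  let ?A = "open_part (underlying_curve M) W" and ?B = "open_part N V"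
  have tA: "mtop ?A = subtopology (mtop M) W" and tB: "mtop ?B = subtopology (mtop N) V"
    by (simp_all add: open_part_def)
  have tsA: "topspace (mtop ?A) = W" and tsB: "topspace (mtop ?B) = V"
    using openin_subset[OF W(1)] openin_subset[OF V] unfolding tA tB by auto
  obtain g where f: "smooth_map ?A ?B f" and g: "smooth_map ?B ?A g"
    and gf: "\<And>q. q \<in> W \<Longrightarrow> g (f q) = q" and fg: "\<And>q. q \<in> V \<Longrightarrow> f (g q) = q"
    using diff unfolding diffeomorphism_def tsA tsB by blast
  have cf: "continuous_map (mtop ?A) (mtop ?B) f" and cg: "continuous_map (mtop ?B) (mtop ?A) g"
    using f g by (auto simp: smooth_map_def)
  have fV: "f q \<in> V" if "q \<in> W" for q
    using continuous_map_image_subset_topspace[OF cf] that unfolding tsA tsB by blast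
  have gW: "g q \<in> W" if "q \<in> V" for q
    using continuous_map_image_subset_topspace[OF cg] that unfolding tsA tsB by blast
  have cg': "continuous_map (subtopology (mtop N) V) (mtop M) g"
    using cg unfolding tA tB by (simp add: continuous_map_in_subtopology)
  have sm: "smooth_on (snd d ` (fst d \<inter> V \<inter> g -` (fst c \<inter> W))) (\<lambda>y. snd c (g (chart_inv d y)))"
    if c: "isothermal_chart M c" and d: "d \<in> charts N" for c d
  proof -
    note isd = charts_is_chart[OF N d]
    let ?c = "(fst c \<inter> W, vec_to_complex \<circ> snd c)" and ?d = "(fst d \<inter> V, snd d)"
    let ?D = "snd d ` (fst d \<inter> V \<inter> g -` (fst c \<inter> W))"
    have isc: "is_chart (mtop M) c" using charts_is_chart[OF M] c by (simp add: isothermal_chart_def)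
    have "(fst c, vec_to_complex \<circ> snd c) \<in> charts (underlying_curve M)"
      using c by (auto simp: charts_underlying_curve)
    then have "?c \<in> charts ?A" by (auto simp: open_part_def intro!: exI[of _ "fst c"] exI[of _ "vec_to_complex \<circ> snd c"])
    moreover have "?d \<in> charts ?B" using d by (auto simp: open_part_def intro!: exI[of _ "fst d"] exI[of _ "snd d"])
    ultimately have "smooth_on (local_dom ?d ?c g) (local_rep ?d ?c g)"
      using g unfolding smooth_map_def by blast
    moreover have "local_dom ?d ?c g = ?D" by (auto simp: local_dom_def)
    ultimately have s: "smooth_on ?D (local_rep ?d ?c g)" by simp
    have "openin (mtop N) {q \<in> topspace (subtopology (mtop N) V). g q \<in> fst c \<inter> W}"
      using openin_continuous_map_preimage[OF cg' openin_Int[OF chart_open(1)[OF isc] W(1)]] V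
      by (simp add: openin_open_subtopology)
    then have "openin (mtop N) (fst d \<inter> {q \<in> topspace (subtopology (mtop N) V). g q \<in> fst c \<inter> W})"
      by (rule openin_Int[OF chart_open(1)[OF isd]])
    moreover have "fst d \<inter> {q \<in> topspace (subtopology (mtop N) V). g q \<in> fst c \<inter> W} = fst d \<inter> V \<inter> g -` (fst c \<inter> W)"
      using openin_subset[OF V] by auto
    ultimately have oD: "open ?D" by (intro chart_image_open[OF isd]) auto
    have "smooth_on ?D (\<lambda>y. complex_to_vec (local_rep ?d ?c g y))"
      by (rule smooth_on_linear_compose[OF bounded_linear_complex_to_vec oD s])
    then show ?thesis
    proof (rule smooth_on_cong[OF oD, rotated])
      fix y assume "y \<in> ?D"
      then obtain q where q: "q \<in> fst d \<inter> V" "y = snd d q" by auto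
      have "chart_inv ?d y = q"
        using q inj_on_subset[OF chart_inj[OF isd], of "fst d \<inter> V"] by (simp add: chart_inv_def inv_into_f_f)
      moreover have "chart_inv d y = q" using q chart_inv_left[OF isd] by auto
      ultimately show "complex_to_vec (local_rep ?d ?c g y) = snd c (g (chart_inv d y))"
        by (simp add: local_rep_apply)
    qed
  qed
  have "local_inverse_on M N f W V g"
    unfolding local_inverse_on_def using W(1) V fV gW gf fg cg' sm by blast
  then show ?thesis using W(2) by blast
qed

context
  fixes M :: "('a, 2) riemannian" and N :: "('b, 2) riemannian" and f :: "'a \<Rightarrow> 'b"
  assumes M: "oriented_riemannian_surface M" and N: "oriented_riemannian_surface N"
    and harm: "harmonic_map M N f" and ld: "local_diffeomorphism (underlying_curve M) N f"
    and cover: "\<forall>p\<in>topspace (mtop M). \<exists>c. isothermal_chart M c \<and> p \<in> fst c"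
begin

lemma harm_smooth: "smooth_map M N f"
  using harm by (auto simp: harmonic_map_def)

lemma harm_continuous: "continuous_map (mtop M) (mtop N) f"
  using harm_smooth by (auto simp: smooth_map_def)

lemma isothermal_is_chart: "isothermal_chart M c \<Longrightarrow> c \<in> charts M \<and> is_chart (mtop M) c"
  using charts_is_chart[OF M] by (auto simp: isothermal_chart_def)

lemma image_in_N: "p \<in> topspace (mtop M) \<Longrightarrow> f p \<in> topspace (mtop N)"
  using continuous_map_image_subset_topspace[OF harm_continuous] by blast

lemma local_rep_differentiable:
  "c \<in> charts M \<Longrightarrow> d \<in> charts N \<Longrightarrow> p \<in> fst c \<Longrightarrow> f p \<in> fst d \<Longrightarrow> local_rep c d f differentiable (at (snd c p))"
  using chart_jacobian_setting(2)[OF M N harm_smooth] by (blast intro: smooth_on_differentiable local_dom_memI)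

text \<open>Differentiating g o f = id in charts exhibits a left inverse of the Jacobian
  matrix.\<close>

lemma isothermal_jacobian_nonzero:
  assumes c: "isothermal_chart M c" and d: "d \<in> charts N" and x: "x \<in> local_dom c d f"
  shows "det (jacobian (local_rep c d f) (at x)) \<noteq> 0"
proof -
  have cM: "c \<in> charts M" and isc: "is_chart (mtop M) c" using isothermal_is_chart[OF c] by auto
  note isd = charts_is_chart[OF N d]
  define p where "p = chart_inv c x"
  have xc: "x \<in> chart_image c" "f p \<in> fst d" using x by (auto simp: local_dom_iff[OF isc] p_def)
  have p: "p \<in> fst c" "snd c p = x" "p \<in> topspace (mtop M)"
    using chart_inv_in[OF isc xc(1)] chart_inv_right[OF isc xc(1)] chart_subset[OF isc] by (auto simp: p_def)
  obtain W V g where pW: "p \<in> W" and inv: "local_inverse_on M N f W V g"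
    using local_diffeomorphism_inverse[OF M N ld p(3)] by blast
  have W: "openin (mtop M) W" "openin (mtop N) V" "p \<in> W"
    and gf: "\<And>q. q \<in> W \<Longrightarrow> f q \<in> V \<and> g (f q) = q"
    and sm: "smooth_on (snd d ` (fst d \<inter> V \<inter> g -` (fst c \<inter> W))) (\<lambda>y. snd c (g (chart_inv d y)))"
    using inv pW c d unfolding local_inverse_on_def by blast+
  define S where "S = local_dom c d f \<inter> snd c ` (fst c \<inter> W)"
  have oS: "open S" unfolding S_def
    by (intro open_Int local_dom_open[OF isc isd harm_continuous] chart_image_open[OF isc] openin_Int chart_open(1)[OF isc] W) auto
  have xS: "x \<in> S" using x p W by (auto simp: S_def)
  let ?h = "\<lambda>y. snd c (g (chart_inv d y))"
  have eq: "x' = ?h (local_rep c d f x')" if "x' \<in> S" for x'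
    using that chart_inv_left[OF isc] chart_inv_left[OF isd] gf by (auto simp: S_def local_rep_apply local_dom_iff[OF isc])
  have d1: "local_rep c d f differentiable (at x)"
    using local_rep_differentiable[OF cM d p(1) xc(2)] p(2) by simp
  have "local_rep c d f x = snd d (f p)" by (simp add: local_rep_apply p_def)
  then have "local_rep c d f x \<in> snd d ` (fst d \<inter> V \<inter> g -` (fst c \<inter> W))"
    using xc p W gf by auto
  then have d2: "?h differentiable (at (local_rep c d f x))" by (rule smooth_on_differentiable[OF sm])
  have "jacobian (\<lambda>x. x) (at x) = jacobian (\<lambda>x. ?h (local_rep c d f x)) (at x)"
    by (rule jacobian_cong(1)[OF oS xS eq differentiable_ident])
  also have "\<dots> = jacobian ?h (at (local_rep c d f x)) ** jacobian (local_rep c d f) (at x)"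
    by (rule jacobian_compose(1)[OF d1 d2])
  finally have "mat 1 = jacobian ?h (at (local_rep c d f x)) ** jacobian (local_rep c d f) (at x)"
    by (simp add: jacobian_def matrix_id_mat_1[unfolded id_def] id_def)
  then have "det (jacobian ?h (at (local_rep c d f x))) * det (jacobian (local_rep c d f) (at x)) = 1"
    by (metis det_I det_mul)
  then show ?thesis by auto
qed

text \<open>Similarity moves \<open>strain\<close> to the given charts; in an isothermal chart it is
  a positive multiple of the pullback, and \<open>dilatation\<close> ignores the factor.\<close>

lemma distortion_eq:
  assumes c: "isothermal_chart M c" and d: "d \<in> charts N" and p: "p \<in> fst c" "f p \<in> fst d"
  shows "distortion M N f p = dilatation (pullback (metric N d) (local_rep c d f) (snd c p))"
proof -
  have cM: "c \<in> charts M" and isc: "is_chart (mtop M) c" using isothermal_is_chart[OF c] by auto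
  have pM: "p \<in> topspace (mtop M)" using chart_subset[OF isc] p by auto
  note ca = chart_at_in[OF M pM] and da = chart_at_in[OF N image_in_N[OF pM]]
  obtain A where A: "invertible A" "strain M N (chart_at M p) (chart_at N (f p)) f p = matrix_inv A ** strain M N c d f p ** A"
    by (rule strain_similar[OF M N harm_continuous ca(1) cM ca(2) p(1) da(1) d da(2) p(2) local_rep_differentiable[OF cM d p]])
  have "distortion M N f p = dilatation (strain M N c d f p)"
    unfolding distortion_def A(2) by (rule dilatation_cong; rule similar_trace_det[OF A(1)])
  also have "\<dots> = dilatation (pullback (metric N d) (local_rep c d f) (snd c p))"
    unfolding strain_isothermal[OF M c p(1)]
    by (rule dilatation_scale) (use isothermal_metric(2)[OF M c chart_in_image[OF isc p(1)]] in simp)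
  finally show ?thesis .
qed

text \<open>Makes the local theory applicable to a pair of charts: the first five facts are the
  hypotheses of the lemmas on \<open>dilatation\<close>, the sixth is the vanishing of the tension
  field.\<close>

lemma distortion_setting:
  assumes c: "isothermal_chart M c" and d: "d \<in> charts N"
  shows "metric_on (chart_image d) (metric N d)" "open (local_dom c d f)"
    "smooth_on (local_dom c d f) (local_rep c d f)" "local_rep c d f ` local_dom c d f \<subseteq> chart_image d"
    "\<And>x. x \<in> local_dom c d f \<Longrightarrow> det (jacobian (local_rep c d f) (at x)) \<noteq> 0"
    "\<And>x. x \<in> local_dom c d f \<Longrightarrow> second_form (metric N d) (local_rep c d f) 1 1 x + second_form (metric N d) (local_rep c d f) 2 2 x = 0"
proof -
  have cM: "c \<in> charts M" using isothermal_is_chart[OF c] by auto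
  show VG: "metric_on (chart_image d) (metric N d)" by (rule metric_on_chart[OF N d])
  note set = chart_jacobian_setting[OF M N harm_smooth cM d]
  show "open (local_dom c d f)" "smooth_on (local_dom c d f) (local_rep c d f)" "local_rep c d f ` local_dom c d f \<subseteq> chart_image d"
    by (fact set)+
  show J: "det (jacobian (local_rep c d f) (at x)) \<noteq> 0" if "x \<in> local_dom c d f" for x
    by (rule isothermal_jacobian_nonzero[OF c d that])
  show "second_form (metric N d) (local_rep c d f) 1 1 x + second_form (metric N d) (local_rep c d f) 2 2 x = 0"
    if x: "x \<in> local_dom c d f" for x
    by (rule tension_vanishes[OF VG set x J[OF x] harmonic_divergence_free[OF M N harm c d x]])
qed

lemma distortion_bounds:
  assumes p: "p \<in> topspace (mtop M)" shows "0 \<le> distortion M N f p" "distortion M N f p < 1"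
proof -
  obtain c where c: "isothermal_chart M c" "p \<in> fst c" using cover p by blast
  note da = chart_at_in[OF N image_in_N[OF p]]
  note set = distortion_setting[OF c(1) da(1)]
  note b = dilatation_bounds[OF set(1-5) local_dom_memI[of p c f, OF c(2) da(2)]]
  show "0 \<le> distortion M N f p" "distortion M N f p < 1"
    using b unfolding distortion_eq[OF c(1) da(1) c(2) da(2)] by auto
qed

lemma distortion_sublevel_open: "openin (mtop M) {p \<in> topspace (mtop M). distortion M N f p < e}"
proof (subst openin_subopen, intro ballI)
  fix p assume "p \<in> {p \<in> topspace (mtop M). distortion M N f p < e}"
  then have p: "p \<in> topspace (mtop M)" "distortion M N f p < e" by auto
  obtain c where c: "isothermal_chart M c" "p \<in> fst c" using cover p(1) by blast
  have isc: "is_chart (mtop M) c" using isothermal_is_chart[OF c(1)] by auto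
  define d where "d = chart_at N (f p)"
  have d: "d \<in> charts N" "f p \<in> fst d" using chart_at_in[OF N image_in_N[OF p(1)]] by (auto simp: d_def)
  note set = distortion_setting[OF c(1) d(1)]
  define D where "D = local_dom c d f \<inter> (\<lambda>x. dilatation (pullback (metric N d) (local_rep c d f) x)) -` {..<e}"
  have "open D" unfolding D_def
    by (rule continuous_open_preimage[OF continuous_on_dilatation[OF set(1-5)] set(2)]) auto
  then have "openin (mtop M) {q \<in> fst c. snd c q \<in> D}" by (rule chart_preimage_open[OF isc])
  moreover have eq: "distortion M N f q = dilatation (pullback (metric N d) (local_rep c d f) (snd c q))"
    if "q \<in> fst c" "snd c q \<in> local_dom c d f" for q
    by (rule distortion_eq[OF c(1) d(1) that(1)]) (use that chart_inv_left[OF isc that(1)] in \<open>auto simp: local_dom_iff[OF isc]\<close>)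
  moreover have "p \<in> {q \<in> fst c. snd c q \<in> D}"
    using eq[OF c(2) local_dom_memI[of p c f, OF c(2) d(2)]] p c d by (auto simp: D_def intro!: local_dom_memI)
  ultimately show "\<exists>T. openin (mtop M) T \<and> p \<in> T \<and> T \<subseteq> {p \<in> topspace (mtop M). distortion M N f p < e}"
    using chart_subset[OF isc] by (intro exI[of _ "{q \<in> fst c. snd c q \<in> D}"]) (auto simp: D_def)
qed

end

section \<open>Maximum principle and subharmonicity\<close>

lemma second_derivative_at_max:
  fixes g :: "real \<Rightarrow> real"
  assumes "0 < \<delta>" and g: "\<And>t. \<bar>t\<bar> < \<delta> \<Longrightarrow> (g has_real_derivative g' t) (at t)"
    and g': "(g' has_real_derivative D) (at 0)" and max: "\<And>t. \<bar>t\<bar> < \<delta> \<Longrightarrow> g t \<le> g 0"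
  shows "D \<le> 0"
proof (rule ccontr)
  assume "\<not> D \<le> 0"
  \<comment> \<open>With a positive second derivative, \<open>g'\<close> would be positive just to
    the right of its zero at 0, and g would exceed its maximum.\<close>
  then obtain e where e: "0 < e" "\<And>h. 0 < h \<Longrightarrow> h < e \<Longrightarrow> g' 0 < g' (0 + h)"
    using DERIV_pos_inc_right[OF g'] by auto
  have g0: "g' 0 = 0"
    by (rule DERIV_local_max[OF g \<open>0 < \<delta>\<close>]) (use max \<open>0 < \<delta>\<close> in auto)
  define t where "t = min \<delta> e / 2"
  have t: "0 < t" "t < \<delta>" "t < e" using \<open>0 < \<delta>\<close> e(1) by (auto simp: t_def)
  have "\<exists>\<xi>. 0 < \<xi> \<and> \<xi> < t \<and> g t - g 0 = (t - 0) * g' \<xi>"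
    by (rule MVT2[OF t(1)]) (use g t in auto)
  then obtain \<xi> where xi: "0 < \<xi>" "\<xi> < t" "g t - g 0 = t * g' \<xi>" by auto
  have "0 < g' \<xi>" using e(2)[of \<xi>] xi t g0 by simp
  then have "g 0 < g t" using xi t by (simp add: algebra_simps)
  then show False using max[of t] t by simp
qed

lemma line_derivative:
  fixes f :: "'a::real_normed_vector \<Rightarrow> real"
  assumes "f differentiable (at (x + t *\<^sub>R v))"
  shows "((\<lambda>t. f (x + t *\<^sub>R v)) has_real_derivative frechet_derivative f (at (x + t *\<^sub>R v)) v) (at t)"
proof -
  have "((\<lambda>t. x + t *\<^sub>R v) has_derivative (\<lambda>s. s *\<^sub>R v)) (at t)"
    by (auto intro!: derivative_eq_intros)
  from has_derivative_compose[OF this differentiable_has_derivative[OF assms]] show ?thesis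
    using linear_cmul[OF linear_frechet_derivative[OF assms]]
    by (simp add: has_field_derivative_def mult_commute_abs)
qed

lemma line_stays_in_open:
  fixes x v :: "'a::real_normed_vector"
  assumes "open S" "x \<in> S" "norm v = 1"
  obtains \<delta> where "0 < \<delta>" "\<And>t. \<bar>t\<bar> < \<delta> \<Longrightarrow> x + t *\<^sub>R v \<in> S"
proof -
  obtain \<delta> where "0 < \<delta>" "ball x \<delta> \<subseteq> S" using assms open_contains_ball by blast
  then show ?thesis using assms(3) by (intro that[of \<delta>]) (auto simp: dist_norm subset_eq)
qed

text \<open>Strict comparison: at an interior maximum of \<open>f - h + \<epsilon> |w - z|\<^sup>2\<close> the Laplacian would be
  positive.\<close>

lemma no_interior_max:
  fixes F :: "real ^ 2 \<Rightarrow> real" and h :: "complex \<Rightarrow> real"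
  assumes W: "open W" "smooth_on W F" "complex_to_vec w \<in> W" and B: "open B" "w \<in> B" "Ck_on 2 B h"
    and lapF: "0 \<le> partial 1 (partial 1 F) (complex_to_vec w) + partial 2 (partial 2 F) (complex_to_vec w)"
    and laph: "laplacian h w = 0" and "0 < \<epsilon>"
    and max: "\<And>v. v \<in> B \<Longrightarrow> complex_to_vec v \<in> W \<Longrightarrow>
       F (complex_to_vec v) - h v + \<epsilon> * (norm (v - z))\<^sup>2 \<le> F (complex_to_vec w) - h w + \<epsilon> * (norm (w - z))\<^sup>2"
  shows False
proof -
  let ?x = "complex_to_vec w"
  let ?h = "\<lambda>b w. frechet_derivative h (at w) b"
  \<comment> \<open>The second derivative test is applied on the line through \<open>w\<close> in
    each coordinate direction, where the quadratic term contributes 2 \<epsilon>. Adding the two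
    directions gives that the Laplacian of F - h plus 4 \<epsilon> is at most 0.\<close>
  have dir: "partial i (partial i F) ?x - frechet_derivative (?h b) (at w) b + 2 * \<epsilon> \<le> 0"
    if ib: "complex_to_vec b = axis i 1" "norm b = 1" for i b
  proof -
    have na: "norm (axis i 1 :: real ^ 2) = 1" by (simp add: norm_axis_1)
    obtain d1 where d1: "0 < d1" "\<And>t. \<bar>t\<bar> < d1 \<Longrightarrow> ?x + t *\<^sub>R axis i 1 \<in> W"
      by (rule line_stays_in_open[OF W(1,3) na]) blast
    obtain d2 where d2: "0 < d2" "\<And>t. \<bar>t\<bar> < d2 \<Longrightarrow> w + t *\<^sub>R b \<in> B"
      by (rule line_stays_in_open[OF B(1,2) ib(2)]) blast
    have cv: "complex_to_vec (w + t *\<^sub>R b) = ?x + t *\<^sub>R axis i 1" for t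
      using bounded_linear_complex_to_vec ib(1)
      by (simp add: linear_add linear_cmul bounded_linear.linear)
    let ?q = "\<lambda>t. (w - z + t *\<^sub>R b) \<bullet> (w - z + t *\<^sub>R b)"
    let ?g = "\<lambda>t. F (?x + t *\<^sub>R axis i 1) - h (w + t *\<^sub>R b) + \<epsilon> * ?q t"
    let ?g' = "\<lambda>t. partial i F (?x + t *\<^sub>R axis i 1) - ?h b (w + t *\<^sub>R b) + \<epsilon> * (2 * ((w - z + t *\<^sub>R b) \<bullet> b))"
    have hB: "h differentiable (at y)" "?h b differentiable (at y)" if "y \<in> B" for y
      using B(3) that by (auto simp: numeral_2_eq_2)
    have dq: "(?q has_real_derivative 2 * ((w - z + t *\<^sub>R b) \<bullet> b)) (at t)" for t
      unfolding has_field_derivative_def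
      by (rule has_derivative_eq_rhs, (rule derivative_intros)+) (auto simp: fun_eq_iff inner_commute algebra_simps)
    have dq': "((\<lambda>t. 2 * ((w - z + t *\<^sub>R b) \<bullet> b)) has_real_derivative 2) (at t)" for t
      unfolding has_field_derivative_def
      by (rule has_derivative_eq_rhs, (rule derivative_intros)+) (use ib(2) in \<open>auto simp: fun_eq_iff dot_square_norm\<close>)
    have "partial i (partial i F) ?x - frechet_derivative (?h b) (at w) b + \<epsilon> * 2 \<le> 0"
    proof (rule second_derivative_at_max[of "min d1 d2" ?g ?g'])
      show "0 < min d1 d2" using d1 d2 by simp
      show "(?g has_real_derivative ?g' t) (at t)" if "\<bar>t\<bar> < min d1 d2" for t
        unfolding partial_def
        by (intro DERIV_add DERIV_diff DERIV_cmult line_derivative dq smooth_on_differentiable[OF W(2)] hB)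
          (use that d1(2)[of t] d2(2)[of t] in auto)
      have "((\<lambda>t. partial i F (?x + t *\<^sub>R axis i 1)) has_real_derivative partial i (partial i F) ?x) (at 0)"
        using line_derivative[of "partial i F" ?x 0 "axis i 1"] smooth_on_differentiable[OF smooth_on_partial[OF W(2)] W(3)]
        by (simp add: partial_def[of i "partial i F"])
      moreover have "((\<lambda>t. ?h b (w + t *\<^sub>R b)) has_real_derivative frechet_derivative (?h b) (at w) b) (at 0)"
        using line_derivative[of "?h b" w 0 b] hB(2)[OF B(2)] by simp
      ultimately show "(?g' has_real_derivative partial i (partial i F) ?x - frechet_derivative (?h b) (at w) b + \<epsilon> * 2) (at 0)"
        by (intro DERIV_add DERIV_diff DERIV_cmult dq')
      show "?g t \<le> ?g 0" if "\<bar>t\<bar> < min d1 d2" for t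
      proof -
        have "F (complex_to_vec (w + t *\<^sub>R b)) - h (w + t *\<^sub>R b) + \<epsilon> * (norm (w + t *\<^sub>R b - z))\<^sup>2
             \<le> F ?x - h w + \<epsilon> * (norm (w - z))\<^sup>2"
          by (rule max) (use that d1(2)[of t] d2(2)[of t] cv[of t] in auto)
        moreover have "w + t *\<^sub>R b - z = w - z + t *\<^sub>R b" by simp
        ultimately show ?thesis unfolding cv by (simp add: power2_norm_eq_inner)
      qed
    qed
    then show ?thesis by simp
  qed
  have b1: "complex_to_vec 1 = axis 1 1" "complex_to_vec \<i> = axis 2 1"
    by (auto simp: complex_to_vec_def vec_eq_iff forall_2 axis_def)
  have "laplacian h w = frechet_derivative (?h 1) (at w) 1 + frechet_derivative (?h \<i>) (at w) \<i>"
    by (simp add: laplacian_def Basis_complex_def)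
  then show False using dir[OF b1(1)] dir[OF b1(2)] lapF laph \<open>0 < \<epsilon>\<close> by simp
qed

definition ln_distortion :: "('a, 2) riemannian \<Rightarrow> ('b, 2) riemannian \<Rightarrow> ('a \<Rightarrow> 'b) \<Rightarrow> 'a \<Rightarrow> ereal" where
  "ln_distortion M N f p = (if distortion M N f p \<le> 0 then -\<infinity> else ereal (ln (distortion M N f p)))"

context
  fixes M :: "('a, 2) riemannian" and N :: "('b, 2) riemannian" and f :: "'a \<Rightarrow> 'b"
  assumes M: "oriented_riemannian_surface M" and N: "oriented_riemannian_surface N"
    and harm: "harmonic_map M N f" and ld: "local_diffeomorphism (underlying_curve M) N f"
    and cover: "\<forall>p\<in>topspace (mtop M). \<exists>c. isothermal_chart M c \<and> p \<in> fst c"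
begin

text \<open>\<open>J\<close> gathers the factor 4, the area density of the target and the absolute
  Jacobian; its positivity is what transfers the sign of the curvature.\<close>

lemma laplacian_ln_distortion:
  assumes c: "isothermal_chart M c" and p: "p \<in> fst c" and pos: "0 < distortion M N f p"
  defines "F \<equiv> \<lambda>x. ln (distortion M N f (chart_inv c x))"
  shows "\<exists>W J. open W \<and> snd c p \<in> W \<and> W \<subseteq> chart_image c \<and> smooth_on W F \<and> 0 < (J::real) \<and>
    (\<forall>x\<in>W. 0 < distortion M N f (chart_inv c x)) \<and>
    partial 1 (partial 1 F) (snd c p) + partial 2 (partial 2 F) (snd c p) = J * gauss_curvature N (f p)"
proof -
  have isc: "is_chart (mtop M) c" using isothermal_is_chart[OF M N harm ld cover c] by auto
  have pM: "p \<in> topspace (mtop M)" using chart_subset[OF isc] p by auto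
  \<comment> \<open>\<open>gauss_curvature\<close> is evaluated in \<open>chart_at\<close>; taking
    this very chart makes it coincide with \<open>metric_curvature\<close> at the point.\<close>
  define d where "d = chart_at N (f p)"
  have d: "d \<in> charts N" "f p \<in> fst d"
    using chart_at_in[OF N image_in_N[OF M N harm ld cover pM]] by (auto simp: d_def)
  let ?G = "metric N d" and ?\<zeta> = "local_rep c d f" and ?x = "snd c p"
  note set = distortion_setting[OF M N harm ld cover c d(1)]
  have x: "?x \<in> local_dom c d f" by (rule local_dom_memI[of p c f, OF p d(2)])
  have eq: "distortion M N f (chart_inv c y) = dilatation (pullback ?G ?\<zeta> y)" if "y \<in> local_dom c d f" for y
    using distortion_eq[OF M N harm ld cover c d(1), of "chart_inv c y"] that chart_inv_in[OF isc] chart_inv_right[OF isc]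
    by (auto simp: local_dom_iff[OF isc])
  have pos': "0 < dilatation (pullback ?G ?\<zeta> ?x)" using pos eq[OF x] chart_inv_left[OF isc p] by simp
  obtain W where W: "open W" "?x \<in> W" "W \<subseteq> local_dom c d f" "\<And>y. y \<in> W \<Longrightarrow> 0 < dilatation (pullback ?G ?\<zeta> y)"
    and sm: "smooth_on W (\<lambda>x. ln (dilatation (pullback ?G ?\<zeta> x)))"
    and lap: "partial 1 (partial 1 (\<lambda>x. ln (dilatation (pullback ?G ?\<zeta> x)))) ?x +
      partial 2 (partial 2 (\<lambda>x. ln (dilatation (pullback ?G ?\<zeta> x)))) ?x =
      4 * metric_curvature ?G (?\<zeta> ?x) * sqrt (det (?G (?\<zeta> ?x))) * \<bar>det (jacobian ?\<zeta> (at ?x))\<bar>"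
    using laplacian_ln_dilatation[OF set x pos'] by blast
  have eqF: "ln (dilatation (pullback ?G ?\<zeta> y)) = F y" if "y \<in> W" for y
    using eq[of y] W(3) that by (auto simp: F_def)
  have smF: "smooth_on W F" by (rule smooth_on_cong[OF W(1) eqF sm])
  have p1: "partial i (\<lambda>x. ln (dilatation (pullback ?G ?\<zeta> x))) y = partial i F y" if "y \<in> W" for i y
    by (rule partial_cong[OF W(1) that eqF smooth_on_differentiable[OF sm that]])
  have p2: "partial i (partial i (\<lambda>x. ln (dilatation (pullback ?G ?\<zeta> x)))) ?x = partial i (partial i F) ?x" for i
    by (rule partial_cong[OF W(1,2) p1 smooth_on_differentiable[OF smooth_on_partial[OF sm] W(2)]])
  have \<zeta>x: "?\<zeta> ?x = snd d (f p)" using chart_inv_left[OF isc p] by (simp add: local_rep_apply)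
  have K: "metric_curvature ?G (?\<zeta> ?x) = gauss_curvature N (f p)"
    unfolding \<zeta>x by (simp add: gauss_curvature_def metric_curvature_def Let_def d_def)
  define J where "J = 4 * sqrt (det (?G (?\<zeta> ?x))) * \<bar>det (jacobian ?\<zeta> (at ?x))\<bar>"
  have "0 < det (?G (?\<zeta> ?x))" by (rule metric_det_pos[OF set(1) subsetD[OF set(4) imageI[OF x]]])
  then have "0 < J" unfolding J_def using set(5)[OF x] by simp
  moreover have "partial 1 (partial 1 F) ?x + partial 2 (partial 2 F) ?x = J * gauss_curvature N (f p)"
    using lap unfolding p2 K J_def by simp
  moreover have "0 < distortion M N f (chart_inv c y)" if "y \<in> W" for y
    using W(4)[OF that] eq[of y] W(3) that by auto
  moreover have "W \<subseteq> chart_image c" using W(3) by (auto simp: local_dom_iff[OF isc])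
  ultimately show ?thesis using W(1,2) smF by blast
qed

lemma ln_distortion_less_ereal_iff: "ln_distortion M N f p < ereal a \<longleftrightarrow> distortion M N f p < exp a"
proof (cases "distortion M N f p \<le> 0")
  case True
  then show ?thesis by (auto simp: ln_distortion_def intro: le_less_trans)
next
  case False
  then have "ln (distortion M N f p) < a \<longleftrightarrow> distortion M N f p < exp a"
    by (metis exp_ln not_le exp_less_cancel_iff)
  then show ?thesis using False by (simp add: ln_distortion_def)
qed

lemma ln_distortion_negative: "p \<in> topspace (mtop M) \<Longrightarrow> ln_distortion M N f p < 0"
  using distortion_bounds(2)[OF M N harm ld cover, of p] ln_distortion_less_ereal_iff[of p 0] by (simp add: zero_ereal_def)

lemma continuous_on_distortion_chart:
  assumes c: "isothermal_chart M c"
  shows "continuous_on (chart_image c) (\<lambda>x. distortion M N f (chart_inv c x))"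
proof (rule Ck_on_local[where k = 0, unfolded Ck_on.simps])
  have isc: "is_chart (mtop M) c" using isothermal_is_chart[OF M N harm ld cover c] by auto
  fix x assume x: "x \<in> chart_image c"
  define d where "d = chart_at N (f (chart_inv c x))"
  have pM: "chart_inv c x \<in> topspace (mtop M)" using chart_subset[OF isc] chart_inv_in[OF isc x] by auto
  have d: "d \<in> charts N" "f (chart_inv c x) \<in> fst d"
    using chart_at_in[OF N image_in_N[OF M N harm ld cover pM]] by (auto simp: d_def)
  note set = distortion_setting[OF M N harm ld cover c d(1)]
  have "continuous_on (local_dom c d f) (\<lambda>x. distortion M N f (chart_inv c x))"
  proof (rule continuous_on_eq[OF continuous_on_dilatation[OF set(1-5)]])
    show "dilatation (pullback (metric N d) (local_rep c d f) y) = distortion M N f (chart_inv c y)" if "y \<in> local_dom c d f" for y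
      using distortion_eq[OF M N harm ld cover c d(1), of "chart_inv c y"] that chart_inv_in[OF isc] chart_inv_right[OF isc]
      by (auto simp: local_dom_iff[OF isc])
  qed
  then show "\<exists>A. open A \<and> x \<in> A \<and> continuous_on A (\<lambda>x. distortion M N f (chart_inv c x))"
    using set(2) x d(2) by (intro exI[of _ "local_dom c d f"]) (auto simp: local_dom_iff[OF isc])
qed

text \<open>If a harmonic h dominates on the circle but not at w, adding \<epsilon> (|v - z|^2 -
  r^2) for small \<epsilon> > 0 to the difference keeps it at most 0 on the circle and positive at
  w. It then has an interior maximum, which \<open>no_interior_max\<close> excludes as the curvature
  is non-negative.\<close>

lemma subharmonic_ln_distortion:
  assumes K: "\<And>q. q \<in> topspace (mtop N) \<Longrightarrow> 0 \<le> gauss_curvature N q"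
  shows "subharmonic (underlying_curve M) (ln_distortion M N f)"
  unfolding subharmonic_def mtop_underlying_curve
proof (intro conjI allI ballI impI)
  show "ln_distortion M N f p < \<infinity>" for p by (simp add: ln_distortion_def)
  show "openin (mtop M) {p \<in> topspace (mtop M). ln_distortion M N f p < a}" for a
  proof (cases a)
    case (real r)
    then show ?thesis using distortion_sublevel_open[OF M N harm ld cover] by (simp add: ln_distortion_less_ereal_iff)
  qed (simp_all add: ln_distortion_def)
next
  fix cc z r h w
  assume cc: "cc \<in> charts (underlying_curve M)"
    and H: "0 < r \<and> cball z r \<subseteq> chart_image cc \<and> continuous_on (cball z r) h \<and> harmonic_function_on (ball z r) h \<and>
        (\<forall>w\<in>sphere z r. ln_distortion M N f (chart_inv cc w) \<le> ereal (h w))"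
    and w1: "w \<in> ball z r"
  obtain c where c: "isothermal_chart M c" and ccd: "cc = (fst c, vec_to_complex \<circ> snd c)"
    using cc by (auto simp: charts_underlying_curve)
  have isc: "is_chart (mtop M) c" using isothermal_is_chart[OF M N harm ld cover c] by auto
  have im: "complex_to_vec w \<in> chart_image c \<and> chart_inv cc w = chart_inv c (complex_to_vec w)" if w: "w \<in> chart_image cc" for w
  proof -
    obtain p where p: "p \<in> fst c" "w = vec_to_complex (snd c p)" using w by (auto simp: ccd chart_image_def)
    have "inj_on (vec_to_complex \<circ> snd c) (fst c)"
      using chart_inj[OF isc] by (auto simp: inj_on_def) (metis vec_complex_inverse(1))
    then have "chart_inv cc w = p" using p inv_into_f_f[of "vec_to_complex \<circ> snd c" "fst c" p] by (simp add: chart_inv_def ccd)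
    then show ?thesis using p chart_inv_left[OF isc p(1)] by (simp add: chart_image_def)
  qed
  let ?m = "\<lambda>w. distortion M N f (chart_inv c (complex_to_vec w))"
  have H': "0 < r" "cball z r \<subseteq> chart_image cc" "continuous_on (cball z r) h" "Ck_on 2 (ball z r) h"
    "\<And>w. w \<in> ball z r \<Longrightarrow> laplacian h w = 0" "\<And>w. w \<in> sphere z r \<Longrightarrow> ln_distortion M N f (chart_inv cc w) \<le> ereal (h w)"
    using H by (auto simp: harmonic_function_on_def)
  have imc: "complex_to_vec w \<in> chart_image c" "chart_inv cc w = chart_inv c (complex_to_vec w)" if "w \<in> cball z r" for w
    using im[of w] H'(2) that by blast+
  have cm: "continuous_on (cball z r) ?m"
    by (rule continuous_on_compose2[OF continuous_on_distortion_chart[OF c] linear_continuous_on[OF bounded_linear_complex_to_vec]])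
      (use imc in auto)
  show "ln_distortion M N f (chart_inv cc w) \<le> ereal (h w)"
  proof (rule ccontr)
    assume neg: "\<not> ln_distortion M N f (chart_inv cc w) \<le> ereal (h w)"
    have wc: "w \<in> cball z r" using w1 by auto
    have mw: "0 < ?m w" "h w < ln (?m w)"
      using neg imc(2)[OF wc] by (auto simp: ln_distortion_def split: if_splits)
    \<comment> \<open>The quadratic term lowers the difference at \<open>w\<close> by at most
      \<epsilon> r^2; this is set to half of its excess there.\<close>
    define \<epsilon> where "\<epsilon> = (ln (?m w) - h w) / (2 * r\<^sup>2)"
    have eps: "0 < \<epsilon>" using mw H'(1) by (simp add: \<epsilon>_def)
    have "\<epsilon> * r\<^sup>2 = (ln (?m w) - h w) / 2" using H'(1) by (simp add: \<epsilon>_def)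
    then have eps': "0 < ln (?m w) - h w - \<epsilon> * r\<^sup>2" using mw by simp
    \<comment> \<open>The exponential of the perturbed difference. It is continuous on the closed
      disc even where the distortion vanishes, so a maximum exists; exceeding 1, it is attained off
      the circle and at positive distortion.\<close>
    define k where "k = (\<lambda>w. ?m w * exp (\<epsilon> * ((norm (w - z))\<^sup>2 - r\<^sup>2) - h w))"
    have ck: "continuous_on (cball z r) k"
      unfolding k_def by (intro continuous_intros cm H'(3))
    have "cball z r \<noteq> {}" using H'(1) by simp
    then obtain y where y: "y \<in> cball z r" "\<And>v. v \<in> cball z r \<Longrightarrow> k v \<le> k y"
      using continuous_attains_sup[OF compact_cball _ ck] by blast
    have kln: "k v = exp (ln (?m v) - h v + \<epsilon> * ((norm (v - z))\<^sup>2 - r\<^sup>2))" if "0 < ?m v" for v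
      using that by (simp add: k_def exp_add exp_diff exp_minus field_simps)
    have "1 < k w"
    proof -
      have "0 \<le> \<epsilon> * (norm (w - z))\<^sup>2" using eps by simp
      then have "0 < ln (?m w) - h w + \<epsilon> * ((norm (w - z))\<^sup>2 - r\<^sup>2)" using eps' by (simp add: algebra_simps)
      then show ?thesis unfolding kln[OF mw(1)] by simp
    qed
    then have ky: "1 < k y" using y(2)[OF wc] by simp
    then have my: "0 < ?m y"
      unfolding k_def by (smt (verit) exp_gt_zero mult_nonpos_nonneg)
    have yb: "y \<in> ball z r"
    proof (rule ccontr)
      assume "y \<notin> ball z r"
      then have ys: "y \<in> sphere z r" using y(1) by auto
      then have "ln (?m y) \<le> h y" using H'(6)[OF ys] imc(2)[OF y(1)] my by (auto simp: ln_distortion_def)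
      moreover have "(norm (y - z))\<^sup>2 = r\<^sup>2" using ys by (simp add: dist_norm norm_minus_commute)
      ultimately have "k y \<le> 1" unfolding kln[OF my] by simp
      then show False using ky by simp
    qed
    define p where "p = chart_inv c (complex_to_vec y)"
    have p: "p \<in> fst c" "snd c p = complex_to_vec y"
      using chart_inv_in[OF isc] chart_inv_right[OF isc] imc(1)[OF y(1)] by (auto simp: p_def)
    have pM: "p \<in> topspace (mtop M)" using p(1) chart_subset[OF isc] by auto
    define F where "F = (\<lambda>x. ln (distortion M N f (chart_inv c x)))"
    have pos: "0 < distortion M N f p" using my by (simp add: p_def)
    obtain W J where W: "open W" "snd c p \<in> W" "smooth_on W F" and J: "0 < (J::real)"
      and pW: "\<And>x. x \<in> W \<Longrightarrow> 0 < distortion M N f (chart_inv c x)"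
      and lap: "partial 1 (partial 1 F) (snd c p) + partial 2 (partial 2 F) (snd c p) = J * gauss_curvature N (f p)"
      using laplacian_ln_distortion[OF c p(1) pos] unfolding F_def by blast
    have Kp: "0 \<le> gauss_curvature N (f p)" by (rule K[OF image_in_N[OF M N harm ld cover pM]])
    show False
    proof (rule no_interior_max[OF W(1,3) _ open_ball yb H'(4) _ H'(5)[OF yb] eps])
      show "complex_to_vec y \<in> W" using W(2) p(2) by simp
      show "0 \<le> partial 1 (partial 1 F) (complex_to_vec y) + partial 2 (partial 2 F) (complex_to_vec y)"
        using lap Kp J unfolding p(2) by simp
      show "F (complex_to_vec v) - h v + \<epsilon> * (norm (v - z))\<^sup>2 \<le> F (complex_to_vec y) - h y + \<epsilon> * (norm (y - z))\<^sup>2"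
        if v: "v \<in> ball z r" "complex_to_vec v \<in> W" for v
      proof -
        have "k v \<le> k y" using y(2) v(1) by auto
        then show ?thesis unfolding kln[OF my] kln[OF pW[OF v(2)]] F_def by (simp add: algebra_simps)
      qed
    qed
  qed
qed

text \<open>The constant logarithm has zero Laplacian, which is also a positive multiple of the
  curvature.\<close>

lemma constant_distortion_flat:
  assumes p: "p \<in> topspace (mtop M)" and const: "\<And>q. q \<in> topspace (mtop M) \<Longrightarrow> ln_distortion M N f q = k"
    and pos: "0 < distortion M N f p"
  shows "gauss_curvature N (f p) = 0"
proof -
  obtain c where c: "isothermal_chart M c" "p \<in> fst c" using cover p by blast
  have isc: "is_chart (mtop M) c" using isothermal_is_chart[OF M N harm ld cover c(1)] by auto
  define F where "F = (\<lambda>x. ln (distortion M N f (chart_inv c x)))"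
  obtain W J where W: "open W" "snd c p \<in> W" "W \<subseteq> chart_image c" "smooth_on W F" and J: "0 < (J::real)"
    and pW: "\<And>x. x \<in> W \<Longrightarrow> 0 < distortion M N f (chart_inv c x)"
    and lap: "partial 1 (partial 1 F) (snd c p) + partial 2 (partial 2 F) (snd c p) = J * gauss_curvature N (f p)"
    using laplacian_ln_distortion[OF c pos] unfolding F_def by blast
  have F: "F x = F (snd c p)" if "x \<in> W" for x
  proof -
    have "ereal (F y) = k" if "y \<in> W" for y
      using const[of "chart_inv c y"] pW[OF that] chart_inv_in[OF isc] chart_subset[OF isc] W(3) that
      by (auto simp: F_def ln_distortion_def)
    then show ?thesis using that W(2) by (metis ereal.inject)
  qed
  have p1: "partial i F x = 0" if "x \<in> W" for i x
    using partial_cong[OF W(1) that F smooth_on_differentiable[OF W(4) that], of i] by simp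
  have "partial i (partial i F) (snd c p) = 0" for i
    using partial_cong[OF W(1,2) p1 smooth_on_differentiable[OF smooth_on_partial[OF W(4)] W(2)], of i i] by simp
  then show ?thesis using lap J by simp
qed

end

section \<open>Isothermal charts transported by a conformal map\<close>

text \<open>Used with s = 1 or s = -1, the sign of the Jacobian: the identity or complex conjugation
  in real coordinates.\<close>

definition reflection :: "real \<Rightarrow> real ^ 2 \<Rightarrow> real ^ 2" where
  "reflection s v = vector [v $ 1, s * v $ 2]"

definition reflection_matrix :: "real \<Rightarrow> real ^ 2 ^ 2" where
  "reflection_matrix s = (\<chi> i j. if i = j then if i = 1 then 1 else s else 0)"

lemma reflection_mult: "reflection s v = reflection_matrix s *v v"
  by (simp add: reflection_def reflection_matrix_def vec_eq_iff forall_2 matrix_vector_mult_def sum_2)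

lemma bounded_linear_reflection: "bounded_linear (reflection s)"
  unfolding reflection_mult[abs_def] by (rule matrix_vector_mul_bounded_linear)

lemma jacobian_reflection: "jacobian (reflection s) (at x) = reflection_matrix s" "reflection s differentiable (at x)"
proof -
  have "reflection s = (*v) (reflection_matrix s)" by (rule ext) (rule reflection_mult)
  then have "(reflection s has_derivative (*v) (reflection_matrix s)) (at x)"
    using bounded_linear_imp_has_derivative[OF bounded_linear_reflection, of s] by simp
  then show "jacobian (reflection s) (at x) = reflection_matrix s" "reflection s differentiable (at x)"
    by (auto intro: jacobian_eqI simp: differentiable_def)
qed

lemma det_reflection_matrix: "det (reflection_matrix s) = s"
  by (simp add: det_2 reflection_matrix_def)

lemma reflection_reflection: "s * s = 1 \<Longrightarrow> reflection s (reflection s v) = v"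
  by (simp add: reflection_def vec_eq_iff forall_2 mult.assoc[symmetric])

lemma reflection_matrix_orthogonal:
  "s * s = 1 \<Longrightarrow> transpose (reflection_matrix s) ** (l *\<^sub>R mat 1) ** reflection_matrix s = l *\<^sub>R mat 1"
  by (simp add: reflection_matrix_def vec_eq_iff forall_2 matrix_matrix_mult_def transpose_def sum_2 mat_def algebra_simps)

text \<open>The chart of \<open>N\<close> is c o g followed by \<open>reflection s\<close>, so that
  \<open>f\<close> reads as the identity or as a reflection. The metric of \<open>N\<close> in it is
  the pullback metric seen through the reflection, a multiple of the identity because
  \<open>f\<close> is conformal. The sign s makes the chart positively oriented.\<close>

lemma pushforward_isothermal_chart:
  fixes M :: "('a, 2) riemannian" and N :: "('b, 2) riemannian" and f :: "'a \<Rightarrow> 'b" and g :: "'b \<Rightarrow> 'a"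
  assumes N: "oriented_riemannian_surface N" and isc: "is_chart (mtop M) c"
    and W: "openin (mtop M) W" "W \<subseteq> fst c" and V: "openin (mtop N) V"
    and f: "\<And>q. q \<in> W \<Longrightarrow> f q \<in> V \<and> g (f q) = q" and g: "\<And>q. q \<in> V \<Longrightarrow> g q \<in> W \<and> f (g q) = q"
    and cf: "continuous_map (subtopology (mtop M) W) (mtop N) f"
    and cg: "continuous_map (subtopology (mtop N) V) (mtop M) g"
    and sf: "\<And>d. d \<in> charts N \<Longrightarrow> smooth_on (snd c ` (W \<inter> f -` fst d)) (local_rep c d f)"
    and sg: "\<And>d. d \<in> charts N \<Longrightarrow> smooth_on (snd d ` (fst d \<inter> V)) (\<lambda>y. snd c (g (chart_inv d y)))"
    and s: "s * s = (1 :: real)"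
    and J: "\<And>d x. d \<in> charts N \<Longrightarrow> x \<in> snd c ` (W \<inter> f -` fst d) \<Longrightarrow> 0 < det (jacobian (local_rep c d f) (at x)) * s"
    and P: "\<And>d x. d \<in> charts N \<Longrightarrow> x \<in> snd c ` (W \<inter> f -` fst d) \<Longrightarrow> \<exists>l. pullback (metric N d) (local_rep c d f) x = l *\<^sub>R mat 1"
  shows "isothermal_chart N (V, \<lambda>q. reflection s (snd c (g q)))"
proof -
  let ?r = "reflection s" and ?S = "reflection_matrix s"
  define e where "e = (V, \<lambda>q. ?r (snd c (g q)))"
  define B where "B = snd c ` W"
  define E where "E = (\<lambda>x. f (chart_inv c (?r x)))"
  note rr = reflection_reflection[OF s]
  have cr: "continuous_on A ?r" for A by (rule linear_continuous_on[OF bounded_linear_reflection])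
  have oB: "open B" unfolding B_def by (rule chart_image_open[OF isc W])
  have BW: "B \<subseteq> chart_image c" using W(2) by (auto simp: B_def chart_image_def)
  have im: "chart_image e = ?r -` B"
  proof
    show "chart_image e \<subseteq> ?r -` B" using g rr by (auto simp: chart_image_def e_def B_def)
    show "?r -` B \<subseteq> chart_image e"
    proof
      fix x assume "x \<in> ?r -` B"
      then obtain q where q: "q \<in> W" "?r x = snd c q" by (auto simp: B_def)
      then have "x = ?r (snd c (g (f q)))" using f[OF q(1)] rr by metis
      then show "x \<in> chart_image e"
        using f[OF q(1)] by (auto simp: chart_image_def e_def intro!: image_eqI[of _ _ "f q"])
    qed
  qed
  have open_r: "open (?r -` A)" if "open A" for A
    using continuous_open_preimage[OF cr open_UNIV that] by simp
  have oim: "open (chart_image e)" unfolding im by (rule open_r[OF oB])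
  have Ein: "E x \<in> V \<and> snd e (E x) = x" if "x \<in> chart_image e" for x
  proof -
    have "?r x \<in> snd c ` W" using that unfolding im B_def by simp
    then obtain q where q: "q \<in> W" "?r x = snd c q" by (rule imageE)
    have "chart_inv c (?r x) = q" using q W(2) chart_inv_left[OF isc] by auto
    then show ?thesis using f[OF q(1)] q rr by (auto simp: E_def e_def) (metis rr)
  qed
  have Eleft: "E (snd e q) = q" if "q \<in> V" for q
    using g[OF that] W(2) chart_inv_left[OF isc] rr by (auto simp: E_def e_def)
  have tV: "topspace (subtopology (mtop N) V) = V" using openin_subset[OF V] by auto
  have tW: "topspace (subtopology (mtop M) W) = W" using openin_subset[OF W(1)] by auto
  have ise: "is_chart (mtop N) e"
    unfolding is_chart_def
  proof (intro conjI)
    show "openin (mtop N) (fst e)" using V by (simp add: e_def)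
    show "open (chart_image e)" by (rule oim)
    have "continuous_map (subtopology (mtop N) V) (subtopology (mtop M) (fst c)) g"
      using cg g W(2) tV by (auto simp: continuous_map_in_subtopology)
    from continuous_map_compose[OF continuous_map_compose[OF this chart_continuous[OF isc]], of euclidean ?r]
    have "continuous_map (subtopology (mtop N) V) euclidean (snd e)"
      using cr[of UNIV] by (simp add: e_def o_def)
    then have 1: "continuous_map (subtopology (mtop N) V) (top_of_set (chart_image e)) (snd e)"
      unfolding continuous_map_in_subtopology tV by (auto simp: chart_image_def e_def)
    have "continuous_map (top_of_set (chart_image e)) (top_of_set (chart_image c)) ?r"
      using cr BW by (auto simp: continuous_map_in_subtopology im)
    from continuous_map_compose[OF this chart_inv_continuous[OF isc]]
    have "continuous_map (top_of_set (chart_image e)) (mtop M) (\<lambda>x. chart_inv c (?r x))" by (simp add: o_def)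
    moreover have "chart_inv c (?r x) \<in> W" if "x \<in> chart_image e" for x
      using that W(2) chart_inv_left[OF isc] by (auto simp: im B_def)
    ultimately have "continuous_map (top_of_set (chart_image e)) (subtopology (mtop M) W) (\<lambda>x. chart_inv c (?r x))"
      by (auto simp: continuous_map_in_subtopology)
    from continuous_map_compose[OF this cf]
    have "continuous_map (top_of_set (chart_image e)) (mtop N) E" by (simp add: E_def[abs_def] o_def)
    then have 2: "continuous_map (top_of_set (chart_image e)) (subtopology (mtop N) V) E"
      using Ein by (auto simp: continuous_map_in_subtopology)
    have "homeomorphic_maps (subtopology (mtop N) V) (top_of_set (chart_image e)) (snd e) E"
      unfolding homeomorphic_maps_def tV using 1 2 Ein Eleft by auto
    then show "homeomorphic_map (subtopology (mtop N) (fst e)) (top_of_set (chart_image e)) (snd e)"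
      using homeomorphic_map_maps by (auto simp: e_def)
  qed
  have einv: "chart_inv e x = E x" if "x \<in> chart_image e" for x
    using Ein[OF that] chart_inv_left[OF ise, of "E x"] by (auto simp: e_def)
  have compat: "oriented_compat e d \<and> oriented_compat d e" and
    jac: "\<And>x. x \<in> local_dom e d id \<Longrightarrow> ?r x \<in> snd c ` (W \<inter> f -` fst d) \<and> local_rep e d id x = local_rep c d f (?r x) \<and>
       jacobian (local_rep e d id) (at x) = jacobian (local_rep c d f) (at (?r x)) ** ?S" if d: "d \<in> charts N" for d
  proof -
    note isd = charts_is_chart[OF N d]
    define D where "D = snd c ` (W \<inter> f -` fst d)"
    have "openin (mtop M) {q \<in> topspace (subtopology (mtop M) W). f q \<in> fst d}"
      using openin_continuous_map_preimage[OF cf chart_open(1)[OF isd]] W(1) by (simp add: openin_open_subtopology)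
    moreover have "{q \<in> topspace (subtopology (mtop M) W). f q \<in> fst d} = W \<inter> f -` fst d" unfolding tW by auto
    ultimately have oD: "open D" unfolding D_def using W(2) by (intro chart_image_open[OF isc]) auto
    have dom: "local_dom e d id = ?r -` D"
    proof
      show "local_dom e d id \<subseteq> ?r -` D"
      proof
        fix x assume x: "x \<in> local_dom e d id"
        then have xi: "x \<in> chart_image e" "E x \<in> fst d" using einv by (auto simp: local_dom_iff[OF ise])
        obtain q where q: "q \<in> W" "?r x = snd c q" using xi by (auto simp: im B_def)
        then have "E x = f q" using W(2) chart_inv_left[OF isc] by (auto simp: E_def)
        then show "x \<in> ?r -` D" using q xi by (auto simp: D_def)
      qed
      show "?r -` D \<subseteq> local_dom e d id"
      proof
        fix x assume "x \<in> ?r -` D"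
        then obtain q where q: "q \<in> W" "f q \<in> fst d" "?r x = snd c q" by (auto simp: D_def)
        then have "E x = f q" "x \<in> chart_image e" using W(2) chart_inv_left[OF isc] by (auto simp: E_def im B_def)
        then show "x \<in> local_dom e d id" using q einv by (auto simp: local_dom_iff[OF ise])
      qed
    qed
    have odom: "open (local_dom e d id)" unfolding dom by (rule open_r[OF oD])
    have rep: "local_rep c d f (?r x) = local_rep e d id x" if "x \<in> local_dom e d id" for x
      using that einv by (auto simp: local_dom_iff[OF ise] local_rep_apply E_def)
    have s1: "smooth_on (local_dom e d id) (\<lambda>x. local_rep c d f (?r x))"
      by (rule smooth_on_compose[OF odom oD _ smooth_on_bounded_linear[OF bounded_linear_reflection odom] sf[OF d, folded D_def]])
        (use dom in auto)
    have sed: "smooth_on (local_dom e d id) (local_rep e d id)" by (rule smooth_on_cong[OF odom rep s1])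
    have jac: "?r x \<in> D \<and> jacobian (local_rep e d id) (at x) = jacobian (local_rep c d f) (at (?r x)) ** ?S"
      if x: "x \<in> local_dom e d id" for x
    proof -
      have rx: "?r x \<in> D" using x dom by auto
      have dd: "local_rep c d f differentiable (at (?r x))" by (rule smooth_on_differentiable[OF sf[OF d] rx[unfolded D_def]])
      note jc = jacobian_compose[OF jacobian_reflection(2) dd]
      show ?thesis using jacobian_cong(1)[OF odom x rep jc(2)] jc(1) rx by (simp add: jacobian_reflection)
    qed
    then show "?r x \<in> snd c ` (W \<inter> f -` fst d) \<and> local_rep e d id x = local_rep c d f (?r x) \<and>
       jacobian (local_rep e d id) (at x) = jacobian (local_rep c d f) (at (?r x)) ** ?S" if "x \<in> local_dom e d id" for x
      using rep that by (auto simp: D_def)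
    have pos: "0 < det (jacobian (local_rep e d id) (at x))" if "x \<in> local_dom e d id" for x
      using jac[OF that] J[OF d, folded D_def] by (simp add: det_mul det_reflection_matrix)
    have dom': "local_dom d e id = snd d ` (fst d \<inter> V)" by (auto simp: local_dom_def e_def)
    have odom': "open (local_dom d e id)" by (rule local_dom_open[OF isd ise continuous_map_id])
    have sde: "smooth_on (local_dom d e id) (local_rep d e id)"
    proof -
      have "smooth_on (local_dom d e id) (\<lambda>y. ?r (snd c (g (chart_inv d y))))"
        by (rule smooth_on_linear_compose[OF bounded_linear_reflection odom' sg[OF d, folded dom']])
      then show ?thesis by (rule smooth_on_cong[OF odom', rotated]) (simp add: local_rep_apply e_def)
    qed
    \<comment> \<open>The two coordinate changes are mutually inverse, so their determinants have
      product 1 and the same sign.\<close>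
    have pos': "0 < det (jacobian (local_rep d e id) (at y))" if y: "y \<in> local_dom d e id" for y
    proof -
      have ret: "local_rep d e id y' \<in> local_dom e d id \<and> y' = local_rep e d id (local_rep d e id y')" if y': "y' \<in> local_dom d e id" for y'
      proof -
        obtain q where q: "q \<in> fst d" "q \<in> V" "y' = snd d q" using y' unfolding dom' by auto
        have 1: "local_rep d e id y' = snd e q" using q chart_inv_left[OF isd] by (simp add: local_rep_apply)
        have 2: "chart_inv e (snd e q) = q" by (rule chart_inv_left[OF ise]) (use q in \<open>simp add: e_def\<close>)
        have "snd e q \<in> local_dom e d id" by (rule local_dom_memI) (use q in \<open>simp_all add: e_def\<close>)
        then show ?thesis unfolding 1 using 2 q by (simp add: local_rep_apply)
      qed
      have d1: "local_rep d e id differentiable (at y)" by (rule smooth_on_differentiable[OF sde y])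
      have d2: "local_rep e d id differentiable (at (local_rep d e id y))"
        by (rule smooth_on_differentiable[OF sed]) (use ret[OF y] in blast)
      have "jacobian (\<lambda>x. x) (at y) = jacobian (\<lambda>x. local_rep e d id (local_rep d e id x)) (at y)"
        by (rule jacobian_cong(1)[OF odom' y _ differentiable_ident]) (use ret in blast)
      also have "\<dots> = jacobian (local_rep e d id) (at (local_rep d e id y)) ** jacobian (local_rep d e id) (at y)"
        by (rule jacobian_compose(1)[OF d1 d2])
      finally have "mat 1 = jacobian (local_rep e d id) (at (local_rep d e id y)) ** jacobian (local_rep d e id) (at y)"
        by (simp add: jacobian_def matrix_id_mat_1[unfolded id_def] id_def)
      then have "det (jacobian (local_rep e d id) (at (local_rep d e id y))) * det (jacobian (local_rep d e id) (at y)) = 1"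
        by (metis det_I det_mul)
      moreover have "0 < det (jacobian (local_rep e d id) (at (local_rep d e id y)))"
        by (rule pos) (use ret[OF y] in blast)
      ultimately show ?thesis by (metis zero_less_mult_pos zero_less_one)
    qed
    show "oriented_compat e d \<and> oriented_compat d e"
      unfolding oriented_compat_def using sed sde pos pos' by blast
  qed
  \<comment> \<open>Maximality of the atlas turns compatibility with all charts into
    membership.\<close>
  have eN: "e \<in> charts N"
    using N ise compat unfolding oriented_riemannian_manifold_def maximal_atlas_def by blast
  have "\<exists>l. metric N e x = l *\<^sub>R mat 1" if x: "x \<in> chart_image e" for x
  proof -
    have Ex: "E x \<in> topspace (mtop N)" using Ein[OF x] openin_subset[OF V] by auto
    define d where "d = chart_at N (E x)"
    have d: "d \<in> charts N" "E x \<in> fst d" using chart_at_in[OF N Ex] by (auto simp: d_def)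
    have xd: "x \<in> local_dom e d id" using x d einv by (auto simp: local_dom_iff[OF ise])
    note j = jac[OF d(1) xd]
    obtain l where l: "pullback (metric N d) (local_rep c d f) (?r x) = l *\<^sub>R mat 1" using P[OF d(1)] j by blast
    \<comment> \<open>The coordinate change from \<open>e\<close> to \<open>d\<close> is
      \<open>f\<close> in the charts \<open>c\<close> and \<open>d\<close> after the reflection, so
      the transformation law expresses the metric by the conformal pullback; the reflection is
      orthogonal and preserves multiples of the identity.\<close>
    have "metric N e x = transpose ?S ** pullback (metric N d) (local_rep c d f) (?r x) ** ?S"
      using metric_transform[OF N eN d(1) xd] j by (simp add: pullback_def matrix_transpose_mul matrix_mul_assoc)
    then show ?thesis unfolding l reflection_matrix_orthogonal[OF s] by blast
  qed
  then show ?thesis using eN by (simp add: isothermal_chart_def e_def)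
qed

text \<open>Restrictions belong to the maximal atlas; this is the transport of charts along the
  identity with s = 1.\<close>

lemma restrict_isothermal_chart:
  fixes M :: "('a, 2) riemannian"
  assumes M: "oriented_riemannian_surface M" and c: "isothermal_chart M c" and W: "openin (mtop M) W" "W \<subseteq> fst c"
  shows "isothermal_chart M (W, snd c)"
proof -
  have cM: "c \<in> charts M" using c by (simp add: isothermal_chart_def)
  note isc = charts_is_chart[OF M cM]
  have sub: "snd c ` (W \<inter> id -` fst d) \<subseteq> local_dom c d id" for d using W(2) by (auto simp: local_dom_def)
  have "isothermal_chart M (W, \<lambda>q. reflection 1 (snd c (id q)))"
  proof (rule pushforward_isothermal_chart[OF M isc W W(1), where f = id])
    fix d assume d: "d \<in> charts M"
    show "smooth_on (snd c ` (W \<inter> id -` fst d)) (local_rep c d id)"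
      by (rule smooth_on_subset[OF chart_change(2)[OF M cM d] sub])
    have "snd d ` (fst d \<inter> W) \<subseteq> local_dom d c id" using W(2) by (auto simp: local_dom_def)
    then have "smooth_on (snd d ` (fst d \<inter> W)) (local_rep d c id)"
      by (rule smooth_on_subset[OF chart_change(2)[OF M d cM]])
    then show "smooth_on (snd d ` (fst d \<inter> W)) (\<lambda>y. snd c (id (chart_inv d y)))" by (simp add: local_rep_def o_def)
    fix x assume "x \<in> snd c ` (W \<inter> id -` fst d)"
    then have x: "x \<in> local_dom c d id" using sub by blast
    show "0 < det (jacobian (local_rep c d id) (at x)) * 1" using chart_change(3)[OF M cM d x] by simp
    have "pullback (metric M d) (local_rep c d id) x = metric M c x"
      using metric_transform[OF M cM d x] by (simp add: pullback_def)
    moreover have "x \<in> chart_image c" using x by (auto simp: local_dom_iff[OF isc])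
    ultimately show "\<exists>l. pullback (metric M d) (local_rep c d id) x = l *\<^sub>R mat 1"
      using c by (simp add: isothermal_chart_def)
  qed (simp_all add: continuous_map_from_subtopology)
  moreover have "reflection 1 v = v" for v by (simp add: reflection_def vec_eq_iff forall_2)
  ultimately show ?thesis by simp
qed

section \<open>Conformal local diffeomorphisms are holomorphic or antiholomorphic\<close>

context
  fixes M :: "('a, 2) riemannian" and N :: "('b, 2) riemannian" and f :: "'a \<Rightarrow> 'b"
  assumes M: "oriented_riemannian_surface M" and N: "oriented_riemannian_surface N"
    and harm: "harmonic_map M N f" and ld: "local_diffeomorphism (underlying_curve M) N f"
    and cover: "\<forall>p\<in>topspace (mtop M). \<exists>c. isothermal_chart M c \<and> p \<in> fst c"
begin

text \<open>Coordinate changes have positive determinant, so the sign of the Jacobian at a point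
  does not depend on the charts. The points of either sign form disjoint open sets covering the
  connected surface, so one of them is empty.\<close>

lemma jacobian_sign_constant:
  assumes con: "connected_space (mtop M)"
  obtains s :: real where "s = 1 \<or> s = -1"
    "\<forall>c d x. isothermal_chart M c \<longrightarrow> d \<in> charts N \<longrightarrow> x \<in> local_dom c d f \<longrightarrow> 0 < s * det (jacobian (local_rep c d f) (at x))"
proof -
  define j where "j = (\<lambda>(c :: ('a, real ^ 2) chart) (d :: ('b, real ^ 2) chart) p. det (jacobian (local_rep c d f) (at (snd c p))))"
  have same: "0 < s * j c d p \<longleftrightarrow> 0 < s * j c' d' p"
    if c: "isothermal_chart M c" "isothermal_chart M c'" "p \<in> fst c" "p \<in> fst c'"
      and d: "d \<in> charts N" "d' \<in> charts N" "f p \<in> fst d" "f p \<in> fst d'" for s :: real and c d p c' d'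
  proof -
    have cM: "c \<in> charts M" "c' \<in> charts M" using c by (auto simp: isothermal_chart_def)
    note ch = local_rep_chain(2)[OF M N harm_continuous[OF M N harm ld cover] cM c(3,4) d
       local_rep_differentiable[OF M N harm ld cover cM(2) d(2) c(4) d(4)]]
    have "0 < det (jacobian (local_rep d' d id) (at (snd d' (f p))))"
      by (rule chart_change(3)[OF N d(2,1)]) (use d in \<open>auto intro!: local_dom_memI\<close>)
    moreover have "0 < det (jacobian (local_rep c c' id) (at (snd c p)))"
      by (rule chart_change(3)[OF M cM]) (use c in \<open>auto intro!: local_dom_memI\<close>)
    moreover have "s * j c d p = det (jacobian (local_rep d' d id) (at (snd d' (f p)))) * (s * j c' d' p) * det (jacobian (local_rep c c' id) (at (snd c p)))"
      unfolding j_def ch by (simp add: det_mul mult_ac)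
    moreover have "0 < a * X * b \<longleftrightarrow> 0 < X" if "0 < a" "0 < b" for a X b :: real
      using that by (simp add: zero_less_mult_iff)
    ultimately show ?thesis by (simp only:)
  qed
  define S where "S = (\<lambda>s::real. {p \<in> topspace (mtop M). \<exists>c d. isothermal_chart M c \<and> d \<in> charts N \<and> p \<in> fst c \<and> f p \<in> fst d \<and> 0 < s * j c d p})"
  have charts_at: "\<exists>c d. isothermal_chart M c \<and> d \<in> charts N \<and> p \<in> fst c \<and> f p \<in> fst d \<and> j c d p \<noteq> 0"
    if p: "p \<in> topspace (mtop M)" for p
  proof -
    obtain c where c: "isothermal_chart M c" "p \<in> fst c" using cover p by blast
    obtain d where d: "d \<in> charts N" "f p \<in> fst d"
      using charts_cover[OF N image_in_N[OF M N harm ld cover p]] by blast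
    have "j c d p \<noteq> 0" unfolding j_def
      by (rule isothermal_jacobian_nonzero[OF M N harm ld cover c(1) d(1) local_dom_memI[of p c f, OF c(2) d(2)]])
    then show ?thesis using c d by blast
  qed
  have opS: "openin (mtop M) (S s)" for s
  proof (subst openin_subopen, intro ballI)
    fix p assume "p \<in> S s"
    then obtain c d where c: "isothermal_chart M c" "p \<in> fst c" and d: "d \<in> charts N" "f p \<in> fst d" and pos: "0 < s * j c d p"
      by (auto simp: S_def)
    have isc: "is_chart (mtop M) c" using isothermal_is_chart[OF M N harm ld cover c(1)] by auto
    note set = distortion_setting[OF M N harm ld cover c(1) d(1)]
    have cJ: "continuous_on (local_dom c d f) (\<lambda>x. s * det (jacobian (local_rep c d f) (at x)))"
    proof -
      have "continuous_on (local_dom c d f) (\<lambda>x. jacobian (local_rep c d f) (at x) $ i $ k)" for i k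
        by (rule continuous_on_eq[OF smooth_on_imp_continuous_on[OF smooth_on_partial[OF smooth_on_vec_nth[OF set(2,3)]]]])
           (rule jacobian_nth[OF smooth_on_differentiable[OF set(3)], symmetric])
      then show ?thesis unfolding det_2 by (intro continuous_on_mult continuous_on_diff continuous_on_const)
    qed
    define D where "D = local_dom c d f \<inter> (\<lambda>x. s * det (jacobian (local_rep c d f) (at x))) -` {0<..}"
    have "open D" unfolding D_def by (rule continuous_open_preimage[OF cJ set(2)]) auto
    then have "openin (mtop M) {q \<in> fst c. snd c q \<in> D}" by (rule chart_preimage_open[OF isc])
    moreover have "p \<in> {q \<in> fst c. snd c q \<in> D}"
      using c d pos by (auto simp: D_def j_def intro!: local_dom_memI)
    moreover have "{q \<in> fst c. snd c q \<in> D} \<subseteq> S s"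
      using c(1) d(1) chart_subset[OF isc] chart_inv_left[OF isc]
      by (auto simp: S_def D_def j_def local_dom_iff[OF isc] intro!: exI[of _ "fst c"] exI[of _ "snd c"] exI[of _ "fst d"] exI[of _ "snd d"])
    ultimately show "\<exists>T. openin (mtop M) T \<and> p \<in> T \<and> T \<subseteq> S s" by blast
  qed
  have disj: "S 1 \<inter> S (-1) = {}"
  proof (rule ccontr)
    assume "S 1 \<inter> S (-1) \<noteq> {}"
    then obtain p c d c' d' where *: "isothermal_chart M c" "isothermal_chart M c'" "p \<in> fst c" "p \<in> fst c'"
      "d \<in> charts N" "d' \<in> charts N" "f p \<in> fst d" "f p \<in> fst d'" "0 < 1 * j c d p" "0 < - 1 * j c' d' p"
      unfolding S_def by blast
    show False using same[OF *(1-8), of 1] *(9,10) by simp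
  qed
  have cov: "topspace (mtop M) \<subseteq> S 1 \<union> S (-1)"
  proof
    fix p assume p: "p \<in> topspace (mtop M)"
    then obtain c d where "isothermal_chart M c" "d \<in> charts N" "p \<in> fst c" "f p \<in> fst d" "j c d p \<noteq> 0"
      using charts_at by blast
    moreover from this(5) have "0 < 1 * j c d p \<or> 0 < - 1 * j c d p" by auto
    ultimately show "p \<in> S 1 \<union> S (-1)" unfolding S_def using p by blast
  qed
  have "S 1 = {} \<or> S (-1) = {}"
    using con opS disj cov unfolding connected_space_def by blast
  then obtain s :: real where s: "s = 1 \<or> s = -1" "topspace (mtop M) \<subseteq> S s" using cov by blast
  have "0 < s * det (jacobian (local_rep c d f) (at x))" if c: "isothermal_chart M c" and d: "d \<in> charts N" and x: "x \<in> local_dom c d f" for c d x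
  proof -
    have isc: "is_chart (mtop M) c" using isothermal_is_chart[OF M N harm ld cover c] by auto
    define p where "p = chart_inv c x"
    have p: "p \<in> fst c" "snd c p = x" "f p \<in> fst d"
      using x chart_inv_in[OF isc] chart_inv_right[OF isc] by (auto simp: p_def local_dom_iff[OF isc])
    then have "p \<in> S s" using s(2) chart_subset[OF isc] by auto
    then obtain c' d' where *: "isothermal_chart M c'" "p \<in> fst c'" "d' \<in> charts N" "f p \<in> fst d'" "0 < s * j c' d' p"
      unfolding S_def by blast
    then have "0 < s * j c d p" using same[OF c *(1) p(1) *(2) d *(3) p(3) *(4)] by blast
    then show ?thesis by (simp add: j_def p)
  qed
  then show ?thesis using that[of s] s(1) by blast
qed

text \<open>The transported chart is built from a local inverse g of \<open>f\<close>; since g o f =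
  id, \<open>f\<close> becomes \<open>reflection s\<close> in these coordinates. Both charts are cut
  down to domains on which g is an inverse.\<close>

lemma conformal_local_charts:
  assumes s: "s = 1 \<or> s = (-1 :: real)"
    and sgn: "\<forall>c d x. isothermal_chart M c \<longrightarrow> d \<in> charts N \<longrightarrow> x \<in> local_dom c d f \<longrightarrow> 0 < s * det (jacobian (local_rep c d f) (at x))"
    and conf: "\<And>p. p \<in> topspace (mtop M) \<Longrightarrow> distortion M N f p = 0" and p: "p \<in> topspace (mtop M)"
  shows "\<exists>c e. isothermal_chart M c \<and> isothermal_chart N e \<and> p \<in> fst c \<and> f p \<in> fst e \<and>
    (\<forall>q\<in>fst c. snd e (f q) = reflection s (snd c q))"
proof -
  obtain c where c: "isothermal_chart M c" "p \<in> fst c" using cover p by blast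
  have isc: "is_chart (mtop M) c" and cM: "c \<in> charts M" using isothermal_is_chart[OF M N harm ld cover c(1)] by auto
  obtain W V g where pW: "p \<in> W" and inv: "local_inverse_on M N f W V g"
    using local_diffeomorphism_inverse[OF M N ld p] by blast
  have W: "openin (mtop M) W" and V: "openin (mtop N) V"
    and f: "\<And>q. q \<in> W \<Longrightarrow> f q \<in> V \<and> g (f q) = q" and g: "\<And>q. q \<in> V \<Longrightarrow> g q \<in> W \<and> f (g q) = q"
    and cg: "continuous_map (subtopology (mtop N) V) (mtop M) g"
    and sg: "\<And>d. d \<in> charts N \<Longrightarrow> smooth_on (snd d ` (fst d \<inter> V \<inter> g -` (fst c \<inter> W))) (\<lambda>y. snd c (g (chart_inv d y)))"
    using inv c unfolding local_inverse_on_def by blast+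
  define W' where "W' = W \<inter> fst c"
  define V' where "V' = {q \<in> V. g q \<in> W'}"
  have W': "openin (mtop M) W'" "W' \<subseteq> fst c" unfolding W'_def using W chart_open(1)[OF isc] by auto
  have "openin (mtop N) {q \<in> topspace (subtopology (mtop N) V). g q \<in> W'}"
    using openin_continuous_map_preimage[OF cg W'(1)] V by (simp add: openin_open_subtopology)
  moreover have "{q \<in> topspace (subtopology (mtop N) V). g q \<in> W'} = V'"
    using openin_subset[OF V] by (auto simp: V'_def)
  ultimately have V': "openin (mtop N) V'" by simp
  have sub: "snd c ` (W' \<inter> f -` fst d) \<subseteq> local_dom c d f" for d
    by (auto simp: W'_def local_dom_def)
  have "isothermal_chart N (V', \<lambda>q. reflection s (snd c (g q)))"
  proof (rule pushforward_isothermal_chart[OF N isc W' V', where f = f])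
    show "f q \<in> V' \<and> g (f q) = q" if "q \<in> W'" for q using f that by (auto simp: V'_def W'_def)
    show "g q \<in> W' \<and> f (g q) = q" if "q \<in> V'" for q using g that by (auto simp: V'_def)
    show "continuous_map (subtopology (mtop M) W') (mtop N) f"
      by (rule continuous_map_from_subtopology[OF harm_continuous[OF M N harm ld cover]])
    show "continuous_map (subtopology (mtop N) V') (mtop M) g"
      by (rule continuous_map_from_subtopology_mono[OF cg]) (auto simp: V'_def)
    show "s * s = 1" using s by auto
    fix d assume d: "d \<in> charts N"
    note set = distortion_setting[OF M N harm ld cover c(1) d]
    show "smooth_on (snd c ` (W' \<inter> f -` fst d)) (local_rep c d f)"
      by (rule smooth_on_subset[OF set(3) sub])
    show "smooth_on (snd d ` (fst d \<inter> V')) (\<lambda>y. snd c (g (chart_inv d y)))"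
      by (rule smooth_on_subset[OF sg[OF d]]) (auto simp: V'_def W'_def)
    fix x assume "x \<in> snd c ` (W' \<inter> f -` fst d)"
    then have x: "x \<in> local_dom c d f" using sub by blast
    show "0 < det (jacobian (local_rep c d f) (at x)) * s"
    proof -
      have "0 < s * det (jacobian (local_rep c d f) (at x))" using sgn c(1) d x by blast
      then show ?thesis by (simp only: mult.commute)
    qed
    have q: "chart_inv c x \<in> fst c" "f (chart_inv c x) \<in> fst d" "snd c (chart_inv c x) = x"
      using x chart_inv_in[OF isc] chart_inv_right[OF isc] by (auto simp: local_dom_iff[OF isc])
    have "dilatation (pullback (metric N d) (local_rep c d f) x) = 0"
      using distortion_eq[OF M N harm ld cover c(1) d q(1,2)] conf[of "chart_inv c x"] q chart_subset[OF isc] by auto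
    then show "\<exists>l. pullback (metric N d) (local_rep c d f) x = l *\<^sub>R mat 1"
      using dilatation_0_conformal[OF set(1-5), of x] x by auto
  qed
  moreover have "isothermal_chart M (W', snd c)" by (rule restrict_isothermal_chart[OF M c(1) W'])
  moreover have "p \<in> W'" "f p \<in> V'" using pW c f by (auto simp: V'_def W'_def)
  moreover have "\<forall>q\<in>W'. reflection s (snd c (g (f q))) = reflection s (snd c q)" using f by (auto simp: W'_def)
  ultimately show ?thesis
    by (intro exI[of _ "(W', snd c)"] exI[of _ "(V', \<lambda>q. reflection s (snd c (g q)))"]) simp
qed

text \<open>In the charts just obtained \<open>f\<close> is z or its conjugate, according to the one
  sign s valid on the whole surface.\<close>

lemma conformal_imp_holomorphic:
  assumes con: "connected_space (mtop M)" and conf: "\<And>p. p \<in> topspace (mtop M) \<Longrightarrow> distortion M N f p = 0"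
  shows "holomorphic_map (underlying_curve M) (underlying_curve N) f \<or>
    antiholomorphic_map (underlying_curve M) (underlying_curve N) f"
proof -
  obtain s :: real where s: "s = 1 \<or> s = -1"
    and sgn: "\<forall>c d x. isothermal_chart M c \<longrightarrow> d \<in> charts N \<longrightarrow> x \<in> local_dom c d f \<longrightarrow> 0 < s * det (jacobian (local_rep c d f) (at x))"
    using jacobian_sign_constant[OF con] by blast
  have loc: "\<exists>c\<in>charts (underlying_curve M). \<exists>d\<in>charts (underlying_curve N). p \<in> fst c \<and> f p \<in> fst d \<and>
      (\<forall>z\<in>local_dom c d f. local_rep c d f z = (if s = 1 then z else cnj z))"
    if p: "p \<in> topspace (mtop M)" for p
  proof -
    obtain c e where c: "isothermal_chart M c" and e: "isothermal_chart N e" and pc: "p \<in> fst c" "f p \<in> fst e"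
      and rep: "\<And>q. q \<in> fst c \<Longrightarrow> snd e (f q) = reflection s (snd c q)"
      using conformal_local_charts[OF s sgn conf p] by blast
    have isc: "is_chart (mtop M) c" using isothermal_is_chart[OF M N harm ld cover c] by auto
    let ?c = "(fst c, vec_to_complex \<circ> snd c)" and ?d = "(fst e, vec_to_complex \<circ> snd e)"
    have "local_rep ?c ?d f z = (if s = 1 then z else cnj z)" if z: "z \<in> local_dom ?c ?d f" for z
    proof -
      obtain q where q: "q \<in> fst c" "z = vec_to_complex (snd c q)" using z by (auto simp: local_dom_def)
      have "inj_on (vec_to_complex \<circ> snd c) (fst c)"
        using chart_inj[OF isc] by (auto simp: inj_on_def) (metis vec_complex_inverse(1))
      then have "chart_inv ?c z = q"
        using q inv_into_f_f[of "vec_to_complex \<circ> snd c" "fst c" q] by (simp add: chart_inv_def)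
      then have "local_rep ?c ?d f z = vec_to_complex (reflection s (snd c q))" using rep[OF q(1)] by (simp add: local_rep_apply)
      also have "\<dots> = (if s = 1 then z else cnj z)"
        unfolding q(2) using s by (auto simp: vec_to_complex_def reflection_def complex_eq_iff)
      finally show ?thesis .
    qed
    moreover have "?c \<in> charts (underlying_curve M)" "?d \<in> charts (underlying_curve N)"
      using c e by (auto simp: charts_underlying_curve)
    ultimately show ?thesis using pc by (metis fst_conv)
  qed
  show ?thesis
  proof (cases "s = 1")
    case True
    have "local_rep c d f holomorphic_on local_dom c d f" if "\<forall>z\<in>local_dom c d f. local_rep c d f z = (if s = 1 then z else cnj z)"
      for c :: "('a, complex) chart" and d :: "('b, complex) chart"
      by (rule holomorphic_transform[OF holomorphic_on_ident]) (use that True in auto)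
    then have "holomorphic_map (underlying_curve M) (underlying_curve N) f"
      unfolding holomorphic_map_def mtop_underlying_curve
      using harm_continuous[OF M N harm ld cover] loc by blast
    then show ?thesis ..
  next
    case False
    have "(cnj \<circ> local_rep c d f) holomorphic_on local_dom c d f" if "\<forall>z\<in>local_dom c d f. local_rep c d f z = (if s = 1 then z else cnj z)"
      for c :: "('a, complex) chart" and d :: "('b, complex) chart"
      by (rule holomorphic_transform[OF holomorphic_on_ident]) (use that False in auto)
    then have "antiholomorphic_map (underlying_curve M) (underlying_curve N) f"
      unfolding antiholomorphic_map_def mtop_underlying_curve
      using harm_continuous[OF M N harm ld cover] loc by blast
    then show ?thesis ..
  qed
qed

end

theorem proposition4p7:
  fixes R :: "'a complex_curve" and N :: "('b, 2) riemannian" and \<phi> :: "'a \<Rightarrow> 'b"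
  assumes "parabolic_surface R"
    and "oriented_riemannian_surface N"
    and "harmonic_map_from_curve R N \<phi>"
    and "local_diffeomorphism R N \<phi>"
    and "(\<forall>p\<in>topspace (mtop N). gauss_curvature N p > 0) \<or>
         (\<forall>p\<in>topspace (mtop N). gauss_curvature N p \<ge> 0) \<and>
         \<not> (\<exists>V. openin (mtop N) V \<and> V \<noteq> {} \<and> flat_on N V)"
  shows "holomorphic_map R (underlying_curve N) \<phi> \<or> antiholomorphic_map R (underlying_curve N) \<phi>"
proof -
  obtain M :: "('a, 2) riemannian" where M: "oriented_riemannian_surface M" and R: "R = underlying_curve M"
    and harm: "harmonic_map M N \<phi>"
    using assms(3) by (auto simp: harmonic_map_from_curve_def)
  note N = assms(2)
  have ld: "local_diffeomorphism (underlying_curve M) N \<phi>" using assms(4) R by simp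
  have open_R: "open_riemann_surface R" and par: "\<not> hyperbolic_surface R"
    using assms(1) by (auto simp: parabolic_surface_def)
  have con: "connected_space (mtop M)" and ne: "topspace (mtop M) \<noteq> {}"
    and cov: "(\<Union>c\<in>charts R. fst c) = topspace (mtop M)"
    using open_R by (auto simp: open_riemann_surface_def riemann_surface_def maximal_atlas_def R)
  \<comment> \<open>Isothermal charts of \<open>M\<close> exist around every point because
    \<open>R\<close>, which is \<open>underlying_curve M\<close>, is a Riemann surface and its
    charts cover it.\<close>
  have cover: "\<forall>p\<in>topspace (mtop M). \<exists>c. isothermal_chart M c \<and> p \<in> fst c"
    using cov unfolding R charts_underlying_curve by fastforce
  have K: "0 \<le> gauss_curvature N q" if "q \<in> topspace (mtop N)" for q
    using assms(5) that by (auto simp: less_imp_le)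
  note ctx = M N harm ld cover
  have "subharmonic R (ln_distortion M N \<phi>)"
    unfolding R by (rule subharmonic_ln_distortion[OF ctx K])
  moreover have "\<forall>p\<in>topspace (mtop R). ln_distortion M N \<phi> p < 0"
    using ln_distortion_negative[OF ctx] by (simp add: R)
  \<comment> \<open>As \<open>R\<close> is open and not hyperbolic, this negative subharmonic
    function is constant; \<open>k\<close> is an extended real and may be -\<infinity>.\<close>
  ultimately obtain k where k: "\<And>p. p \<in> topspace (mtop M) \<Longrightarrow> ln_distortion M N \<phi> p = k"
    using par open_R unfolding hyperbolic_surface_def by (auto simp: R)
  have conf: "distortion M N \<phi> p = 0" if p: "p \<in> topspace (mtop M)" for p
  proof (rule ccontr)
    assume "distortion M N \<phi> p \<noteq> 0"
    then have pos: "0 < distortion M N \<phi> p" using distortion_bounds(1)[OF ctx p] by simp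
    \<comment> \<open>Positive distortion at one point makes \<open>k\<close> finite, hence the
      distortion is positive at every point.\<close>
    have flat: "gauss_curvature N (\<phi> q) = 0" if q: "q \<in> topspace (mtop M)" for q
    proof (rule constant_distortion_flat[OF ctx q k])
      have "ln_distortion M N \<phi> q = ln_distortion M N \<phi> p" using k p q by simp
      then show "0 < distortion M N \<phi> q" using pos by (auto simp: ln_distortion_def split: if_splits)
    qed
    \<comment> \<open>Every point of the open set V is a value of \<phi>, so the curvature vanishes
      on V. This contradicts positive curvature at \<phi>(p) in one case and the absence of flat
      open sets in the other.\<close>
    obtain W V g where pW: "p \<in> W" and inv: "local_inverse_on M N \<phi> W V g"
      using local_diffeomorphism_inverse[OF M N ld p] by blast
    have W: "openin (mtop M) W" and V: "openin (mtop N) V" "\<phi> p \<in> V"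
      and g: "\<And>q. q \<in> V \<Longrightarrow> g q \<in> W \<and> \<phi> (g q) = q"
      using inv pW unfolding local_inverse_on_def by blast+
    have "gauss_curvature N q = 0" if "q \<in> V" for q
      using flat[of "g q"] g[OF that] openin_subset[OF W] by auto
    then have "flat_on N V" by (simp add: flat_on_def)
    then show False
      using assms(5) V flat[OF p] image_in_N[OF ctx p] by force
  qed
  show ?thesis unfolding R by (rule conformal_imp_holomorphic[OF ctx con conf])
qed

end
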